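(* Suppose that the triple $(R,\Delta,\mathfrak a_\bullet)$ is sharply $F$-pure. Then any finite (scheme-theoretic) union of centers of sharp $F$-purity for $(R,\Delta,\mathfrak a_\bullet)$ forms an $F$-pure subscheme; that is, if $P_1,\dots,P_n\in\operatorname{Spec}R$ are centers of sharp $F$-purity for $(R,\Delta,\mathfrak a_\bullet)$ and $I=\bigcap_{i=1}^n P_i$, then $R/I$ is $F$-pure.
   Context: All rings are commutative, noetherian, excellent, of prime characteristic $p>0$ (they contain a field of characteristic $p$) and $F$-finite (finite as modules over themselves via Frobenius). $F^e_*M$ denotes $M$ viewed as an $R$-module via the $e$-iterated Frobenius. $R^\circ$ is the set of elements of $R$ in no minimal prime. A graded system of ideals $\mathfrak a_\bullet=\{\mathfrak a_i\}_{i\ge 0}$ satisfies $\mathfrak a_i\mathfrak a_j\subseteq\mathfrak a_{i+j}$. A triple $(R,\Delta,\mathfrak a_\bullet)$ consists of a reduced ring $R$, an effective $\mathbb R$-(Weil) divisor $\Delta$ on $\operatorname{Spec}R$, and a graded system of ideals of $R$ such that: $R$ is a normal domain if $\Delta\ne0$; $\mathfrak a_0=R$; $\mathfrak a_i\cap R^\circ\neq\emptyset$ for all $i$. $R(D)$ denotes the global sections of $\mathcal O_{\operatorname{Spec}R}(D)$ (and $R(0)=R$). The triple is sharply $F$-pure if for some $e>0$ there is $d\in\mathfrak a_{p^e-1}$ such that the $R$-linear map $R\to F^e_*R(\lceil (p^e-1)\Delta\rceil)$ sending $1$ to $d$ splits. A ring $A$ is $F$-pure if $A\to F_*A$, $1\mapsto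 1$, splits as a map of $A$-modules. A prime $P\in\operatorname{Spec}R$ is a center of sharp $F$-purity for $(R,\Delta,\mathfrak a_\bullet)$ if for every $f\in PR_P$, every $e>0$ and every $a\in\mathfrak a_{p^e-1}$, the $R_P$-linear map $R_P\to F^e_*R_P(\lceil (p^e-1)\Delta|_{\operatorname{Spec}R_P}\rceil)$ sending $1$ to $fa$ does not split. *)

theory Defs
  imports
    Complex_Main
    "HOL-Library.Extended_Nat"
    "HOL-Computational_Algebra.Primes"
    "HOL-Algebra.Module"
    "HOL-Algebra.Ideal_Product"
    "HOL-Algebra.Polynomials"
begin

section \<open>Localization and total ring of fractions\<close>

definition loc_rel :: "('a, 'm) ring_scheme \<Rightarrow> 'a set \<Rightarrow> (('a \<times> 'a) \<times> ('a \<times> 'a)) set" where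
  "loc_rel R S = {((a, s), (b, t)). a \<in> carrier R \<and> s \<in> S \<and> b \<in> carrier R \<and> t \<in> S \<and>
     (\<exists>u\<in>S. u \<otimes>\<^bsub>R\<^esub> (a \<otimes>\<^bsub>R\<^esub> t) = u \<otimes>\<^bsub>R\<^esub> (b \<otimes>\<^bsub>R\<^esub> s))}"

definition lfrac :: "('a, 'm) ring_scheme \<Rightarrow> 'a set \<Rightarrow> 'a \<Rightarrow> 'a \<Rightarrow> ('a \<times> 'a) set" where
  "lfrac R S a s = loc_rel R S `` {(a, s)}"

definition loc_ring :: "('a, 'm) ring_scheme \<Rightarrow> 'a set \<Rightarrow> ('a \<times> 'a) set ring" where
  "loc_ring R S =
     \<lparr>carrier = {lfrac R S a s | a s. a \<in> carrier R \<and> s \<in> S},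
      monoid.mult = (\<lambda>x y. \<Union>(a, s)\<in>x. \<Union>(b, t)\<in>y. lfrac R S (a \<otimes>\<^bsub>R\<^esub> b) (s \<otimes>\<^bsub>R\<^esub> t)),
      one = lfrac R S \<one>\<^bsub>R\<^esub> \<one>\<^bsub>R\<^esub>,
      ring.zero = lfrac R S \<zero>\<^bsub>R\<^esub> \<one>\<^bsub>R\<^esub>,
      add = (\<lambda>x y. \<Union>(a, s)\<in>x. \<Union>(b, t)\<in>y.
               lfrac R S ((a \<otimes>\<^bsub>R\<^esub> t) \<oplus>\<^bsub>R\<^esub> (b \<otimes>\<^bsub>R\<^esub> s)) (s \<otimes>\<^bsub>R\<^esub> t))\<rparr>"

definition loc_at :: "('a, 'm) ring_scheme \<Rightarrow> 'a set \<Rightarrow> ('a \<times> 'a) set ring" where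
  "loc_at R P = loc_ring R (carrier R - P)"

definition to_loc_at :: "('a, 'm) ring_scheme \<Rightarrow> 'a set \<Rightarrow> 'a \<Rightarrow> ('a \<times> 'a) set" where
  "to_loc_at R P a = lfrac R (carrier R - P) a \<one>\<^bsub>R\<^esub>"

text \<open>The ideal \<open>P R\<^sub>P\<close> of \<open>R\<^sub>P\<close>.\<close>
definition loc_max :: "('a, 'm) ring_scheme \<Rightarrow> 'a set \<Rightarrow> ('a \<times> 'a) set set" where
  "loc_max R P = {lfrac R (carrier R - P) a s | a s. a \<in> P \<and> s \<in> carrier R - P}"

definition nonzerodivisors :: "('a, 'm) ring_scheme \<Rightarrow> 'a set" where
  "nonzerodivisors R =
     {s \<in> carrier R. \<forall>r\<in>carrier R. s \<otimes>\<^bsub>R\<^esub> r = \<zero>\<^bsub>R\<^esub> \<longrightarrow> r = \<zero>\<^bsub>R\<^esub>}"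

text \<open>For a domain, the fraction field.\<close>
definition tot_frac :: "('a, 'm) ring_scheme \<Rightarrow> ('a \<times> 'a) set ring" where
  "tot_frac R = loc_ring R (nonzerodivisors R)"

definition to_tot_frac :: "('a, 'm) ring_scheme \<Rightarrow> 'a \<Rightarrow> ('a \<times> 'a) set" where
  "to_tot_frac R a = lfrac R (nonzerodivisors R) a \<one>\<^bsub>R\<^esub>"


section \<open>Primes, reducedness, normality\<close>

definition prime_chain :: "('a, 'm) ring_scheme \<Rightarrow> nat \<Rightarrow> (nat \<Rightarrow> 'a set) \<Rightarrow> bool" where
  "prime_chain R n c \<longleftrightarrow> (\<forall>i\<le>n. primeideal (c i) R) \<and> (\<forall>i<n. c i \<subset> c (Suc i))"

definition prime_height :: "('a, 'm) ring_scheme \<Rightarrow> 'a set \<Rightarrow> enat" where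
  "prime_height R P = (SUP n\<in>{n. \<exists>c. prime_chain R n c \<and> c n = P}. enat n)"

definition minimal_prime :: "('a, 'm) ring_scheme \<Rightarrow> 'a set \<Rightarrow> bool" where
  "minimal_prime R P \<longleftrightarrow> primeideal P R \<and> (\<forall>Q. primeideal Q R \<and> Q \<subseteq> P \<longrightarrow> Q = P)"

text \<open>The set usually written \<open>R\<^sup>\<circ>\<close>.\<close>
definition ring_circ :: "('a, 'm) ring_scheme \<Rightarrow> 'a set" where
  "ring_circ R = {r \<in> carrier R. \<forall>P. minimal_prime R P \<longrightarrow> r \<notin> P}"

definition reduced_ring :: "('a, 'm) ring_scheme \<Rightarrow> bool" where
  "reduced_ring R \<longleftrightarrow> cring R \<and>
     (\<forall>x\<in>carrier R. \<forall>n::nat. x [^]\<^bsub>R\<^esub> n = \<zero>\<^bsub>R\<^esub> \<longrightarrow> x = \<zero>\<^bsub>R\<^esub>)"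

text \<open>A polynomial is the list of its coefficients, leading coefficient first.\<close>
definition normal_domain :: "('a, 'm) ring_scheme \<Rightarrow> bool" where
  "normal_domain R \<longleftrightarrow> domain R \<and>
     (\<forall>x\<in>carrier (tot_frac R).
        (\<exists>f. f \<noteq> [] \<and> set f \<subseteq> to_tot_frac R ` carrier R \<and> hd f = \<one>\<^bsub>tot_frac R\<^esub> \<and>
             ring.eval (tot_frac R) f x = \<zero>\<^bsub>tot_frac R\<^esub>)
        \<longrightarrow> x \<in> to_tot_frac R ` carrier R)"


section \<open>Modules and Frobenius push-forward\<close>

definition self_module :: "('a, 'm) ring_scheme \<Rightarrow> ('a, 'a) module" where
  "self_module R = \<lparr>carrier = carrier R, monoid.mult = monoid.mult R, one = one R,
                    ring.zero = ring.zero R, add = add R, smult = monoid.mult R\<rparr>"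

text \<open>\<open>F\<^sup>e\<^sub>* M\<close> in characteristic \<open>p\<close>.\<close>
definition frob_push ::
    "nat \<Rightarrow> nat \<Rightarrow> ('a, 'm) ring_scheme \<Rightarrow> ('a, 'b) module \<Rightarrow> ('a, 'b) module" where
  "frob_push p e R M = M\<lparr>smult := (\<lambda>r x. (r [^]\<^bsub>R\<^esub> (p ^ e)) \<odot>\<^bsub>M\<^esub> x)\<rparr>"

definition linear_maps ::
    "('a, 'm) ring_scheme \<Rightarrow> ('a, 'b) module \<Rightarrow> ('a, 'c) module \<Rightarrow> ('b \<Rightarrow> 'c) set" where
  "linear_maps R M N = {\<phi> \<in> carrier M \<rightarrow> carrier N.
     (\<forall>x\<in>carrier M. \<forall>y\<in>carrier M. \<phi> (x \<oplus>\<^bsub>M\<^esub> y) = \<phi> x \<oplus>\<^bsub>N\<^esub> \<phi> y) \<and>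
     (\<forall>r\<in>carrier R. \<forall>x\<in>carrier M. \<phi> (r \<odot>\<^bsub>M\<^esub> x) = r \<odot>\<^bsub>N\<^esub> \<phi> x)}"

text \<open>The \<open>R\<close>-linear map \<open>R \<rightarrow> M\<close> with \<open>1 \<mapsto> d\<close> is \<open>r \<mapsto> r \<cdot> d\<close>; it splits if it has an
  \<open>R\<close>-linear left inverse.\<close>
definition splits_at :: "('a, 'm) ring_scheme \<Rightarrow> ('a, 'b) module \<Rightarrow> 'b \<Rightarrow> bool" where
  "splits_at R M d \<longleftrightarrow>
     (\<exists>\<phi>\<in>linear_maps R M (self_module R). \<forall>r\<in>carrier R. \<phi> (r \<odot>\<^bsub>M\<^esub> d) = r)"

definition fin_gen_module :: "('a, 'm) ring_scheme \<Rightarrow> ('a, 'b) module \<Rightarrow> bool" where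
  "fin_gen_module R M \<longleftrightarrow> (\<exists>B. finite B \<and> B \<subseteq> carrier M \<and>
     (\<forall>x\<in>carrier M. \<exists>c\<in>B \<rightarrow> carrier R. x = (\<Oplus>\<^bsub>M\<^esub>b\<in>B. c b \<odot>\<^bsub>M\<^esub> b)))"

definition F_finite :: "nat \<Rightarrow> ('a, 'm) ring_scheme \<Rightarrow> bool" where
  "F_finite p R \<longleftrightarrow> fin_gen_module R (frob_push p 1 R (self_module R))"


section \<open>Excellent rings\<close>

text \<open>Polynomials in the variables \<open>x\<^sub>0, \<dots>, x\<^bsub>n-1\<^esub>\<close>, as coefficient functions on exponent
  vectors \<open>nat \<Rightarrow> nat\<close> vanishing from \<open>n\<close> on.\<close>
definition mpoly :: "('a, 'm) ring_scheme \<Rightarrow> nat \<Rightarrow> ((nat \<Rightarrow> nat) \<Rightarrow> 'a) ring" where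
  "mpoly R n =
     \<lparr>carrier = {f. (\<forall>m. f m \<in> carrier R) \<and> finite {m. f m \<noteq> \<zero>\<^bsub>R\<^esub>} \<and>
                    (\<forall>m. f m \<noteq> \<zero>\<^bsub>R\<^esub> \<longrightarrow> (\<forall>i\<ge>n. m i = 0))},
      monoid.mult = (\<lambda>f g m. \<Oplus>\<^bsub>R\<^esub>k\<in>{k. \<forall>i. k i \<le> m i}. f k \<otimes>\<^bsub>R\<^esub> g (\<lambda>i. m i - k i)),
      one = (\<lambda>m. if m = (\<lambda>_. 0) then \<one>\<^bsub>R\<^esub> else \<zero>\<^bsub>R\<^esub>),
      ring.zero = (\<lambda>_. \<zero>\<^bsub>R\<^esub>),
      add = (\<lambda>f g m. f m \<oplus>\<^bsub>R\<^esub> g m)\<rparr>"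

definition mpoly_const :: "('a, 'm) ring_scheme \<Rightarrow> 'a \<Rightarrow> (nat \<Rightarrow> nat) \<Rightarrow> 'a" where
  "mpoly_const R a = (\<lambda>m. if m = (\<lambda>_. 0) then a else \<zero>\<^bsub>R\<^esub>)"

definition ideal_pow :: "('a, 'm) ring_scheme \<Rightarrow> 'a set \<Rightarrow> nat \<Rightarrow> 'a set" where
  "ideal_pow R I k = I [^]\<^bsub>ideals_set R\<^esub> k"

text \<open>The \<open>I\<close>-adic completion, as the inverse limit of the rings \<open>R/I\<^sup>k\<close>.\<close>
definition completion :: "('a, 'm) ring_scheme \<Rightarrow> 'a set \<Rightarrow> (nat \<Rightarrow> 'a set) ring" where
  "completion R I =
     \<lparr>carrier = {f. \<forall>k. f k \<in> carrier (R Quot ideal_pow R I k) \<and> f (Suc k) \<subseteq> f k},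
      monoid.mult = (\<lambda>f g k. f k \<otimes>\<^bsub>R Quot ideal_pow R I k\<^esub> g k),
      one = (\<lambda>k. \<one>\<^bsub>R Quot ideal_pow R I k\<^esub>),
      ring.zero = (\<lambda>k. \<zero>\<^bsub>R Quot ideal_pow R I k\<^esub>),
      add = (\<lambda>f g k. f k \<oplus>\<^bsub>R Quot ideal_pow R I k\<^esub> g k)\<rparr>"

definition to_completion :: "('a, 'm) ring_scheme \<Rightarrow> 'a set \<Rightarrow> 'a \<Rightarrow> nat \<Rightarrow> 'a set" where
  "to_completion R I a = (\<lambda>k. ideal_pow R I k +>\<^bsub>R\<^esub> a)"

text \<open>\<open>R\<^sub>P\<close> is a regular local ring (\<open>R\<close> noetherian): its maximal ideal is generated by
  \<open>dim R\<^sub>P\<close> elements.\<close>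
definition regular_at :: "('a, 'm) ring_scheme \<Rightarrow> 'a set \<Rightarrow> bool" where
  "regular_at R P \<longleftrightarrow> (\<exists>B. finite B \<and> B \<subseteq> carrier (loc_at R P) \<and>
     enat (card B) = prime_height (loc_at R P) (loc_max R P) \<and>
     genideal (loc_at R P) B = loc_max R P)"

definition regular_ring :: "('a, 'm) ring_scheme \<Rightarrow> bool" where
  "regular_ring R \<longleftrightarrow> cring R \<and> noetherian_ring R \<and> (\<forall>P. primeideal P R \<longrightarrow> regular_at R P)"

definition open_regular_locus :: "('a, 'm) ring_scheme \<Rightarrow> bool" where
  "open_regular_locus R \<longleftrightarrow>
     (\<exists>K. ideal K R \<and> (\<forall>P. primeideal P R \<longrightarrow> (regular_at R P \<longleftrightarrow> \<not> K \<subseteq> P)))"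

definition saturated_chain :: "('a, 'm) ring_scheme \<Rightarrow> nat \<Rightarrow> (nat \<Rightarrow> 'a set) \<Rightarrow> bool" where
  "saturated_chain R n c \<longleftrightarrow> prime_chain R n c \<and>
     (\<forall>i<n. \<not> (\<exists>Q. primeideal Q R \<and> c i \<subset> Q \<and> Q \<subset> c (Suc i)))"

definition catenary :: "('a, 'm) ring_scheme \<Rightarrow> bool" where
  "catenary R \<longleftrightarrow> (\<forall>m n c d. saturated_chain R m c \<and> saturated_chain R n d \<and>
     c 0 = d 0 \<and> c m = d n \<longrightarrow> m = n)"

text \<open>Up to isomorphism, the finitely generated \<open>R\<close>-algebras are the quotients of the
  polynomial rings \<open>R[x\<^sub>0, \<dots>, x\<^bsub>n-1\<^esub>]\<close>.\<close>
definition universally_catenary :: "('a, 'm) ring_scheme \<Rightarrow> bool" where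
  "universally_catenary R \<longleftrightarrow>
     (\<forall>n J. ideal J (mpoly R n) \<longrightarrow> catenary (mpoly R n Quot J))"

definition J2_ring :: "('a, 'm) ring_scheme \<Rightarrow> bool" where
  "J2_ring R \<longleftrightarrow> (\<forall>n J. ideal J (mpoly R n) \<longrightarrow> open_regular_locus (mpoly R n Quot J))"

text \<open>For a ring \<open>A\<close>, a prime \<open>Q\<close> of \<open>A\<close> and an ideal \<open>J\<close> of \<open>B[x\<^sub>0, \<dots>, x\<^bsub>n-1\<^esub>]\<close>, where
  \<open>h : A \<rightarrow> B\<close> is an \<open>A\<close>-algebra: the localization of \<open>B[x\<^sub>0, \<dots>, x\<^bsub>n-1\<^esub>]/J\<close> at the image of
  \<open>A - Q\<close>.\<close>
definition fibre_alg ::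
    "('a, 'm) ring_scheme \<Rightarrow> 'a set \<Rightarrow> ('b, 'k) ring_scheme \<Rightarrow> ('a \<Rightarrow> 'b) \<Rightarrow> nat \<Rightarrow>
     ((nat \<Rightarrow> nat) \<Rightarrow> 'b) set \<Rightarrow>
     (((nat \<Rightarrow> nat) \<Rightarrow> 'b) set \<times> ((nat \<Rightarrow> nat) \<Rightarrow> 'b) set) set ring" where
  "fibre_alg A Q B h n J =
     loc_ring (mpoly B n Quot J)
       ((\<lambda>a. J +>\<^bsub>mpoly B n\<^esub> mpoly_const B (h a)) ` (carrier A - Q))"

text \<open>All fibres of the \<open>A\<close>-algebra \<open>h : A \<rightarrow> B\<close> are geometrically regular, i.e.
  \<open>B \<otimes>\<^sub>A L\<close> is regular for every prime \<open>Q\<close> of \<open>A\<close> and every finite field extension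
  \<open>L\<close> of the residue field \<open>\<kappa>(Q)\<close>. By Zariski's lemma the finite extensions of \<open>\<kappa>(Q)\<close> are, up
  to isomorphism, the quotients of the rings \<open>\<kappa>(Q)[x\<^sub>0, \<dots>, x\<^bsub>n-1\<^esub>]\<close> that are fields. Such an
  \<open>L\<close> is the localization of \<open>A[x\<^sub>0, \<dots>, x\<^bsub>n-1\<^esub>]/N\<close> at \<open>A - Q\<close>, where \<open>N\<close> is the (prime)
  kernel of \<open>A[x\<^sub>0, \<dots>, x\<^bsub>n-1\<^esub>] \<rightarrow> L\<close> and so lies over \<open>Q\<close>; and \<open>B \<otimes>\<^sub>A L\<close> is the localization
  of \<open>B[x\<^sub>0, \<dots>, x\<^bsub>n-1\<^esub>]/N B[x\<^sub>0, \<dots>, x\<^bsub>n-1\<^esub>]\<close> at the image of \<open>A - Q\<close>.\<close>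
definition geom_regular_fibres ::
    "('a, 'm) ring_scheme \<Rightarrow> ('b, 'k) ring_scheme \<Rightarrow> ('a \<Rightarrow> 'b) \<Rightarrow> bool" where
  "geom_regular_fibres A B h \<longleftrightarrow>
     (\<forall>n Q N. primeideal Q A \<and> primeideal N (mpoly A n) \<and>
        {a \<in> carrier A. mpoly_const A a \<in> N} = Q \<and> field (fibre_alg A Q A id n N) \<longrightarrow>
        regular_ring (fibre_alg A Q B h n (genideal (mpoly B n) ((\<lambda>f. h \<circ> f) ` N))))"

definition G_ring :: "('a, 'm) ring_scheme \<Rightarrow> bool" where
  "G_ring R \<longleftrightarrow> (\<forall>P. primeideal P R \<longrightarrow>
     geom_regular_fibres (loc_at R P) (completion (loc_at R P) (loc_max R P))
       (to_completion (loc_at R P) (loc_max R P)))"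

definition excellent_ring :: "('a, 'm) ring_scheme \<Rightarrow> bool" where
  "excellent_ring R \<longleftrightarrow> cring R \<and> noetherian_ring R \<and> universally_catenary R \<and>
     G_ring R \<and> J2_ring R"


section \<open>Weil divisors\<close>

text \<open>A Weil divisor is a function on sets, supported on finitely many height one primes.\<close>
definition weil_divisor :: "('a, 'm) ring_scheme \<Rightarrow> ('a set \<Rightarrow> 'c::zero) \<Rightarrow> bool" where
  "weil_divisor R D \<longleftrightarrow> finite {Q. D Q \<noteq> 0} \<and>
     (\<forall>Q. D Q \<noteq> 0 \<longrightarrow> primeideal Q R \<and> prime_height R Q = 1)"

definition effective_R_divisor :: "('a, 'm) ring_scheme \<Rightarrow> ('a set \<Rightarrow> real) \<Rightarrow> bool" where
  "effective_R_divisor R \<Delta> \<longleftrightarrow> weil_divisor R \<Delta> \<and> (\<forall>Q. 0 \<le> \<Delta> Q)"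

definition ceil_mult :: "nat \<Rightarrow> ('a set \<Rightarrow> real) \<Rightarrow> 'a set \<Rightarrow> int" where
  "ceil_mult k \<Delta> = (\<lambda>Q. \<lceil>real k * \<Delta> Q\<rceil>)"

text \<open>Restriction to \<open>Spec R\<^sub>P\<close>: the coefficient at a prime of \<open>R\<^sub>P\<close> is the coefficient at
  its contraction to \<open>R\<close>.\<close>
definition restrict_divisor ::
    "('a, 'm) ring_scheme \<Rightarrow> 'a set \<Rightarrow> ('a set \<Rightarrow> 'c::zero) \<Rightarrow> (('a \<times> 'a) set set \<Rightarrow> 'c)" where
  "restrict_divisor R P D = (\<lambda>Q. if primeideal Q (loc_at R P)
     then D {r \<in> carrier R. to_loc_at R P r \<in> Q} else 0)"

text \<open>For \<open>R\<close> a noetherian normal domain, \<open>Q\<close> a prime of height one and \<open>a \<noteq> 0\<close>: the order of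
  \<open>a\<close> in the discrete valuation ring \<open>R\<^sub>Q\<close>.\<close>
definition ord_at :: "('a, 'm) ring_scheme \<Rightarrow> 'a set \<Rightarrow> 'a \<Rightarrow> nat" where
  "ord_at R Q a = (GREATEST n. to_loc_at R Q a \<in> ideal_pow (loc_at R Q) (loc_max R Q) n)"

definition val_at :: "('a, 'm) ring_scheme \<Rightarrow> 'a set \<Rightarrow> ('a \<times> 'a) set \<Rightarrow> int" where
  "val_at R Q x = (THE k. \<exists>a\<in>carrier R - {\<zero>\<^bsub>R\<^esub>}. \<exists>b\<in>carrier R - {\<zero>\<^bsub>R\<^esub>}.
     x = lfrac R (nonzerodivisors R) a b \<and> k = int (ord_at R Q a) - int (ord_at R Q b))"

text \<open>\<open>R(D)\<close> as a subset of the total ring of fractions. For \<open>D = 0\<close> the ring \<open>R\<close> need not be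
  a normal domain, and \<open>R(0)\<close> is the image of \<open>R\<close>; for a noetherian normal domain and \<open>D = 0\<close>
  the two branches agree.\<close>
definition div_sections ::
    "('a, 'm) ring_scheme \<Rightarrow> ('a set \<Rightarrow> int) \<Rightarrow> ('a \<times> 'a) set set" where
  "div_sections R D =
     (if D = (\<lambda>_. 0) then to_tot_frac R ` carrier R
      else {x \<in> carrier (tot_frac R). x \<noteq> \<zero>\<^bsub>tot_frac R\<^esub> \<longrightarrow>
              (\<forall>Q. primeideal Q R \<and> prime_height R Q = 1 \<longrightarrow> 0 \<le> val_at R Q x + D Q)})"

definition div_module ::
    "('a, 'm) ring_scheme \<Rightarrow> ('a set \<Rightarrow> int) \<Rightarrow> ('a, ('a \<times> 'a) set) module" where
  "div_module R D =
     \<lparr>carrier = div_sections R D, monoid.mult = monoid.mult (tot_frac R), one = one (tot_frac R),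
      ring.zero = ring.zero (tot_frac R), add = add (tot_frac R),
      smult = (\<lambda>r x. to_tot_frac R r \<otimes>\<^bsub>tot_frac R\<^esub> x)\<rparr>"


section \<open>Triples, sharp F-purity and its centers\<close>

definition base_ring :: "nat \<Rightarrow> ('a, 'm) ring_scheme \<Rightarrow> bool" where
  "base_ring p R \<longleftrightarrow> cring R \<and> noetherian_ring R \<and> excellent_ring R \<and>
     Factorial_Ring.prime p \<and> \<one>\<^bsub>R\<^esub> \<noteq> \<zero>\<^bsub>R\<^esub> \<and> add_pow R p \<one>\<^bsub>R\<^esub> = \<zero>\<^bsub>R\<^esub> \<and> F_finite p R"

definition graded_system :: "('a, 'm) ring_scheme \<Rightarrow> (nat \<Rightarrow> 'a set) \<Rightarrow> bool" where
  "graded_system R \<aa> \<longleftrightarrow> (\<forall>i. ideal (\<aa> i) R) \<and>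
     (\<forall>i j. ideal_prod R (\<aa> i) (\<aa> j) \<subseteq> \<aa> (i + j))"

definition is_triple ::
    "('a, 'm) ring_scheme \<Rightarrow> ('a set \<Rightarrow> real) \<Rightarrow> (nat \<Rightarrow> 'a set) \<Rightarrow> bool" where
  "is_triple R \<Delta> \<aa> \<longleftrightarrow> reduced_ring R \<and> effective_R_divisor R \<Delta> \<and> graded_system R \<aa> \<and>
     (\<Delta> \<noteq> (\<lambda>_. 0) \<longrightarrow> normal_domain R) \<and> \<aa> 0 = carrier R \<and>
     (\<forall>i. \<aa> i \<inter> ring_circ R \<noteq> {})"

definition sharply_F_pure ::
    "nat \<Rightarrow> ('a, 'm) ring_scheme \<Rightarrow> ('a set \<Rightarrow> real) \<Rightarrow> (nat \<Rightarrow> 'a set) \<Rightarrow> bool" where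
  "sharply_F_pure p R \<Delta> \<aa> \<longleftrightarrow> (\<exists>e>0. \<exists>d\<in>\<aa> (p ^ e - 1).
     splits_at R (frob_push p e R (div_module R (ceil_mult (p ^ e - 1) \<Delta>))) (to_tot_frac R d))"

definition F_pure :: "nat \<Rightarrow> ('a, 'm) ring_scheme \<Rightarrow> bool" where
  "F_pure p R \<longleftrightarrow> splits_at R (frob_push p 1 R (self_module R)) \<one>\<^bsub>R\<^esub>"

definition center_sharp_F_purity ::
    "nat \<Rightarrow> ('a, 'm) ring_scheme \<Rightarrow> ('a set \<Rightarrow> real) \<Rightarrow> (nat \<Rightarrow> 'a set) \<Rightarrow> 'a set \<Rightarrow> bool" where
  "center_sharp_F_purity p R \<Delta> \<aa> P \<longleftrightarrow> primeideal P R \<and>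
     (\<forall>f\<in>loc_max R P. \<forall>e>0. \<forall>a\<in>\<aa> (p ^ e - 1).
        \<not> splits_at (loc_at R P)
            (frob_push p e (loc_at R P)
               (div_module (loc_at R P) (ceil_mult (p ^ e - 1) (restrict_divisor R P \<Delta>))))
            (to_tot_frac (loc_at R P) (f \<otimes>\<^bsub>loc_at R P\<^esub> to_loc_at R P a)))"

end

theory Submission
  imports Defs
begin

text \<open>
  Sharp F-purity provides \<open>e > 0\<close>, an element \<open>d\<close> of \<open>\<aa>\<close> in degree \<open>p\<^sup>e - 1\<close> and a \<open>p\<^sup>e\<close>-inverse
  linear map \<open>\<phi>\<close> from \<open>R(D)\<close> to \<open>R\<close>, where \<open>D\<close> is the round-up of \<open>(p\<^sup>e - 1) \<Delta>\<close>, with \<open>\<phi> d = 1\<close>. Since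
  \<open>D\<close> is effective, \<open>\<psi> x = \<phi> (d x)\<close> is defined on all of \<open>R\<close> and splits the \<open>e\<close>-fold Frobenius.

  The point is that \<open>\<psi>\<close> maps each center \<open>P\<close> into itself (\<open>center_compatible\<close>). Suppose that
  \<open>u = \<phi> (d f)\<close> is not in \<open>P\<close> for some \<open>f \<in> P\<close>. Then \<open>u\<close> is a unit of \<open>R\<^sub>P\<close>, and the localization of \<open>\<phi>\<close>
  at \<open>P\<close>, divided by \<open>u\<close>, sends \<open>d f\<close> to \<open>1\<close>; so it splits a map that does not split because \<open>P\<close> is a
  center. Hence \<open>\<psi>\<close> maps the intersection \<open>I\<close> of the centers into itself and induces a splitting of the
  \<open>e\<close>-fold Frobenius of \<open>R / I\<close>. As the \<open>e\<close>-fold Frobenius factors through Frobenius, \<open>R / I\<close> is F-pure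
  (\<open>F_pure_quotient\<close>).

  Two things need work. One is the localization of \<open>\<phi>\<close>, where \<open>y / s\<close> must be sent to
  \<open>\<phi> (s\<^bsup>q-1\<^esup> y) / s\<close> with \<open>q = p\<^sup>e\<close> (locale \<open>cartier_map\<close>). The other is that sections of the
  restricted divisor over \<open>R\<^sub>P\<close> lie in the localization of \<open>R(D)\<close> (\<open>local_section_clearable\<close>). If
  \<open>D\<close> is zero this is clear. Otherwise \<open>R\<close> is a noetherian normal domain; its localizations at primes of
  height one are discrete valuation rings (\<open>ex_uniformizer\<close>), so that being a section becomes
  a condition on poles along each such prime. These conditions are compared over \<open>R\<close> and \<open>R\<^sub>P\<close> for the primes
  inside \<open>P\<close>, and the finitely many poles along other primes are removed by a factor outside \<open>P\<close>
  (\<open>clear_poles_away_from\<close>).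
\<close>

section \<open>Rings of fractions\<close>

locale localizing = cring +
  fixes S
  assumes S_sub: "S \<subseteq> carrier R"
    and S_one: "\<one> \<in> S"
    and S_mult: "s \<in> S \<Longrightarrow> t \<in> S \<Longrightarrow> s \<otimes> t \<in> S"
begin

lemma S_carr [simp]: "s \<in> S \<Longrightarrow> s \<in> carrier R"
  using S_sub by blast

abbreviation "fr \<equiv> lfrac R S"
abbreviation "L \<equiv> loc_ring R S"

lemma equiv_loc_rel: "equiv (carrier R \<times> S) (loc_rel R S)"
proof (rule equivI)
  show "loc_rel R S \<subseteq> (carrier R \<times> S) \<times> (carrier R \<times> S)"
    by (auto simp: loc_rel_def)
  show "refl_on (carrier R \<times> S) (loc_rel R S)"
    using S_one by (auto simp: refl_on_def loc_rel_def)
  show "sym (loc_rel R S)"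
    by (rule symI) (auto simp: loc_rel_def, metis)
  show "trans (loc_rel R S)"
  proof (rule transI, clarify)
    fix a s b t c r
    assume "((a, s), (b, t)) \<in> loc_rel R S" "((b, t), (c, r)) \<in> loc_rel R S"
    then obtain u v where c: "a \<in> carrier R" "s \<in> S" "b \<in> carrier R" "t \<in> S" "c \<in> carrier R" "r \<in> S"
      and uv: "u \<in> S" "v \<in> S" and eu: "u \<otimes> (a \<otimes> t) = u \<otimes> (b \<otimes> s)"
      and ev: "v \<otimes> (b \<otimes> r) = v \<otimes> (c \<otimes> t)"
      unfolding loc_rel_def by auto
    have "(u \<otimes> v \<otimes> t) \<otimes> (a \<otimes> r) = (v \<otimes> r) \<otimes> (u \<otimes> (a \<otimes> t))"
      using c uv by (simp add: m_ac)
    also have "\<dots> = (u \<otimes> s) \<otimes> (v \<otimes> (b \<otimes> r))"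
      unfolding eu using c uv by (simp add: m_ac)
    also have "\<dots> = (u \<otimes> v \<otimes> t) \<otimes> (c \<otimes> s)"
      unfolding ev using c uv by (simp add: m_ac)
    finally show "((a, s), (c, r)) \<in> loc_rel R S"
      unfolding loc_rel_def using c uv S_mult by blast
  qed
qed

lemma lfrac_eq_iff:
  assumes "a \<in> carrier R" "s \<in> S" "b \<in> carrier R" "t \<in> S"
  shows "fr a s = fr b t \<longleftrightarrow> (\<exists>u\<in>S. u \<otimes> (a \<otimes> t) = u \<otimes> (b \<otimes> s))"
  unfolding lfrac_def using assms
  by (subst eq_equiv_class_iff[OF equiv_loc_rel]) (auto simp: loc_rel_def)

lemma lfrac_eqI:
  assumes "a \<in> carrier R" "s \<in> S" "b \<in> carrier R" "t \<in> S" "a \<otimes> t = b \<otimes> s"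
  shows "fr a s = fr b t"
  using assms S_one lfrac_eq_iff by auto

lemma lfrac_self: "a \<in> carrier R \<Longrightarrow> s \<in> S \<Longrightarrow> (a, s) \<in> fr a s"
  unfolding lfrac_def using equiv_class_self[OF equiv_loc_rel] by simp

lemma lfrac_memD:
  assumes "(b, t) \<in> fr a s"
  shows "b \<in> carrier R" "t \<in> S" "fr b t = fr a s"
  using assms equiv_class_eq[OF equiv_loc_rel, of "(a, s)" "(b, t)"]
  by (auto simp: lfrac_def loc_rel_def)

text \<open>The operations of \<^const>\<open>loc_ring\<close> are unions over all representatives of the two
  arguments; such a union collapses as soon as every choice of representatives gives the same
  class.\<close>

lemma UN_lfrac2:
  assumes "a \<in> carrier R" "s \<in> S" "b \<in> carrier R" "t \<in> S"
    and "\<And>a' s' b' t'. (a', s') \<in> fr a s \<Longrightarrow> (b', t') \<in> fr b t \<Longrightarrow> F a' s' b' t' = F a s b t"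
  shows "(\<Union>(a', s')\<in>fr a s. \<Union>(b', t')\<in>fr b t. F a' s' b' t') = F a s b t"
proof -
  have "(\<Union>(a', s')\<in>fr a s. \<Union>(b', t')\<in>fr b t. F a' s' b' t')
      = (\<Union>x\<in>fr a s. \<Union>y\<in>fr b t. F a s b t)"
    using assms(5) by (intro SUP_cong) auto
  also have "\<dots> = F a s b t" using lfrac_self[OF assms(1,2)] lfrac_self[OF assms(3,4)] by auto
  finally show ?thesis .
qed

lemma lfrac_cross:
  assumes "(a', s') \<in> fr a s" "a \<in> carrier R" "s \<in> S"
  obtains u where "u \<in> S" "u \<otimes> (a' \<otimes> s) = u \<otimes> (a \<otimes> s')"
  using lfrac_memD[OF assms(1)] lfrac_eq_iff assms(2,3) by blast

lemma lfrac_mult: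
  assumes "a \<in> carrier R" "s \<in> S" "b \<in> carrier R" "t \<in> S"
  shows "fr a s \<otimes>\<^bsub>L\<^esub> fr b t = fr (a \<otimes> b) (s \<otimes> t)"
proof -
  have "fr (a' \<otimes> b') (s' \<otimes> t') = fr (a \<otimes> b) (s \<otimes> t)"
    if m: "(a', s') \<in> fr a s" "(b', t') \<in> fr b t" for a' s' b' t'
  proof -
    obtain u where u: "u \<in> S" "u \<otimes> (a' \<otimes> s) = u \<otimes> (a \<otimes> s')" using lfrac_cross m(1) assms by metis
    obtain v where v: "v \<in> S" "v \<otimes> (b' \<otimes> t) = v \<otimes> (b \<otimes> t')" using lfrac_cross m(2) assms by metis
    note c = lfrac_memD[OF m(1)] lfrac_memD[OF m(2)]
    have "(u \<otimes> v) \<otimes> ((a' \<otimes> b') \<otimes> (s \<otimes> t)) = (u \<otimes> (a' \<otimes> s)) \<otimes> (v \<otimes> (b' \<otimes> t))"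
      using c assms u(1) v(1) by (simp add: m_ac)
    also have "\<dots> = (u \<otimes> v) \<otimes> ((a \<otimes> b) \<otimes> (s' \<otimes> t'))"
      unfolding u v using c assms u(1) v(1) by (simp add: m_ac)
    finally show ?thesis using c assms u(1) v(1) S_mult by (subst lfrac_eq_iff) auto
  qed
  then show ?thesis using UN_lfrac2[OF assms, of "\<lambda>a s b t. fr (a \<otimes> b) (s \<otimes> t)"]
    by (simp add: loc_ring_def)
qed

lemma lfrac_add:
  assumes "a \<in> carrier R" "s \<in> S" "b \<in> carrier R" "t \<in> S"
  shows "fr a s \<oplus>\<^bsub>L\<^esub> fr b t = fr (a \<otimes> t \<oplus> b \<otimes> s) (s \<otimes> t)"
proof -
  have "fr (a' \<otimes> t' \<oplus> b' \<otimes> s') (s' \<otimes> t') = fr (a \<otimes> t \<oplus> b \<otimes> s) (s \<otimes> t)"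
    if m: "(a', s') \<in> fr a s" "(b', t') \<in> fr b t" for a' s' b' t'
  proof -
    obtain u where u: "u \<in> S" "u \<otimes> (a' \<otimes> s) = u \<otimes> (a \<otimes> s')" using lfrac_cross m(1) assms by metis
    obtain v where v: "v \<in> S" "v \<otimes> (b' \<otimes> t) = v \<otimes> (b \<otimes> t')" using lfrac_cross m(2) assms by metis
    note c = lfrac_memD[OF m(1)] lfrac_memD[OF m(2)]
    have "(u \<otimes> v) \<otimes> ((a' \<otimes> t' \<oplus> b' \<otimes> s') \<otimes> (s \<otimes> t))
        = (u \<otimes> (a' \<otimes> s)) \<otimes> (v \<otimes> t \<otimes> t') \<oplus> (v \<otimes> (b' \<otimes> t)) \<otimes> (u \<otimes> s \<otimes> s')"
      using c assms u(1) v(1) by (simp add: m_ac l_distr r_distr)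
    also have "\<dots> = (u \<otimes> v) \<otimes> ((a \<otimes> t \<oplus> b \<otimes> s) \<otimes> (s' \<otimes> t'))"
      unfolding u v using c assms u(1) v(1) by (simp add: m_ac l_distr r_distr)
    finally show ?thesis using c assms u(1) v(1) S_mult by (subst lfrac_eq_iff) auto
  qed
  then show ?thesis using UN_lfrac2[OF assms, of "\<lambda>a s b t. fr (a \<otimes> t \<oplus> b \<otimes> s) (s \<otimes> t)"]
    by (simp add: loc_ring_def)
qed

lemma lfrac_in: "a \<in> carrier R \<Longrightarrow> s \<in> S \<Longrightarrow> fr a s \<in> carrier L"
  by (auto simp: loc_ring_def)

lemma loc_cases:
  assumes "x \<in> carrier L" obtains a s where "a \<in> carrier R" "s \<in> S" "x = fr a s"
  using assms by (auto simp: loc_ring_def)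

lemma loc_one: "\<one>\<^bsub>L\<^esub> = fr \<one> \<one>" and loc_zero: "\<zero>\<^bsub>L\<^esub> = fr \<zero> \<one>"
  by (simp_all add: loc_ring_def)

lemma loc_cring: "cring L"
proof (rule cringI)
  note S_one[simp] S_mult[simp] lfrac_in[simp]
  show "abelian_group L"
  proof (rule abelian_groupI)
    fix x y assume x: "x \<in> carrier L" and y: "y \<in> carrier L"
    obtain a s where as: "a \<in> carrier R" "s \<in> S" "x = fr a s" using x by (rule loc_cases)
    obtain b t where bt: "b \<in> carrier R" "t \<in> S" "y = fr b t" using y by (rule loc_cases)
    show "x \<oplus>\<^bsub>L\<^esub> y \<in> carrier L" using as bt by (simp add: lfrac_add)
    show "x \<oplus>\<^bsub>L\<^esub> y = y \<oplus>\<^bsub>L\<^esub> x" using as bt by (simp add: lfrac_add m_ac a_ac)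
    show "\<zero>\<^bsub>L\<^esub> \<oplus>\<^bsub>L\<^esub> x = x" using as by (simp add: lfrac_add loc_zero)
    have "fr (\<ominus> a) s \<oplus>\<^bsub>L\<^esub> x = \<zero>\<^bsub>L\<^esub>"
      using as by (simp add: lfrac_add loc_zero, intro lfrac_eqI) (simp_all add: l_minus l_neg)
    then show "\<exists>z\<in>carrier L. z \<oplus>\<^bsub>L\<^esub> x = \<zero>\<^bsub>L\<^esub>" using as by (meson a_inv_closed lfrac_in)
    fix z assume z: "z \<in> carrier L"
    obtain c r where cr: "c \<in> carrier R" "r \<in> S" "z = fr c r" using z by (rule loc_cases)
    show "x \<oplus>\<^bsub>L\<^esub> y \<oplus>\<^bsub>L\<^esub> z = x \<oplus>\<^bsub>L\<^esub> (y \<oplus>\<^bsub>L\<^esub> z)"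
      using as bt cr by (simp add: lfrac_add m_ac a_ac l_distr r_distr)
  qed (simp add: loc_zero)
  show "comm_monoid L"
  proof (rule comm_monoidI)
    fix x y assume x: "x \<in> carrier L" and y: "y \<in> carrier L"
    obtain a s where as: "a \<in> carrier R" "s \<in> S" "x = fr a s" using x by (rule loc_cases)
    obtain b t where bt: "b \<in> carrier R" "t \<in> S" "y = fr b t" using y by (rule loc_cases)
    show "x \<otimes>\<^bsub>L\<^esub> y \<in> carrier L" using as bt by (simp add: lfrac_mult)
    show "x \<otimes>\<^bsub>L\<^esub> y = y \<otimes>\<^bsub>L\<^esub> x" using as bt by (simp add: lfrac_mult m_ac)
    show "\<one>\<^bsub>L\<^esub> \<otimes>\<^bsub>L\<^esub> x = x" using as by (simp add: lfrac_mult loc_one)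
    fix z assume z: "z \<in> carrier L"
    obtain c r where cr: "c \<in> carrier R" "r \<in> S" "z = fr c r" using z by (rule loc_cases)
    show "x \<otimes>\<^bsub>L\<^esub> y \<otimes>\<^bsub>L\<^esub> z = x \<otimes>\<^bsub>L\<^esub> (y \<otimes>\<^bsub>L\<^esub> z)"
      using as bt cr by (simp add: lfrac_mult m_ac)
  qed (simp add: loc_one)
  fix x y z assume x: "x \<in> carrier L" and y: "y \<in> carrier L" and z: "z \<in> carrier L"
  obtain a s where as: "a \<in> carrier R" "s \<in> S" "x = fr a s" using x by (rule loc_cases)
  obtain b t where bt: "b \<in> carrier R" "t \<in> S" "y = fr b t" using y by (rule loc_cases)
  obtain c r where cr: "c \<in> carrier R" "r \<in> S" "z = fr c r" using z by (rule loc_cases)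
  show "(x \<oplus>\<^bsub>L\<^esub> y) \<otimes>\<^bsub>L\<^esub> z = x \<otimes>\<^bsub>L\<^esub> z \<oplus>\<^bsub>L\<^esub> y \<otimes>\<^bsub>L\<^esub> z"
  proof -
    let ?N = "(a \<otimes> t \<oplus> b \<otimes> s) \<otimes> c"
    have N: "a \<otimes> c \<otimes> (t \<otimes> r) \<oplus> b \<otimes> c \<otimes> (s \<otimes> r) = ?N \<otimes> r"
      using as(1,2) bt(1,2) cr(1,2) by (simp add: m_ac l_distr r_distr)
    have "?N \<in> carrier R" using as(1,2) bt(1,2) cr(1,2) by simp
    moreover have "w \<otimes> (s \<otimes> r \<otimes> (t \<otimes> r)) = w \<otimes> r \<otimes> (s \<otimes> t \<otimes> r)" if "w \<in> carrier R" for w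
      using that as(1,2) bt(1,2) cr(1,2) by (simp add: m_ac)
    ultimately show ?thesis
      using as bt cr by (simp add: lfrac_mult lfrac_add N, intro lfrac_eqI) simp_all
  qed
qed

sublocale L: cring L
  by (rule loc_cring)

lemma to_loc_hom: "(\<lambda>a. fr a \<one>) \<in> ring_hom R L"
  by (rule ring_hom_memI) (simp_all add: lfrac_in S_one lfrac_mult lfrac_add loc_one)

lemma lfrac_pow:
  assumes "a \<in> carrier R" "s \<in> S"
  shows "s [^] (n::nat) \<in> S" "fr a s [^]\<^bsub>L\<^esub> n = fr (a [^] n) (s [^] n)"
proof -
  have "s [^] n \<in> S \<and> fr a s [^]\<^bsub>L\<^esub> n = fr (a [^] n) (s [^] n)"
    by (induction n) (simp_all add: assms S_one S_mult loc_one lfrac_mult)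
  then show "s [^] (n::nat) \<in> S" "fr a s [^]\<^bsub>L\<^esub> n = fr (a [^] n) (s [^] n)" by auto
qed

lemma lfrac_eq_zero_iff:
  assumes "a \<in> carrier R" "s \<in> S"
  shows "fr a s = \<zero>\<^bsub>L\<^esub> \<longleftrightarrow> (\<exists>u\<in>S. u \<otimes> a = \<zero>)"
  unfolding loc_zero using assms S_one by (subst lfrac_eq_iff) auto

lemma lfrac_mult_denominator:
  assumes "a \<in> carrier R" "s \<in> S"
  shows "fr s \<one> \<otimes>\<^bsub>L\<^esub> fr a s = fr a \<one>"
proof -
  have "fr s \<one> \<otimes>\<^bsub>L\<^esub> fr a s = fr (s \<otimes> a) (\<one> \<otimes> s)"
    using assms S_one by (intro lfrac_mult) auto
  also have "\<dots> = fr a \<one>"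
    using assms S_one by (intro lfrac_eqI) (auto simp: m_comm)
  finally show ?thesis .
qed

text \<open>When \<open>S\<close> is \<open>carrier R - P\<close>, the condition of this rule contains its own conclusion, so as a
  rewrite rule it would loop.\<close>

declare S_carr [simp del]

end

lemma (in primeideal) localizing_compl: "localizing R (carrier R - I)"
proof -
  have "\<one> \<notin> I" using I_notcarr one_imp_carrier by blast
  then show ?thesis by unfold_locales (auto dest: I_prime)
qed

lemma (in cring) localizing_nonzerodivisors: "localizing R (nonzerodivisors R)"
proof unfold_locales
  fix s t assume s: "s \<in> nonzerodivisors R" and t: "t \<in> nonzerodivisors R"
  show "s \<otimes> t \<in> nonzerodivisors R"
    unfolding nonzerodivisors_def
  proof (intro CollectI conjI ballI impI)
    have c: "s \<in> carrier R" "t \<in> carrier R" using s t by (auto simp: nonzerodivisors_def)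
    then show "s \<otimes> t \<in> carrier R" by simp
    fix r assume r: "r \<in> carrier R" "s \<otimes> t \<otimes> r = \<zero>"
    then have "s \<otimes> (t \<otimes> r) = \<zero>" using c by (simp add: m_assoc)
    then have "t \<otimes> r = \<zero>" using s c r unfolding nonzerodivisors_def by blast
    then show "r = \<zero>" using t r unfolding nonzerodivisors_def by blast
  qed
qed (auto simp: nonzerodivisors_def)

lemma (in "domain") nonzerodivisors_domain: "nonzerodivisors R = carrier R - {\<zero>}"
  unfolding nonzerodivisors_def using integral by fastforce

text \<open>The map of rings of fractions induced by a ring homomorphism \<open>h\<close>. A fraction is a class of
  pairs; \<open>h\<close> is applied to a chosen pair, and the result does not depend on the choice when \<open>h\<close>
  carries the old denominators to new ones.\<close>

definition frac_map ::
    "('b, 'k) ring_scheme \<Rightarrow> 'b set \<Rightarrow> ('a \<Rightarrow> 'b) \<Rightarrow> ('a \<times> 'a) set \<Rightarrow> ('b \<times> 'b) set" where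
  "frac_map B S' h x = (let p = SOME p. p \<in> x in lfrac B S' (h (fst p)) (h (snd p)))"

lemma
  assumes "localizing R S" "localizing B S'" and h: "h \<in> ring_hom R B" and hS: "h ` S \<subseteq> S'"
  shows frac_map_lfrac: "\<And>a s. a \<in> carrier R \<Longrightarrow> s \<in> S \<Longrightarrow>
      frac_map B S' h (lfrac R S a s) = lfrac B S' (h a) (h s)"
    and frac_map_hom: "frac_map B S' h \<in> ring_hom (loc_ring R S) (loc_ring B S')"
proof -
  interpret A: localizing R S by fact
  interpret B: localizing B S' by fact
  have hc: "\<And>s. s \<in> S \<Longrightarrow> h s \<in> S'" "\<And>a. a \<in> carrier R \<Longrightarrow> h a \<in> carrier B"
    using hS ring_hom_closed[OF h] by auto
  note A.S_carr[simp] B.S_carr[simp]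
  show eq: "frac_map B S' h (lfrac R S a s) = lfrac B S' (h a) (h s)"
    if as: "a \<in> carrier R" "s \<in> S" for a s
  proof -
    define p where "p = (SOME p. p \<in> lfrac R S a s)"
    have p: "(fst p, snd p) \<in> lfrac R S a s"
      unfolding p_def using A.lfrac_self[OF as] by (metis prod.collapse someI_ex)
    note c = A.lfrac_memD[OF p]
    obtain u where u: "u \<in> S" "u \<otimes>\<^bsub>R\<^esub> (fst p \<otimes>\<^bsub>R\<^esub> s) = u \<otimes>\<^bsub>R\<^esub> (a \<otimes>\<^bsub>R\<^esub> snd p)"
      using A.lfrac_cross[OF p as] by blast
    have "h u \<otimes>\<^bsub>B\<^esub> (h (fst p) \<otimes>\<^bsub>B\<^esub> h s) = h u \<otimes>\<^bsub>B\<^esub> (h a \<otimes>\<^bsub>B\<^esub> h (snd p))"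
      using arg_cong[OF u(2), of h] c u(1) as by (simp add: ring_hom_mult[OF h])
    then have "lfrac B S' (h (fst p)) (h (snd p)) = lfrac B S' (h a) (h s)"
      using c u(1) as hc by (subst B.lfrac_eq_iff) auto
    then show ?thesis by (simp add: frac_map_def p_def)
  qed
  show "frac_map B S' h \<in> ring_hom (loc_ring R S) (loc_ring B S')"
  proof (rule ring_hom_memI)
    fix x y assume x: "x \<in> carrier A.L" and y: "y \<in> carrier A.L"
    obtain a s where as: "a \<in> carrier R" "s \<in> S" "x = A.fr a s" using x by (rule A.loc_cases)
    obtain b t where bt: "b \<in> carrier R" "t \<in> S" "y = A.fr b t" using y by (rule A.loc_cases)
    show "frac_map B S' h x \<in> carrier B.L" using as by (simp add: eq B.lfrac_in hc)
    show "frac_map B S' h (x \<otimes>\<^bsub>A.L\<^esub> y) = frac_map B S' h x \<otimes>\<^bsub>B.L\<^esub> frac_map B S' h y"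
      using as bt A.S_mult hc
      by (simp add: eq A.lfrac_mult B.lfrac_mult ring_hom_mult[OF h])
    show "frac_map B S' h (x \<oplus>\<^bsub>A.L\<^esub> y) = frac_map B S' h x \<oplus>\<^bsub>B.L\<^esub> frac_map B S' h y"
      using as bt A.S_mult hc
      by (simp add: eq A.lfrac_add B.lfrac_add ring_hom_mult[OF h] ring_hom_add[OF h])
  next
    show "frac_map B S' h \<one>\<^bsub>A.L\<^esub> = \<one>\<^bsub>B.L\<^esub>"
      using A.S_one by (simp add: A.loc_one B.loc_one eq ring_hom_one[OF h])
  qed
qed

section \<open>Powers and Frobenius in a commutative ring\<close>

lemma (in cring) nat_pow_pred_mult:
  assumes "x \<in> carrier R" and "0 < (q::nat)"
  shows "x [^] (q - 1) \<otimes> x = x [^] q"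
  using assms by (metis Suc_diff_1 nat_pow_Suc)

lemma (in cring) binomial_expansion:
  assumes [simp]: "a \<in> carrier R" "b \<in> carrier R"
  shows "(a \<oplus> b) [^] n = (\<Oplus>k\<in>{..n}. [(n choose k)] \<cdot> (a [^] k \<otimes> b [^] (n - k)))"
proof (induction n)
  case 0 show ?case by simp
next
  case (Suc n)
  let ?S = "\<Oplus>k\<in>{..n}. [(n choose k)] \<cdot> (a [^] k \<otimes> b [^] (n - k))"
  have A: "a \<otimes> ?S = (\<Oplus>k\<in>{..n}. [(n choose k)] \<cdot> (a [^] Suc k \<otimes> b [^] (n - k)))"
    by (subst finsum_rdistr)
       (auto intro!: finsum_cong' simp: add_pow_rdistr m_ac)
  have "b \<otimes> ?S = (\<Oplus>k\<in>{..n}. [(n choose k)] \<cdot> (a [^] k \<otimes> b [^] (Suc n - k)))"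
    by (subst finsum_rdistr)
       (auto intro!: finsum_cong' simp: add_pow_rdistr m_ac Suc_diff_le)
  also have "\<dots> = (\<Oplus>k\<in>{..Suc n}. [(n choose k)] \<cdot> (a [^] k \<otimes> b [^] (Suc n - k)))"
    by (subst finsum_Suc) (auto simp: binomial_eq_0)
  also have "\<dots> = (\<Oplus>k\<in>{..n}. [(n choose Suc k)] \<cdot> (a [^] Suc k \<otimes> b [^] (n - k))) \<oplus> b [^] Suc n"
    by (subst finsum_Suc2) (auto simp: del: nat_pow_Suc)
  finally have B: "b \<otimes> ?S = \<dots>" .
  have "(a \<oplus> b) [^] Suc n = a \<otimes> ?S \<oplus> b \<otimes> ?S"
    using Suc by (simp add: m_comm[of ?S] l_distr)
  also have "\<dots> = (\<Oplus>k\<in>{..n}. [(Suc n choose Suc k)] \<cdot> (a [^] Suc k \<otimes> b [^] (n - k))) \<oplus> b [^] Suc n"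
    unfolding A B
    by (subst a_assoc[symmetric]) (auto simp: finsum_addf[symmetric] add.nat_pow_mult
          simp del: nat_pow_Suc)
  also have "\<dots> = (\<Oplus>k\<in>{..Suc n}. [(Suc n choose k)] \<cdot> (a [^] k \<otimes> b [^] (Suc n - k)))"
    by (subst finsum_Suc2) (auto simp: simp del: nat_pow_Suc binomial_Suc_Suc)
  finally show ?case .
qed

text \<open>All the inner binomial coefficients are divisible by \<open>p\<close>, hence vanish in \<open>R\<close>.\<close>

lemma (in cring) frobenius_add:
  assumes p: "Factorial_Ring.prime (p::nat)" "[p] \<cdot> \<one> = \<zero>"
    and [simp]: "a \<in> carrier R" "b \<in> carrier R"
  shows "(a \<oplus> b) [^] p = a [^] p \<oplus> b [^] p"
proof -
  have z: "[(p choose k)] \<cdot> x = \<zero>" if "0 < k" "k < p" "x \<in> carrier R" for k x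
  proof -
    have "p dvd (p choose k)" using that p(1) by (intro dvd_choose_prime) auto
    then obtain m where m: "p choose k = p * m" by (rule dvdE)
    have "[p] \<cdot> x = ([p] \<cdot> \<one>) \<otimes> x" using that(3) by (simp add: add_pow_ldistr)
    then have "[p] \<cdot> x = \<zero>" using p(2) that(3) by simp
    moreover have "[(p * m)] \<cdot> x = [m] \<cdot> ([p] \<cdot> x)"
      using add.nat_pow_pow[OF that(3), of m p] by simp
    ultimately show ?thesis unfolding m by simp
  qed
  have p1: "1 < p" using p(1) prime_gt_1_nat by blast
  obtain n where n: "p = Suc (Suc n)" using less_imp_Suc_add[OF p1] by auto
  have "(a \<oplus> b) [^] p = (\<Oplus>k\<in>{..Suc (Suc n)}. [(p choose k)] \<cdot> (a [^] k \<otimes> b [^] (p - k)))"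
    using binomial_expansion[of a b p] by (simp add: n)
  also have "\<dots> = a [^] p \<oplus> ((\<Oplus>k\<in>{..n}. [(p choose Suc k)] \<cdot> (a [^] Suc k \<otimes> b [^] (p - Suc k))) \<oplus> b [^] p)"
    by (subst finsum_Suc, simp, subst finsum_Suc2) (auto simp: n simp del: nat_pow_Suc binomial_Suc_Suc)
  also have "(\<Oplus>k\<in>{..n}. [(p choose Suc k)] \<cdot> (a [^] Suc k \<otimes> b [^] (p - Suc k))) = (\<Oplus>k\<in>{..n}. \<zero>)"
    by (intro finsum_cong' z) (auto simp: n)
  finally show ?thesis by (simp add: finsum_zero)
qed

lemma (in cring) frobenius_pow_add:
  assumes p: "Factorial_Ring.prime (p::nat)" "[p] \<cdot> \<one> = \<zero>"
    and [simp]: "a \<in> carrier R" "b \<in> carrier R"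
  shows "(a \<oplus> b) [^] (p ^ e) = a [^] (p ^ e) \<oplus> b [^] (p ^ e)"
proof (induction e)
  case (Suc e)
  have "(a \<oplus> b) [^] (p ^ Suc e) = ((a \<oplus> b) [^] (p ^ e)) [^] p"
    by (simp add: nat_pow_pow mult.commute)
  also have "\<dots> = a [^] (p ^ Suc e) \<oplus> b [^] (p ^ Suc e)"
    unfolding Suc by (subst frobenius_add[OF p]) (auto simp: nat_pow_pow mult.commute)
  finally show ?case .
qed simp

section \<open>Ideals in noetherian rings, and primes of height one\<close>

lemma (in cring) ideal_of_closed:
  assumes "I \<subseteq> carrier R" "\<zero> \<in> I" "\<And>x y. x \<in> I \<Longrightarrow> y \<in> I \<Longrightarrow> x \<oplus> y \<in> I"
    and l: "\<And>r x. r \<in> carrier R \<Longrightarrow> x \<in> I \<Longrightarrow> r \<otimes> x \<in> I"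
  shows "ideal I R"
proof (rule idealI)
  show "ring R" by unfold_locales
  show "subgroup I (add_monoid R)"
  proof (rule add.subgroupI)
    show "\<ominus> x \<in> I" if "x \<in> I" for x
    proof -
      have "(\<ominus> \<one>) \<otimes> x \<in> I" using that by (intro l) auto
      then show ?thesis using that assms(1) by (auto simp: l_minus subset_iff)
    qed
  qed (use assms in auto)
  show "x \<otimes> a \<in> I" if "a \<in> I" "x \<in> carrier R" for a x using l that by blast
  show "a \<otimes> x \<in> I" if "a \<in> I" "x \<in> carrier R" for a x
    using l[OF that(2,1)] that assms(1) by (metis m_comm subsetD)
qed

text \<open>The form in which the noetherian hypothesis is used below: every argument picks an ideal that
  is maximal with a suitable property.\<close>

lemma (in noetherian_ring) ex_maximal_ideal_among:
  assumes "F \<noteq> {}" "\<And>I. I \<in> F \<Longrightarrow> ideal I R"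
  obtains M where "M \<in> F" "\<And>J. J \<in> F \<Longrightarrow> M \<subseteq> J \<Longrightarrow> J = M"
proof -
  have "\<exists>M\<in>F. \<forall>J\<in>F. M \<subseteq> J \<longrightarrow> J = M"
  proof (rule subset_Zorn_nonempty[OF assms(1)])
    fix C assume C: "C \<noteq> {}" "subset.chain F C"
    then have "subset.chain {I. ideal I R} C" using assms(2) by (auto simp: pred_on.chain_def)
    then show "\<Union>C \<in> F" using ideal_chain_is_trivial[OF C(1)] C(2) by (auto simp: pred_on.chain_def)
  qed
  then show ?thesis using that by blast
qed

definition minimal_primes_over :: "('a, 'm) ring_scheme \<Rightarrow> 'a set \<Rightarrow> 'a set set" where
  "minimal_primes_over R I = {Q. primeideal Q R \<and> I \<subseteq> Q \<and>
     (\<forall>Q'. primeideal Q' R \<and> I \<subseteq> Q' \<and> Q' \<subseteq> Q \<longrightarrow> Q' = Q)}"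

text \<open>Noetherian induction. An ideal \<open>M\<close> that is maximal among the counterexamples is neither prime
  nor the whole ring, so \<open>a b \<in> M\<close> for some \<open>a\<close>, \<open>b\<close> outside \<open>M\<close>; a minimal prime over \<open>M\<close> is then
  minimal over \<open>M + (a)\<close> or over \<open>M + (b)\<close>, and these have only finitely many minimal primes.\<close>

lemma (in cring) finite_minimal_primes_over:
  assumes "noetherian_ring R" "ideal I R"
  shows "finite (minimal_primes_over R I)"
proof (rule ccontr)
  interpret noetherian_ring R by fact
  let ?F = "{I. ideal I R \<and> infinite (minimal_primes_over R I)}"
  assume "infinite (minimal_primes_over R I)"
  then have "?F \<noteq> {}" using assms(2) by blast
  then obtain M where M: "M \<in> ?F" and max: "\<And>J. J \<in> ?F \<Longrightarrow> M \<subseteq> J \<Longrightarrow> J = M"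
    by (rule ex_maximal_ideal_among) auto
  interpret M: ideal M R using M by blast
  have "\<not> primeideal M R"
  proof
    assume "primeideal M R"
    then have "minimal_primes_over R M \<subseteq> {M}" unfolding minimal_primes_over_def by blast
    then show False using M finite_subset by blast
  qed
  moreover have "carrier R \<noteq> M"
  proof
    assume "carrier R = M"
    have "Q \<notin> minimal_primes_over R M" for Q
    proof
      assume "Q \<in> minimal_primes_over R M"
      then have Q: "primeideal Q R" "carrier R \<subseteq> Q"
        using \<open>carrier R = M\<close> by (auto simp: minimal_primes_over_def)
      interpret Q: primeideal Q R by fact
      show False using Q(2) Q.a_subset Q.I_notcarr by blast
    qed
    then have "minimal_primes_over R M = {}" by blast
    then show False using M by simp
  qed
  ultimately obtain a b where ab: "a \<in> carrier R" "b \<in> carrier R" "a \<otimes> b \<in> M" "a \<notin> M" "b \<notin> M"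
    using M.primeidealCD[OF is_cring] by blast
  have fin: "finite (minimal_primes_over R (Idl (insert c M)))"
    and sub: "M \<subseteq> Idl (insert c M)" if "c \<in> carrier R" "c \<notin> M" for c
  proof -
    have i: "insert c M \<subseteq> carrier R" using that M.Icarr by blast
    then have "insert c M \<subseteq> Idl (insert c M)" by (rule genideal_self)
    then show "M \<subseteq> Idl (insert c M)" "finite (minimal_primes_over R (Idl (insert c M)))"
      using genideal_ideal[OF i] max that by blast+
  qed
  have "minimal_primes_over R M
      \<subseteq> minimal_primes_over R (Idl (insert a M)) \<union> minimal_primes_over R (Idl (insert b M))"
  proof
    fix Q assume Q: "Q \<in> minimal_primes_over R M"
    then have Qp: "primeideal Q R" "M \<subseteq> Q" by (auto simp: minimal_primes_over_def)
    have step: "Q \<in> minimal_primes_over R (Idl (insert c M))" if c: "c \<in> carrier R" "c \<notin> M" "c \<in> Q" for c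
    proof -
      have "Idl (insert c M) \<subseteq> Q"
        using c Qp by (intro genideal_minimal) (auto intro: primeideal.axioms(1))
      moreover have "Q' = Q" if "primeideal Q' R" "Idl (insert c M) \<subseteq> Q'" "Q' \<subseteq> Q" for Q'
      proof -
        have "M \<subseteq> Q'" using sub[OF c(1,2)] that(2) by (rule subset_trans)
        then show ?thesis using Q that(1,3) by (simp add: minimal_primes_over_def)
      qed
      ultimately show ?thesis using Qp(1) by (simp add: minimal_primes_over_def)
    qed
    have "a \<in> Q \<or> b \<in> Q" using primeideal.I_prime[OF Qp(1) ab(1,2)] ab(3) Qp(2) by blast
    then show "Q \<in> minimal_primes_over R (Idl (insert a M)) \<union> minimal_primes_over R (Idl (insert b M))"
      using step ab by blast
  qed
  then have "finite (minimal_primes_over R M)"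
    by (rule finite_subset) (use fin ab in simp)
  then show False using M by simp
qed

text \<open>A chain of primes of length two that ends at \<open>Q\<close> has a prime strictly between \<open>0\<close> and \<open>Q\<close> as its
  middle term.\<close>

lemma (in "domain") prime_height_one_iff:
  assumes Q: "primeideal Q R"
  shows "prime_height R Q = 1 \<longleftrightarrow>
    Q \<noteq> {\<zero>} \<and> (\<forall>Q'. primeideal Q' R \<and> Q' \<subseteq> Q \<longrightarrow> Q' = {\<zero>} \<or> Q' = Q)" (is "?L \<longleftrightarrow> ?R")
proof -
  let ?N = "{n. \<exists>c. prime_chain R n c \<and> c n = Q}"
  have z: "\<zero> \<in> Q'" if "primeideal Q' R" for Q'
    using that primeideal.axioms(1) ideal.axioms(1) additive_subgroup.zero_closed by blast
  have le1: "enat n \<le> prime_height R Q" if "n \<in> ?N" for n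
    unfolding prime_height_def using that by (rule SUP_upper)
  show ?thesis
  proof
    assume h: ?L
    have "Q \<noteq> {\<zero>}"
    proof
      assume Q0: "Q = {\<zero>}"
      have "prime_height R Q \<le> 0"
        unfolding prime_height_def
      proof (rule SUP_least)
        fix n assume "n \<in> ?N"
        then obtain c where c: "prime_chain R n c" "c n = Q" by blast
        have "n = 0"
        proof (cases n)
          case (Suc m)
          then have "c m \<subset> Q" "primeideal (c m) R" using c by (auto simp: prime_chain_def)
          then show ?thesis using Q0 z by blast
        qed
        then show "enat n \<le> 0" by (simp add: zero_enat_def)
      qed
      then show False using h by simp
    qed
    moreover have "Q' = {\<zero>} \<or> Q' = Q" if Q': "primeideal Q' R" "Q' \<subseteq> Q" for Q'
    proof (rule ccontr)
      assume n: "\<not> ?thesis"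
      define c where "c i = (if i = 0 then {\<zero>} else if i = 1 then Q' else Q)" for i :: nat
      have "prime_chain R 2 c"
        unfolding prime_chain_def c_def using Q Q' zeroprimeideal n z[OF Q'(1)]
        by (auto simp: less_Suc_eq numeral_2_eq_2)
      then have "2 \<in> ?N" by (auto simp: c_def)
      from le1[OF this] show False unfolding h by (simp add: one_enat_def)
    qed
    ultimately show ?R by blast
  next
    assume h: ?R
    have "prime_chain R 1 (\<lambda>i. if i = 0 then {\<zero>} else Q)"
      unfolding prime_chain_def using Q zeroprimeideal h z[OF Q] by auto
    then have "1 \<in> ?N" by (auto intro!: exI[of _ "\<lambda>i. if i = 0 then {\<zero>} else Q"])
    from le1[OF this] have "1 \<le> prime_height R Q" by (simp add: one_enat_def)
    moreover have "prime_height R Q \<le> 1"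
      unfolding prime_height_def
    proof (rule SUP_least)
      fix n assume "n \<in> ?N"
      then obtain c where c: "prime_chain R n c" "c n = Q" by blast
      have "n \<le> 1"
      proof (rule ccontr)
        assume "\<not> n \<le> 1"
        then obtain m where n: "n = Suc (Suc m)" by (metis One_nat_def Suc_le_mono le0 not0_implies_Suc)
        have c': "primeideal (c m) R" "primeideal (c (Suc m)) R" "c m \<subset> c (Suc m)" "c (Suc m) \<subset> Q"
          using c n unfolding prime_chain_def by auto
        then have "c (Suc m) = {\<zero>}" using h by (metis psubset_imp_subset psubset_eq)
        then show False using c'(3) z[OF c'(1)] by auto
      qed
      then show "enat n \<le> 1" by (simp add: one_enat_def)
    qed
    ultimately show ?L by simp
  qed
qed

lemma (in "domain") finite_height_one_primes_containing:
  assumes "noetherian_ring R" "b \<in> carrier R" "b \<noteq> \<zero>"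
  shows "finite {Q. primeideal Q R \<and> prime_height R Q = 1 \<and> b \<in> Q}"
proof (rule finite_subset)
  show "finite (minimal_primes_over R (PIdl b))"
    using assms by (intro finite_minimal_primes_over cgenideal_ideal)
  show "{Q. primeideal Q R \<and> prime_height R Q = 1 \<and> b \<in> Q} \<subseteq> minimal_primes_over R (PIdl b)"
  proof clarify
    fix Q assume Q: "primeideal Q R" "prime_height R Q = 1" "b \<in> Q"
    have "PIdl b \<subseteq> Q" using Q by (intro cgenideal_minimal) (auto intro: primeideal.axioms(1))
    moreover have "Q' = Q" if "primeideal Q' R" "PIdl b \<subseteq> Q'" "Q' \<subseteq> Q" for Q'
      using that prime_height_one_iff[OF Q(1)] Q(2) assms(2,3) cgenideal_self[OF assms(2)] by blast
    ultimately show "Q \<in> minimal_primes_over R (PIdl b)" using Q by (auto simp: minimal_primes_over_def)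
  qed
qed

section \<open>Fractions of a domain\<close>

locale localizing_domain = localizing + "domain" +
  assumes S_nonzero: "\<zero> \<notin> S"
begin

lemma lfrac_eq_iff_cross:
  assumes "a \<in> carrier R" "s \<in> S" "b \<in> carrier R" "t \<in> S"
  shows "fr a s = fr b t \<longleftrightarrow> a \<otimes> t = b \<otimes> s"
  using assms S_nonzero S_one lfrac_eq_iff[OF assms] m_lcancel by (metis S_carr m_closed)

lemma lfrac_zero_iff:
  assumes "a \<in> carrier R" "s \<in> S"
  shows "fr a s = \<zero>\<^bsub>L\<^esub> \<longleftrightarrow> a = \<zero>"
  unfolding loc_zero using assms S_one by (subst lfrac_eq_iff_cross) (auto simp: S_carr)

lemma loc_domain: "domain L"
proof (rule domainI[OF loc_cring])
  show "\<one>\<^bsub>L\<^esub> \<noteq> \<zero>\<^bsub>L\<^esub>" unfolding loc_one using S_one by (subst lfrac_zero_iff) auto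
  fix x y assume xy: "x \<otimes>\<^bsub>L\<^esub> y = \<zero>\<^bsub>L\<^esub>" and x: "x \<in> carrier L" and y: "y \<in> carrier L"
  obtain a s where as: "a \<in> carrier R" "s \<in> S" "x = fr a s" using x by (rule loc_cases)
  obtain b t where bt: "b \<in> carrier R" "t \<in> S" "y = fr b t" using y by (rule loc_cases)
  have "a \<otimes> b = \<zero>" using xy as bt S_mult by (simp add: lfrac_mult lfrac_zero_iff)
  then show "x = \<zero>\<^bsub>L\<^esub> \<or> y = \<zero>\<^bsub>L\<^esub>" using as bt integral by (auto simp: lfrac_zero_iff)
qed

end

lemma (in "domain") localizing_domain_nonzerodivisors: "localizing_domain R (nonzerodivisors R)"
proof -
  interpret localizing R "nonzerodivisors R" by (rule localizing_nonzerodivisors)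
  show ?thesis by unfold_locales (simp add: nonzerodivisors_domain)
qed

lemma (in "domain") localizing_domain_compl:
  assumes "primeideal P R" shows "localizing_domain R (carrier R - P)"
proof -
  interpret P: primeideal P R by fact
  interpret localizing R "carrier R - P" by (rule P.localizing_compl)
  show ?thesis by unfold_locales simp
qed

section \<open>Uniformizers and orders of vanishing\<close>

text \<open>An element \<open>\<pi>\<close> that generates the maximal ideal of the discrete valuation ring \<open>R\<^sub>Q\<close>, described by
  elements of \<open>R\<close>: each nonzero \<open>a\<close> is, up to elements outside \<open>Q\<close>, a power of \<open>\<pi>\<close>. In this form
  the notion passes to localizations of \<open>R\<close> without any study of iterated localizations.\<close>

locale uniformizer = "domain" R + Q: primeideal Q R for R (structure) and Q +
  fixes \<pi>
  assumes unif_in: "\<pi> \<in> Q" and unif_nonzero: "\<pi> \<noteq> \<zero>"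
    and unif_rep: "a \<in> carrier R \<Longrightarrow> a \<noteq> \<zero> \<Longrightarrow>
      \<exists>n::nat. \<exists>s\<in>carrier R - Q. \<exists>t\<in>carrier R - Q. s \<otimes> a = t \<otimes> \<pi> [^] n"
begin

lemma unif_carr [simp]: "\<pi> \<in> carrier R"
  using unif_in by (rule Q.Icarr)

lemma unif_pow_nonzero: "\<pi> [^] (n::nat) \<noteq> \<zero>"
  using unif_nonzero by (induction n) (auto simp: integral_iff)

lemma compl_mult: "s \<in> carrier R - Q \<Longrightarrow> t \<in> carrier R - Q \<Longrightarrow> s \<otimes> t \<in> carrier R - Q"
  using Q.I_prime by auto

sublocale loc: localizing_domain R "carrier R - Q"
  by (rule localizing_domain_compl) (rule Q.primeideal)

text \<open>Otherwise \<open>\<pi>\<close> would divide the unit \<open>u\<close> of \<open>R\<^sub>Q\<close>.\<close>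

lemma exponent_le:
  assumes eq: "u \<otimes> \<pi> [^] m = r \<otimes> \<pi> [^] (n::nat)" and u: "u \<in> carrier R - Q" and r: "r \<in> carrier R"
  shows "n \<le> (m::nat)"
proof (rule ccontr)
  assume "\<not> n \<le> m"
  then obtain d where n: "n = m + Suc d" by (metis add_Suc_right less_imp_Suc_add not_le)
  have "u \<otimes> \<pi> [^] m = (r \<otimes> \<pi> [^] d \<otimes> \<pi>) \<otimes> \<pi> [^] m"
    unfolding eq n using r by (simp add: nat_pow_mult[symmetric] m_ac)
  then have "u = r \<otimes> \<pi> [^] d \<otimes> \<pi>"
    using u r unif_pow_nonzero by (subst (asm) m_rcancel) auto
  then show False using u r unif_in Q.I_l_closed by auto
qed

text \<open>The maximal ideal of \<open>R\<^sub>Q\<close> is generated by \<open>\<pi>\<close>, so its \<open>n\<close>-th power is generated by \<open>\<pi>\<^sup>n\<close>.\<close>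

lemma max_ideal_pow:
  "ideal_pow (loc_at R Q) (loc_max R Q) n =
     {loc.fr (r \<otimes> \<pi> [^] n) s | r s. r \<in> carrier R \<and> s \<in> carrier R - Q}"
proof (induction n)
  case 0
  show ?case by (auto simp: ideal_pow_def ideals_set_def loc_at_def loc_ring_def; force)
next
  case (Suc n)
  let ?W = "\<lambda>n. {loc.fr (r \<otimes> \<pi> [^] n) s | r s. r \<in> carrier R \<and> s \<in> carrier R - Q}"
  have "ideal_pow (loc_at R Q) (loc_max R Q) (Suc n) = ideal_prod loc.L (?W n) (loc_max R Q)"
    using Suc by (simp add: ideal_pow_def ideals_set_def loc_at_def)
  also have "\<dots> = ?W (Suc n)"
  proof (intro equalityI subsetI)
    fix x assume "x \<in> ideal_prod loc.L (?W n) (loc_max R Q)"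
    then show "x \<in> ?W (Suc n)"
    proof induction
      case (prod i j)
      obtain r s where rs: "i = loc.fr (r \<otimes> \<pi> [^] n) s" "r \<in> carrier R" "s \<in> carrier R - Q"
        using prod by blast
      obtain q s' where qs: "j = loc.fr q s'" "q \<in> Q" "s' \<in> carrier R - Q"
        using prod unfolding loc_max_def by blast
      have qc: "q \<in> carrier R" using qs Q.Icarr by blast
      have "\<exists>t\<in>carrier R - Q. \<exists>r'\<in>carrier R. t \<otimes> q = r' \<otimes> \<pi>"
      proof (cases "q = \<zero>")
        case True then show ?thesis using loc.S_one by (intro bexI[of _ \<one>] bexI[of _ \<zero>]) auto
      next
        case False
        then obtain v t u where u: "t \<in> carrier R - Q" "u \<in> carrier R - Q" "t \<otimes> q = u \<otimes> \<pi> [^] (v::nat)"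
          using unif_rep qc by blast
        have "v \<noteq> 0"
        proof
          assume "v = 0"
          then have "u = t \<otimes> q" using u by simp
          then show False using u qs Q.I_l_closed by auto
        qed
        then obtain w where "v = Suc w" using not0_implies_Suc by blast
        then show ?thesis using u by (intro bexI[of _ t] bexI[of _ "u \<otimes> \<pi> [^] w"]) (auto simp: m_assoc)
      qed
      then obtain t r' where t: "t \<in> carrier R - Q" "r' \<in> carrier R" "t \<otimes> q = r' \<otimes> \<pi>" by blast
      have "i \<otimes>\<^bsub>loc.L\<^esub> j = loc.fr ((r \<otimes> \<pi> [^] n) \<otimes> q) (s \<otimes> s')"
        using rs qs qc by (simp add: loc.lfrac_mult)
      also have "\<dots> = loc.fr ((r \<otimes> r') \<otimes> \<pi> [^] Suc n) (t \<otimes> (s \<otimes> s'))"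
      proof (rule loc.lfrac_eqI)
        have "(r \<otimes> \<pi> [^] n) \<otimes> q \<otimes> (t \<otimes> (s \<otimes> s')) = (r \<otimes> \<pi> [^] n) \<otimes> (t \<otimes> q) \<otimes> (s \<otimes> s')"
          using rs qs qc t(1,2) by (simp add: m_ac)
        also have "\<dots> = (r \<otimes> r') \<otimes> \<pi> [^] Suc n \<otimes> (s \<otimes> s')"
          unfolding t(3) using rs qs qc t(1,2) by (simp add: m_ac)
        finally show "(r \<otimes> \<pi> [^] n) \<otimes> q \<otimes> (t \<otimes> (s \<otimes> s')) = (r \<otimes> r') \<otimes> \<pi> [^] Suc n \<otimes> (s \<otimes> s')" .
        show "t \<otimes> (s \<otimes> s') \<in> carrier R - Q" using rs(3) qs(3) t(1) by (intro compl_mult)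
        show "s \<otimes> s' \<in> carrier R - Q" using rs(3) qs(3) by (intro compl_mult)
      qed (use rs(2) qc t(2) in simp_all)
      finally show ?case
        using m_closed[OF rs(2) t(2)] compl_mult[OF t(1) compl_mult[OF rs(3) qs(3)]] by blast
    next
      case (sum x y)
      obtain r s where rs: "x = loc.fr (r \<otimes> \<pi> [^] Suc n) s" "r \<in> carrier R" "s \<in> carrier R - Q"
        using sum by blast
      obtain r' s' where rs': "y = loc.fr (r' \<otimes> \<pi> [^] Suc n) s'" "r' \<in> carrier R" "s' \<in> carrier R - Q"
        using sum by blast
      have "x \<oplus>\<^bsub>loc.L\<^esub> y = loc.fr ((r \<otimes> \<pi> [^] Suc n) \<otimes> s' \<oplus> (r' \<otimes> \<pi> [^] Suc n) \<otimes> s) (s \<otimes> s')"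
        using rs rs' by (simp add: loc.lfrac_add)
      also have "(r \<otimes> \<pi> [^] Suc n) \<otimes> s' \<oplus> (r' \<otimes> \<pi> [^] Suc n) \<otimes> s = (r \<otimes> s' \<oplus> r' \<otimes> s) \<otimes> \<pi> [^] Suc n"
        using rs rs' by (simp add: m_ac l_distr r_distr del: nat_pow_Suc)
      finally show ?case using rs rs' compl_mult by blast
    qed
  next
    fix x assume "x \<in> ?W (Suc n)"
    then obtain r s where rs: "x = loc.fr (r \<otimes> \<pi> [^] Suc n) s" "r \<in> carrier R" "s \<in> carrier R - Q"
      by blast
    have "x = loc.fr (r \<otimes> \<pi> [^] n) s \<otimes>\<^bsub>loc.L\<^esub> loc.fr \<pi> \<one>"
      using rs loc.S_one by (subst loc.lfrac_mult) (auto simp: m_ac)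
    moreover have "loc.fr \<pi> \<one> \<in> loc_max R Q" unfolding loc_max_def using unif_in loc.S_one by blast
    ultimately show "x \<in> ideal_prod loc.L (?W n) (loc_max R Q)"
      using rs by (auto intro!: ideal_prod.prod)
  qed
  finally show ?case .
qed

text \<open>Since powers of the maximal ideal are generated by powers of \<open>\<pi>\<close>, the greatest element that
  defines \<^const>\<open>ord_at\<close> is the exponent in the representation of \<open>a\<close>.\<close>

lemma ord_at_eq:
  assumes a: "a \<in> carrier R" and s: "s \<in> carrier R - Q" and t: "t \<in> carrier R - Q"
    and eq: "s \<otimes> a = t \<otimes> \<pi> [^] v"
  shows "ord_at R Q a = v"
proof -
  have "to_loc_at R Q a \<in> ideal_pow (loc_at R Q) (loc_max R Q) n \<longleftrightarrow> n \<le> v" for n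
  proof
    assume "to_loc_at R Q a \<in> ideal_pow (loc_at R Q) (loc_max R Q) n"
    then obtain r s' where r: "r \<in> carrier R" "s' \<in> carrier R - Q"
      and e: "loc.fr a \<one> = loc.fr (r \<otimes> \<pi> [^] n) s'"
      unfolding max_ideal_pow to_loc_at_def by blast
    then have e': "a \<otimes> s' = r \<otimes> \<pi> [^] n" using a loc.S_one by (simp add: loc.lfrac_eq_iff_cross)
    have "(s' \<otimes> t) \<otimes> \<pi> [^] v = s \<otimes> (a \<otimes> s')" using eq[symmetric] r a s t by (simp add: m_ac)
    also have "\<dots> = (s \<otimes> r) \<otimes> \<pi> [^] n" unfolding e' using r s by (simp add: m_ac)
    finally show "n \<le> v" using r s t compl_mult by (intro exponent_le[of "s' \<otimes> t" v "s \<otimes> r" n]) auto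
  next
    assume "n \<le> v"
    then obtain d where v: "v = d + n" by (metis add.commute le_iff_add)
    have tc: "t \<otimes> \<pi> [^] d \<in> carrier R" using t by simp
    have "loc.fr a \<one> = loc.fr ((t \<otimes> \<pi> [^] d) \<otimes> \<pi> [^] n) s"
    proof (rule loc.lfrac_eqI)
      have "a \<otimes> s = t \<otimes> \<pi> [^] v" using eq a s by (simp add: m_comm)
      also have "\<dots> = (t \<otimes> \<pi> [^] d) \<otimes> \<pi> [^] n \<otimes> \<one>"
        using t by (simp add: v nat_pow_mult[symmetric] m_assoc)
      finally show "a \<otimes> s = (t \<otimes> \<pi> [^] d) \<otimes> \<pi> [^] n \<otimes> \<one>" .
    qed (use a s t loc.S_one in auto)
    then show "to_loc_at R Q a \<in> ideal_pow (loc_at R Q) (loc_max R Q) n"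
      unfolding max_ideal_pow to_loc_at_def using s tc by blast
  qed
  then show ?thesis unfolding ord_at_def by (intro Greatest_equality) auto
qed

lemma ord_at_rep:
  assumes a: "a \<in> carrier R" "a \<noteq> \<zero>"
  obtains s t where "s \<in> carrier R - Q" "t \<in> carrier R - Q" "s \<otimes> a = t \<otimes> \<pi> [^] (ord_at R Q a)"
  using unif_rep[OF a] ord_at_eq[OF a(1)] by metis

lemma ord_at_mult:
  assumes a: "a \<in> carrier R" "a \<noteq> \<zero>" and b: "b \<in> carrier R" "b \<noteq> \<zero>"
  shows "ord_at R Q (a \<otimes> b) = ord_at R Q a + ord_at R Q b"
proof -
  obtain s t where st: "s \<in> carrier R - Q" "t \<in> carrier R - Q" "s \<otimes> a = t \<otimes> \<pi> [^] (ord_at R Q a)"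
    using ord_at_rep[OF a] .
  obtain s' t' where st': "s' \<in> carrier R - Q" "t' \<in> carrier R - Q" "s' \<otimes> b = t' \<otimes> \<pi> [^] (ord_at R Q b)"
    using ord_at_rep[OF b] .
  have "(s \<otimes> s') \<otimes> (a \<otimes> b) = (s \<otimes> a) \<otimes> (s' \<otimes> b)"
    using st(1) st'(1) a b by (simp add: m_ac)
  also have "\<dots> = (t \<otimes> t') \<otimes> \<pi> [^] (ord_at R Q a + ord_at R Q b)"
    unfolding st(3) st'(3) using st(2) st'(2) by (simp add: m_ac nat_pow_mult[symmetric])
  finally show ?thesis using st st' a b compl_mult by (intro ord_at_eq) auto
qed

text \<open>The definite description in \<^const>\<open>val_at\<close> is meaningful because \<^const>\<open>ord_at\<close> is additive on
  products, so that a difference of orders depends only on the fraction.\<close>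

lemma val_at_lfrac:
  assumes a: "a \<in> carrier R" "a \<noteq> \<zero>" and b: "b \<in> carrier R" "b \<noteq> \<zero>"
  shows "val_at R Q (lfrac R (nonzerodivisors R) a b) = int (ord_at R Q a) - int (ord_at R Q b)"
  unfolding val_at_def
proof (rule the_equality)
  show "\<exists>a'\<in>carrier R - {\<zero>}. \<exists>b'\<in>carrier R - {\<zero>}.
      lfrac R (nonzerodivisors R) a b = lfrac R (nonzerodivisors R) a' b' \<and>
      int (ord_at R Q a) - int (ord_at R Q b) = int (ord_at R Q a') - int (ord_at R Q b')"
    using a b by blast
  interpret T: localizing_domain R "nonzerodivisors R" by (rule localizing_domain_nonzerodivisors)
  fix k assume "\<exists>a'\<in>carrier R - {\<zero>}. \<exists>b'\<in>carrier R - {\<zero>}.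
      lfrac R (nonzerodivisors R) a b = lfrac R (nonzerodivisors R) a' b' \<and>
      k = int (ord_at R Q a') - int (ord_at R Q b')"
  then obtain a' b' where c: "a' \<in> carrier R" "a' \<noteq> \<zero>" "b' \<in> carrier R" "b' \<noteq> \<zero>"
    and e: "lfrac R (nonzerodivisors R) a b = lfrac R (nonzerodivisors R) a' b'"
    and k: "k = int (ord_at R Q a') - int (ord_at R Q b')" by blast
  have "a \<otimes> b' = a' \<otimes> b"
    using e a b c by (subst (asm) T.lfrac_eq_iff_cross) (auto simp: nonzerodivisors_domain)
  then have "ord_at R Q a + ord_at R Q b' = ord_at R Q a' + ord_at R Q b"
    using ord_at_mult a b c by metis
  then show "k = int (ord_at R Q a) - int (ord_at R Q b)" unfolding k by linarith
qed

end

text \<open>The condition that \<open>\<pi>\<^sup>k a / b\<close> lies in \<open>R\<^sub>Q\<close>, that is, that \<open>a / b\<close> has a pole of order at most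
  \<open>k\<close> along \<open>Q\<close>. It replaces the inequalities between valuations: it is visibly stable under sums
  and multiples, and it can be pulled back from \<open>R\<^sub>P\<close> to \<open>R\<close>.\<close>

definition pole_le :: "('a, 'm) ring_scheme \<Rightarrow> 'a set \<Rightarrow> 'a \<Rightarrow> nat \<Rightarrow> 'a \<Rightarrow> 'a \<Rightarrow> bool" where
  "pole_le R Q \<pi> k a b \<longleftrightarrow> (\<exists>s\<in>carrier R - Q. \<exists>r\<in>carrier R.
     s \<otimes>\<^bsub>R\<^esub> (\<pi> [^]\<^bsub>R\<^esub> k \<otimes>\<^bsub>R\<^esub> a) = r \<otimes>\<^bsub>R\<^esub> b)"

text \<open>Substituting the representations of \<open>a\<close> and \<open>b\<close> turns both sides into the inequality
  \<open>ord b \<le> ord a + k\<close>.\<close>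

lemma (in uniformizer) val_at_ge_iff:
  assumes a: "a \<in> carrier R" "a \<noteq> \<zero>" and b: "b \<in> carrier R" "b \<noteq> \<zero>"
  shows "0 \<le> val_at R Q (lfrac R (nonzerodivisors R) a b) + int k \<longleftrightarrow> pole_le R Q \<pi> k a b"
proof -
  let ?v = "ord_at R Q a" and ?w = "ord_at R Q b"
  obtain s t where st: "s \<in> carrier R - Q" "t \<in> carrier R - Q" "s \<otimes> a = t \<otimes> \<pi> [^] ?v"
    using ord_at_rep[OF a] .
  obtain s' t' where st': "s' \<in> carrier R - Q" "t' \<in> carrier R - Q" "s' \<otimes> b = t' \<otimes> \<pi> [^] ?w"
    using ord_at_rep[OF b] .
  have "?w \<le> ?v + k \<longleftrightarrow> pole_le R Q \<pi> k a b"
  proof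
    assume "?w \<le> ?v + k"
    then obtain d where d: "?v + k = d + ?w" by (metis add.commute le_iff_add)
    have "(s \<otimes> t') \<otimes> (\<pi> [^] k \<otimes> a) = (s \<otimes> a) \<otimes> (\<pi> [^] k \<otimes> t')"
      using st(1) st'(2) a by (simp add: m_ac)
    also have "\<dots> = t \<otimes> t' \<otimes> \<pi> [^] (?v + k)"
      unfolding st(3) using st(2) st'(2) by (simp add: m_ac nat_pow_mult[symmetric])
    also have "\<dots> = (t \<otimes> \<pi> [^] d) \<otimes> (t' \<otimes> \<pi> [^] ?w)"
      unfolding d using st(2) st'(2) by (simp add: m_ac nat_pow_mult[symmetric])
    also have "\<dots> = (t \<otimes> \<pi> [^] d \<otimes> s') \<otimes> b"
      unfolding st'(3)[symmetric] using st(2) st'(1) b by (simp add: m_ac)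
    finally show "pole_le R Q \<pi> k a b"
      unfolding pole_le_def using st st' compl_mult
      by (intro bexI[of _ "s \<otimes> t'"] bexI[of _ "t \<otimes> \<pi> [^] d \<otimes> s'"]) auto
  next
    assume "pole_le R Q \<pi> k a b"
    then obtain u r where u: "u \<in> carrier R - Q" "r \<in> carrier R" "u \<otimes> (\<pi> [^] k \<otimes> a) = r \<otimes> b"
      unfolding pole_le_def by blast
    have "(u \<otimes> (s' \<otimes> t)) \<otimes> \<pi> [^] (?v + k) = u \<otimes> s' \<otimes> \<pi> [^] k \<otimes> (t \<otimes> \<pi> [^] ?v)"
      using u(1) st(2) st'(1) by (simp add: m_ac nat_pow_mult[symmetric])
    also have "\<dots> = s \<otimes> s' \<otimes> (u \<otimes> (\<pi> [^] k \<otimes> a))"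
      unfolding st(3)[symmetric] using u(1) st(1) st'(1) a by (simp add: m_ac)
    also have "\<dots> = s \<otimes> r \<otimes> (s' \<otimes> b)"
      unfolding u(3) using u(2) st(1) st'(1) b by (simp add: m_ac)
    also have "\<dots> = (s \<otimes> r \<otimes> t') \<otimes> \<pi> [^] ?w"
      unfolding st'(3) using u(2) st(1) st'(2) by (simp add: m_ac)
    finally show "?w \<le> ?v + k"
    proof (rule exponent_le)
      show "u \<otimes> (s' \<otimes> t) \<in> carrier R - Q" using u(1) st(2) st'(1) by (intro compl_mult)
    qed (use u(2) st(1) st'(2) in simp)
  qed
  then show ?thesis using val_at_lfrac[OF a b] by auto
qed

section \<open>Existence of uniformizers\<close>

text \<open>If \<open>c y\<^sup>n \<in> R\<close> for \<open>y = a / b\<close> and all \<open>n\<close>, the ideals generated by \<open>c, c y, \<dots>, c y\<^bsup>n-1\<^esup>\<close> form an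
  ascending chain in \<open>R\<close>. Where the chain becomes stationary, \<open>c y\<^sup>m\<close> is an \<open>R\<close>-combination of lower
  terms; cancelling \<open>c\<close> gives a monic equation for \<open>y\<close>, and \<open>R\<close> is integrally closed. This takes the
  place of the determinant trick.\<close>

lemma (in "domain") normal_domain_almost_integral:
  assumes noeth: "noetherian_ring R" and normal: "normal_domain R"
    and a: "a \<in> carrier R" and b: "b \<in> carrier R" "b \<noteq> \<zero>" and c: "c \<in> carrier R" "c \<noteq> \<zero>"
    and "\<And>n::nat. \<exists>z\<in>carrier R. c \<otimes> a [^] n = z \<otimes> b [^] n"
  shows "\<exists>r\<in>carrier R. a = r \<otimes> b"
proof -
  interpret N: noetherian_ring R by fact
  interpret T: localizing_domain R "nonzerodivisors R" by (rule localizing_domain_nonzerodivisors)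
  interpret K: "domain" T.L by (rule T.loc_domain)
  have bn: "b \<in> nonzerodivisors R" using b by (simp add: nonzerodivisors_domain)
  let ?i = "\<lambda>x. T.fr x \<one>"
  have ic: "?i x \<in> carrier T.L" if "x \<in> carrier R" for x using that T.S_one by (rule T.lfrac_in)
  have iadd: "?i (x \<oplus> y) = ?i x \<oplus>\<^bsub>T.L\<^esub> ?i y" and imult: "?i (x \<otimes> y) = ?i x \<otimes>\<^bsub>T.L\<^esub> ?i y"
    if "x \<in> carrier R" "y \<in> carrier R" for x y
    using ring_hom_add[OF T.to_loc_hom that] ring_hom_mult[OF T.to_loc_hom that] by simp_all
  define y where "y = T.fr a b"
  have y: "y \<in> carrier T.L" unfolding y_def using a bn by (rule T.lfrac_in)
  obtain z where z: "\<And>n::nat. z n \<in> carrier R" "\<And>n. c \<otimes> a [^] n = z n \<otimes> b [^] n"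
    using assms(8) by metis
  have iz: "?i (z n) = ?i c \<otimes>\<^bsub>T.L\<^esub> y [^]\<^bsub>T.L\<^esub> n" for n
  proof -
    have "?i c \<otimes>\<^bsub>T.L\<^esub> y [^]\<^bsub>T.L\<^esub> n = T.fr (c \<otimes> a [^] n) (\<one> \<otimes> b [^] n)"
      unfolding y_def T.lfrac_pow(2)[OF a bn]
      using a c T.S_one T.lfrac_pow(1)[OF a bn] by (subst T.lfrac_mult) auto
    also have "\<dots> = ?i (z n)"
      using z(1) z(2)[of n] a b c T.S_one T.lfrac_pow(1)[OF a bn, of n]
      by (intro T.lfrac_eqI) auto
    finally show ?thesis ..
  qed
  \<comment> \<open>\<open>S n\<close> is the ideal generated by \<open>z 0, \<dots>, z (n - 1)\<close>, where \<open>z i\<close> stands for \<open>c y\<^sup>i\<close>.\<close>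
  define S where "S = rec_nat {\<zero>} (\<lambda>n I. PIdl (z n) <+> I)"
  have S0: "S 0 = {\<zero>}" and S_Suc: "S (Suc n) = PIdl (z n) <+> S n" for n
    by (simp_all add: S_def)
  have S_ideal: "ideal (S n) R" for n
    by (induction n) (simp_all add: S0 S_Suc zeroideal add_ideals cgenideal_ideal z(1))
  have S_zero: "\<zero> \<in> S n" for n
    by (rule additive_subgroup.zero_closed[OF ideal.axioms(1)[OF S_ideal]])
  have S_carr: "w \<in> carrier R" if "w \<in> S n" for w n
    by (rule ideal.Icarr[OF S_ideal that])
  have S_step: "S n \<subseteq> S (Suc n)" for n
  proof
    fix w assume w: "w \<in> S n"
    have "\<zero> \<in> PIdl (z n)"
      by (rule additive_subgroup.zero_closed[OF ideal.axioms(1)[OF cgenideal_ideal[OF z(1)]]])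
    then have "\<zero> \<oplus> w \<in> S (Suc n)" unfolding S_Suc set_add_def' using w by blast
    then show "w \<in> S (Suc n)" using S_carr[OF w] by simp
  qed
  then have mono: "m \<le> n \<Longrightarrow> S m \<subseteq> S n" for m n by (rule lift_Suc_mono_le)
  have "subset.chain {I. ideal I R} (range S)"
    unfolding subset_chain_def
  proof (intro conjI ballI)
    show "range S \<subseteq> {I. ideal I R}" using S_ideal by blast
    fix I J assume "I \<in> range S" "J \<in> range S"
    then obtain m n where mn: "I = S m" "J = S n" by blast
    show "I \<subseteq> J \<or> J \<subseteq> I" unfolding mn using mono[of m n] mono[of n m] nat_le_linear by blast
  qed
  then have "\<Union>(range S) \<in> range S" by (intro N.ideal_chain_is_trivial) auto
  then obtain m where m: "\<Union>(range S) = S m" by blast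
  have "z m \<in> S (Suc m)"
  proof -
    have "z m \<oplus> \<zero> \<in> S (Suc m)" unfolding S_Suc set_add_def'
      using cgenideal_self[OF z(1)] S_zero by blast
    then show ?thesis using z(1) by simp
  qed
  then have "z m \<in> S m" using m by blast
  then have neg: "\<ominus> z m \<in> S m"
    by (rule additive_subgroup.a_inv_closed[OF ideal.axioms(1)[OF S_ideal]])
  \<comment> \<open>The list \<open>f\<close> collects the coefficients of \<open>w\<close> with respect to the generators \<open>c y\<^sup>i\<close>, highest power first.\<close>
  have "\<exists>f. length f = n \<and> set f \<subseteq> ?i ` carrier R \<and> ?i w = ?i c \<otimes>\<^bsub>T.L\<^esub> T.L.eval f y" if "w \<in> S n" for n w
    using that
  proof (induction n arbitrary: w)
    case 0
    then show ?case using S0 ic[OF c(1)] by (auto simp: T.loc_zero[symmetric])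
  next
    case (Suc n)
    then obtain r v where rv: "r \<in> carrier R" "v \<in> S n" "w = r \<otimes> z n \<oplus> v"
      unfolding S_Suc set_add_def' cgenideal_def by blast
    obtain f where f: "length f = n" "set f \<subseteq> ?i ` carrier R" "?i v = ?i c \<otimes>\<^bsub>T.L\<^esub> T.L.eval f y"
      using Suc.IH[OF rv(2)] by blast
    have fc: "T.L.eval f y \<in> carrier T.L"
      using f(2) ic y by (intro T.L.eval_in_carrier) auto
    have "?i w = ?i r \<otimes>\<^bsub>T.L\<^esub> (?i c \<otimes>\<^bsub>T.L\<^esub> y [^]\<^bsub>T.L\<^esub> n) \<oplus>\<^bsub>T.L\<^esub> ?i c \<otimes>\<^bsub>T.L\<^esub> T.L.eval f y"
      unfolding rv(3) using rv(1) z(1)[of n] S_carr[OF rv(2)] by (simp add: iadd imult iz f(3))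
    also have "\<dots> = ?i c \<otimes>\<^bsub>T.L\<^esub> (?i r \<otimes>\<^bsub>T.L\<^esub> y [^]\<^bsub>T.L\<^esub> n \<oplus>\<^bsub>T.L\<^esub> T.L.eval f y)"
      using ic[OF c(1)] ic[OF rv(1)] y fc by (simp add: T.L.r_distr T.L.m_lcomm)
    also have "\<dots> = ?i c \<otimes>\<^bsub>T.L\<^esub> T.L.eval (?i r # f) y" by (simp add: f(1))
    finally show ?case using f rv(1) by (intro exI[of _ "?i r # f"]) auto
  qed
  from this[OF neg] obtain f where f: "length f = m" "set f \<subseteq> ?i ` carrier R"
    "?i (\<ominus> z m) = ?i c \<otimes>\<^bsub>T.L\<^esub> T.L.eval f y" by blast
  have fc: "T.L.eval f y \<in> carrier T.L"
    using f(2) ic y by (intro T.L.eval_in_carrier) auto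
  have ym: "y [^]\<^bsub>T.L\<^esub> m \<in> carrier T.L" using y by simp
  have "?i c \<otimes>\<^bsub>T.L\<^esub> T.L.eval (\<one>\<^bsub>T.L\<^esub> # f) y = ?i c \<otimes>\<^bsub>T.L\<^esub> y [^]\<^bsub>T.L\<^esub> m \<oplus>\<^bsub>T.L\<^esub> ?i c \<otimes>\<^bsub>T.L\<^esub> T.L.eval f y"
    using ic[OF c(1)] ym fc by (simp add: f(1) T.L.r_distr)
  also have "\<dots> = ?i (z m \<oplus> \<ominus> z m)"
    using z(1)[of m] by (simp add: iadd iz[symmetric] f(3)[symmetric] del: r_neg)
  also have "\<dots> = \<zero>\<^bsub>T.L\<^esub>" using z(1)[of m] by (simp add: r_neg T.loc_zero)
  finally have "?i c \<otimes>\<^bsub>T.L\<^esub> T.L.eval (\<one>\<^bsub>T.L\<^esub> # f) y = \<zero>\<^bsub>T.L\<^esub>" .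
  moreover have "?i c \<noteq> \<zero>\<^bsub>T.L\<^esub>" using c T.S_one by (simp add: T.lfrac_zero_iff)
  moreover have "T.L.eval (\<one>\<^bsub>T.L\<^esub> # f) y \<in> carrier T.L" using ym fc f(1) by simp
  ultimately have root: "T.L.eval (\<one>\<^bsub>T.L\<^esub> # f) y = \<zero>\<^bsub>T.L\<^esub>"
    using K.integral ic[OF c(1)] by blast
  have "set (\<one>\<^bsub>T.L\<^esub> # f) \<subseteq> to_tot_frac R ` carrier R"
    using f(2) by (auto simp: to_tot_frac_def T.loc_one)
  then have "y \<in> to_tot_frac R ` carrier R"
    using normal root y unfolding normal_domain_def tot_frac_def
    by (metis list.sel(1) list.distinct(1))
  then obtain r where r: "r \<in> carrier R" "T.fr a b = T.fr r \<one>" unfolding y_def to_tot_frac_def by blast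
  then have "a \<otimes> \<one> = r \<otimes> b" using a bn T.S_one T.lfrac_eq_iff_cross by blast
  then show ?thesis using r a by auto
qed

text \<open>The classical proof that \<open>R\<^sub>Q\<close> is a discrete valuation ring, written with elements of \<open>R\<close>. Fix
  \<open>0 \<noteq> b \<in> Q\<close>. Among the ideals \<open>ann c = (b R\<^sub>Q : c) \<inter> R\<close> with \<open>c \<notin> b R\<^sub>Q\<close>, a maximal one is prime and
  lies between \<open>(b)\<close> and \<open>Q\<close>, so it equals \<open>Q\<close> because \<open>Q\<close> has height one. Put \<open>x = c / b\<close>, so that
  \<open>x Q R\<^sub>Q \<subseteq> R\<^sub>Q\<close>. If \<open>x Q R\<^sub>Q \<subseteq> Q R\<^sub>Q\<close>, a multiple \<open>s x\<close> with \<open>s \<notin> Q\<close> maps \<open>Q\<close> to itself; then all \<open>b (s x)\<^sup>n\<close> lie in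
  \<open>R\<close>, whence \<open>s x \<in> R\<close> by normality, which contradicts \<open>c \<notin> b R\<^sub>Q\<close>. So \<open>x q\<close> is a unit of \<open>R\<^sub>Q\<close> for some
  \<open>q \<in> Q\<close>, and this \<open>q\<close> generates \<open>Q R\<^sub>Q\<close>. Finally, dividing by \<open>q\<close> repeatedly must stop at a unit, since
  it strictly enlarges the ideals \<open>sat a = a R\<^sub>Q \<inter> R\<close>.\<close>

lemma (in "domain") ex_uniformizer:
  assumes noeth: "noetherian_ring R" and normal: "normal_domain R"
    and Q: "primeideal Q R" and ht: "prime_height R Q = 1"
  shows "\<exists>\<pi>. uniformizer R Q \<pi>"
proof -
  interpret N: noetherian_ring R by fact
  interpret Q: primeideal Q R by fact
  have Qmin: "Q' = {\<zero>} \<or> Q' = Q" if "primeideal Q' R" "Q' \<subseteq> Q" for Q'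
    using prime_height_one_iff[OF Q] ht that by blast
  have one: "\<one> \<notin> Q" using Q.I_notcarr Q.one_imp_carrier by blast
  have cm: "s \<otimes> t \<in> carrier R - Q" if "s \<in> carrier R - Q" "t \<in> carrier R - Q" for s t
    using that Q.I_prime by auto
  obtain b where b: "b \<in> Q" "b \<noteq> \<zero>"
    using prime_height_one_iff[OF Q] ht Q.zero_closed by blast
  have bc: "b \<in> carrier R" using b Q.Icarr by blast
  define ann where "ann c = {r \<in> carrier R. \<exists>s\<in>carrier R - Q. \<exists>k\<in>carrier R. s \<otimes> (r \<otimes> c) = k \<otimes> b}" for c
  have annI: "r \<in> ann c" if "r \<in> carrier R" "s \<in> carrier R - Q" "k \<in> carrier R" "s \<otimes> (r \<otimes> c) = k \<otimes> b" for r c s k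
    unfolding ann_def using that by blast
  have ann_ideal: "ideal (ann c) R" if c: "c \<in> carrier R" for c
  proof (rule ideal_of_closed)
    show "ann c \<subseteq> carrier R" by (auto simp: ann_def)
    show "\<zero> \<in> ann c" by (rule annI[of _ \<one> \<zero>]) (use one c bc in auto)
    fix x y assume "x \<in> ann c" "y \<in> ann c"
    then obtain s k s' k' where e: "x \<in> carrier R" "s \<in> carrier R - Q" "k \<in> carrier R" "s \<otimes> (x \<otimes> c) = k \<otimes> b"
      "y \<in> carrier R" "s' \<in> carrier R - Q" "k' \<in> carrier R" "s' \<otimes> (y \<otimes> c) = k' \<otimes> b"
      unfolding ann_def by blast
    have "(s \<otimes> s') \<otimes> ((x \<oplus> y) \<otimes> c) = s' \<otimes> (s \<otimes> (x \<otimes> c)) \<oplus> s \<otimes> (s' \<otimes> (y \<otimes> c))"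
      using e(1,2,5,6) c by (simp add: l_distr r_distr m_ac)
    also have "\<dots> = (s' \<otimes> k \<oplus> s \<otimes> k') \<otimes> b"
      unfolding e(4) e(8) using e(2,3,6,7) bc by (simp add: l_distr m_assoc)
    finally show "x \<oplus> y \<in> ann c"
      using e(1-3,5-7) cm by (intro annI[of _ "s \<otimes> s'" "s' \<otimes> k \<oplus> s \<otimes> k'"]) auto
  next
    fix r x assume r: "r \<in> carrier R" and "x \<in> ann c"
    then obtain s k where e: "x \<in> carrier R" "s \<in> carrier R - Q" "k \<in> carrier R" "s \<otimes> (x \<otimes> c) = k \<otimes> b"
      unfolding ann_def by blast
    have "s \<otimes> ((r \<otimes> x) \<otimes> c) = r \<otimes> (s \<otimes> (x \<otimes> c))" using e(1,2) r c by (simp add: m_ac)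
    also have "\<dots> = (r \<otimes> k) \<otimes> b" unfolding e(4) using e(3) r bc by (simp add: m_assoc)
    finally show "r \<otimes> x \<in> ann c" using e(1-3) r by (intro annI[of _ s "r \<otimes> k"]) auto
  qed
  let ?F = "{ann c | c. c \<in> carrier R \<and> \<one> \<notin> ann c}"
  have "\<one> \<notin> ann \<one>"
  proof
    assume "\<one> \<in> ann \<one>"
    then obtain s k where s: "s \<in> carrier R - Q" "k \<in> carrier R" "s = k \<otimes> b" unfolding ann_def by auto
    have "k \<otimes> b \<in> Q" using b(1) s(2) by (rule Q.I_l_closed)
    then show False using s by blast
  qed
  then have "?F \<noteq> {}" by blast
  then obtain M where M: "M \<in> ?F" and max: "\<And>J. J \<in> ?F \<Longrightarrow> M \<subseteq> J \<Longrightarrow> J = M"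
    by (rule N.ex_maximal_ideal_among) (use ann_ideal in auto)
  obtain c where c: "c \<in> carrier R" "\<one> \<notin> ann c" "M = ann c" using M by blast
  have c0: "c \<noteq> \<zero>"
  proof
    assume "c = \<zero>"
    then have "\<one> \<in> ann c" by (intro annI[of _ \<one> \<zero>]) (use one bc in auto)
    then show False using c by simp
  qed
  have "primeideal M R"
  proof (rule primeidealI)
    show "ideal M R" using c ann_ideal by blast
    show "cring R" by (rule is_cring)
    show "carrier R \<noteq> M" using c one_closed by blast
    fix x y assume x: "x \<in> carrier R" and y: "y \<in> carrier R" and xy: "x \<otimes> y \<in> M"
    show "x \<in> M \<or> y \<in> M"
    proof (rule disjCI)
      assume ny: "y \<notin> M"
      have "\<one> \<notin> ann (y \<otimes> c)"
        using ny y c by (auto simp: ann_def)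
      then have "ann (y \<otimes> c) \<in> ?F" using y c by blast
      moreover have "M \<subseteq> ann (y \<otimes> c)"
      proof
        fix r assume "r \<in> M"
        then obtain s k where e: "r \<in> carrier R" "s \<in> carrier R - Q" "k \<in> carrier R" "s \<otimes> (r \<otimes> c) = k \<otimes> b"
          unfolding c(3) ann_def by blast
        have "s \<otimes> (r \<otimes> (y \<otimes> c)) = y \<otimes> (s \<otimes> (r \<otimes> c))" using e(1,2) y c(1) by (simp add: m_ac)
        also have "\<dots> = (y \<otimes> k) \<otimes> b" unfolding e(4) using e(3) y bc by (simp add: m_assoc)
        finally show "r \<in> ann (y \<otimes> c)" using e(1-3) y by (intro annI[of _ s "y \<otimes> k"]) auto
      qed
      ultimately have "ann (y \<otimes> c) = M" by (rule max)
      moreover have "x \<in> ann (y \<otimes> c)"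
        using xy x y c(1) unfolding c(3) ann_def by (auto simp: m_assoc)
      ultimately show "x \<in> M" by blast
    qed
  qed
  moreover have "M \<subseteq> Q"
  proof (rule subsetI, rule ccontr)
    fix r assume "r \<in> M" and rQ: "r \<notin> Q"
    then obtain s k where e: "r \<in> carrier R" "s \<in> carrier R - Q" "k \<in> carrier R" "s \<otimes> (r \<otimes> c) = k \<otimes> b"
      unfolding c(3) ann_def by blast
    have "(s \<otimes> r) \<otimes> (\<one> \<otimes> c) = k \<otimes> b" using e(1,2) c(1) by (simp add: m_assoc e(4)[symmetric])
    moreover have "s \<otimes> r \<in> carrier R - Q" using e(1,2) rQ by (intro cm) auto
    ultimately have "\<one> \<in> ann c" using e(3) by (intro annI) auto
    then show False using c by simp
  qed
  moreover have "b \<in> M"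
    unfolding c(3) by (rule annI[of _ \<one> c]) (use one bc c(1) in \<open>auto simp: m_comm\<close>)
  ultimately have MQ: "ann c = Q" using Qmin b(2) c(3) by blast
  \<comment> \<open>Some \<open>q c / b\<close> with \<open>q \<in> Q\<close> is a unit of \<open>R\<^sub>Q\<close>.\<close>
  have "\<exists>q\<in>Q. \<exists>s\<in>carrier R - Q. \<exists>u\<in>carrier R - Q. s \<otimes> (q \<otimes> c) = u \<otimes> b"
  proof (rule ccontr)
    assume no: "\<not> ?thesis"
    have stable: "\<exists>s\<in>carrier R - Q. \<exists>k\<in>Q. s \<otimes> (q \<otimes> c) = k \<otimes> b" if q: "q \<in> Q" for q
    proof -
      obtain s k where "s \<in> carrier R - Q" "k \<in> carrier R" "s \<otimes> (q \<otimes> c) = k \<otimes> b"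
        using q[folded MQ] unfolding ann_def by blast
      then show ?thesis using no q by blast
    qed
    obtain A where A: "A \<subseteq> carrier R" "finite A" "Q = Idl A" using N.finetely_gen[OF Q.is_ideal] by blast
    have AQ: "A \<subseteq> Q" unfolding A(3) by (rule genideal_self[OF A(1)])
    \<comment> \<open>As \<open>Q\<close> is finitely generated, the denominators have a common multiple.\<close>
    have "\<exists>s\<in>carrier R - Q. \<forall>q\<in>A. \<exists>k\<in>Q. s \<otimes> (q \<otimes> c) = k \<otimes> b"
      using A(2) AQ
    proof (induction A rule: finite_induct)
      case empty
      then show ?case using one by auto
    next
      case (insert q B)
      obtain s where s: "s \<in> carrier R - Q" "\<forall>q\<in>B. \<exists>k\<in>Q. s \<otimes> (q \<otimes> c) = k \<otimes> b" using insert by blast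
      obtain t k where t: "t \<in> carrier R - Q" "k \<in> Q" "t \<otimes> (q \<otimes> c) = k \<otimes> b" using stable insert.prems by blast
      have "\<exists>k\<in>Q. (s \<otimes> t) \<otimes> (q' \<otimes> c) = k \<otimes> b" if q': "q' \<in> insert q B" for q'
      proof (cases "q' = q")
        case True
        have "(s \<otimes> t) \<otimes> (q \<otimes> c) = s \<otimes> (t \<otimes> (q \<otimes> c))"
          using s(1) t(1) c(1) insert.prems Q.Icarr by (auto simp: m_assoc)
        also have "\<dots> = (s \<otimes> k) \<otimes> b" unfolding t(3) using s(1) Q.Icarr[OF t(2)] bc by (simp add: m_assoc)
        finally show ?thesis using True s(1) t(2) Q.I_l_closed by blast
      next
        case False
        then obtain k' where k': "k' \<in> Q" "s \<otimes> (q' \<otimes> c) = k' \<otimes> b" using s q' by blast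
        have qc: "q' \<in> carrier R" using q' insert.prems Q.Icarr by blast
        have "(s \<otimes> t) \<otimes> (q' \<otimes> c) = t \<otimes> (s \<otimes> (q' \<otimes> c))"
          using s(1) t(1) c(1) qc by (simp add: m_ac)
        also have "\<dots> = (t \<otimes> k') \<otimes> b" unfolding k'(2) using t(1) Q.Icarr[OF k'(1)] bc by (simp add: m_assoc)
        finally show ?thesis using t(1) k'(1) Q.I_l_closed by blast
      qed
      then show ?case using cm[OF s(1) t(1)] by blast
    qed
    then obtain s where s: "s \<in> carrier R - Q" "\<And>q. q \<in> A \<Longrightarrow> \<exists>k\<in>Q. s \<otimes> (q \<otimes> c) = k \<otimes> b" by blast
    let ?a = "s \<otimes> c"
    have a: "?a \<in> carrier R" using s(1) c(1) by simp
    let ?J = "{q \<in> carrier R. \<exists>k\<in>Q. q \<otimes> ?a = k \<otimes> b}"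
    have "ideal ?J R"
    proof (rule ideal_of_closed)
      show "\<zero> \<in> ?J" using a bc by (auto intro!: bexI[of _ \<zero>])
      fix x y assume "x \<in> ?J" "y \<in> ?J"
      then obtain k k' where e: "x \<in> carrier R" "k \<in> Q" "x \<otimes> ?a = k \<otimes> b" "y \<in> carrier R" "k' \<in> Q" "y \<otimes> ?a = k' \<otimes> b"
        by blast
      have "(x \<oplus> y) \<otimes> ?a = (k \<oplus> k') \<otimes> b"
        using e(1,4) a bc Q.Icarr[OF e(2)] Q.Icarr[OF e(5)] by (simp only: l_distr e(3,6))
      then show "x \<oplus> y \<in> ?J" using e Q.a_closed by blast
    next
      fix r x assume r: "r \<in> carrier R" and "x \<in> ?J"
      then obtain k where e: "x \<in> carrier R" "k \<in> Q" "x \<otimes> ?a = k \<otimes> b" by blast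
      have "(r \<otimes> x) \<otimes> ?a = (r \<otimes> k) \<otimes> b"
        using e(1) r a bc Q.Icarr[OF e(2)] by (simp only: m_assoc e(3))
      then show "r \<otimes> x \<in> ?J" using e(1,2) r Q.I_l_closed by blast
    qed auto
    moreover have "A \<subseteq> ?J"
    proof
      fix q assume q: "q \<in> A"
      have "q \<in> carrier R" using q A(1) by blast
      moreover have "q \<otimes> ?a = s \<otimes> (q \<otimes> c)" using calculation s(1) c(1) by (simp add: m_ac)
      ultimately show "q \<in> ?J" using s(2)[OF q] by auto
    qed
    ultimately have QJ: "Q \<subseteq> ?J" unfolding A(3) by (rule genideal_minimal)
    have "\<exists>z\<in>Q. b \<otimes> ?a [^] n = z \<otimes> b [^] n" for n :: nat
    proof (induction n)
      case 0 show ?case using b(1) by (intro bexI[of _ b]) auto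
    next
      case (Suc n)
      then obtain z where z: "z \<in> Q" "b \<otimes> ?a [^] n = z \<otimes> b [^] n" by blast
      obtain k where k: "k \<in> Q" "z \<otimes> ?a = k \<otimes> b" using QJ z(1) by blast
      note zc = Q.Icarr[OF z(1)] and kc = Q.Icarr[OF k(1)]
      have "b \<otimes> ?a [^] Suc n = (b \<otimes> ?a [^] n) \<otimes> ?a" using a bc by (simp add: m_assoc)
      also have "\<dots> = (z \<otimes> ?a) \<otimes> b [^] n" unfolding z(2) using a zc bc by (simp add: m_ac)
      also have "\<dots> = k \<otimes> b [^] Suc n" unfolding k(2) using kc bc by (simp add: m_ac)
      finally show ?case using k(1) by blast
    qed
    then have "\<exists>r\<in>carrier R. ?a = r \<otimes> b"
      using Q.Icarr by (intro normal_domain_almost_integral[OF noeth normal a bc b(2) bc b(2)]) blast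
    then obtain r where "r \<in> carrier R" "?a = r \<otimes> b" by blast
    then have "\<one> \<in> ann c" using s(1) c(1) by (intro annI[of _ s r]) auto
    then show False using c by simp
  qed
  then obtain q s u where q: "q \<in> Q" "s \<in> carrier R - Q" "u \<in> carrier R - Q" "s \<otimes> (q \<otimes> c) = u \<otimes> b" by blast
  have qc: "q \<in> carrier R" using q(1) Q.Icarr by blast
  have q0: "q \<noteq> \<zero>"
  proof
    assume "q = \<zero>"
    then have "u \<otimes> b = \<zero>" using q(2,4) c(1) by auto
    then have "u = \<zero>" using q(3) b(2) bc integral by blast
    then show False using q(3) Q.zero_closed by blast
  qed
  have divides: "\<exists>t\<in>carrier R - Q. \<exists>k\<in>carrier R. t \<otimes> x = k \<otimes> q" if x: "x \<in> Q" for x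
  proof -
    have xc: "x \<in> carrier R" using x Q.Icarr by blast
    obtain t k where t: "t \<in> carrier R - Q" "k \<in> carrier R" "t \<otimes> (x \<otimes> c) = k \<otimes> b"
      using x[folded MQ] unfolding ann_def by blast
    have "((u \<otimes> t) \<otimes> x) \<otimes> c = u \<otimes> (t \<otimes> (x \<otimes> c))"
      using q(3) t(1) xc c(1) by (simp add: m_assoc)
    also have "\<dots> = k \<otimes> (u \<otimes> b)" unfolding t(3) using q(3) t(2) bc by (simp add: m_ac)
    also have "\<dots> = ((k \<otimes> s) \<otimes> q) \<otimes> c"
      unfolding q(4)[symmetric] using q(2) t(2) qc c(1) by (simp add: m_assoc)
    finally have "(u \<otimes> t) \<otimes> x = (k \<otimes> s) \<otimes> q"
      using q(2,3) t(1,2) xc qc c(1) c0 by (subst (asm) m_rcancel) auto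
    then show ?thesis using cm[OF q(3) t(1)] q(2) t(2) by blast
  qed
  define sat where "sat a = {r \<in> carrier R. \<exists>s\<in>carrier R - Q. \<exists>k\<in>carrier R. s \<otimes> r = k \<otimes> a}" for a
  have sat_ideal: "ideal (sat a) R" if a: "a \<in> carrier R" for a
  proof (rule ideal_of_closed)
    show "sat a \<subseteq> carrier R" by (auto simp: sat_def)
    show "\<zero> \<in> sat a" unfolding sat_def using one a by (auto intro!: bexI[of _ \<one>] bexI[of _ \<zero>])
    fix x y assume "x \<in> sat a" "y \<in> sat a"
    then obtain s k s' k' where e: "x \<in> carrier R" "s \<in> carrier R - Q" "k \<in> carrier R" "s \<otimes> x = k \<otimes> a"
      "y \<in> carrier R" "s' \<in> carrier R - Q" "k' \<in> carrier R" "s' \<otimes> y = k' \<otimes> a"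
      unfolding sat_def by blast
    have "(s \<otimes> s') \<otimes> (x \<oplus> y) = s' \<otimes> (s \<otimes> x) \<oplus> s \<otimes> (s' \<otimes> y)"
      using e(1,2,5,6) by (simp add: r_distr m_ac)
    also have "\<dots> = (s' \<otimes> k \<oplus> s \<otimes> k') \<otimes> a"
      unfolding e(4) e(8) using e(2,3,6,7) a by (simp add: l_distr m_assoc)
    finally have "(s \<otimes> s') \<otimes> (x \<oplus> y) = (s' \<otimes> k \<oplus> s \<otimes> k') \<otimes> a" .
    moreover have "s' \<otimes> k \<oplus> s \<otimes> k' \<in> carrier R" using e(2,3,6,7) by simp
    ultimately show "x \<oplus> y \<in> sat a" unfolding sat_def using e(1,5) cm[OF e(2,6)] by blast
  next
    fix r x assume r: "r \<in> carrier R" and "x \<in> sat a"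
    then obtain s k where e: "x \<in> carrier R" "s \<in> carrier R - Q" "k \<in> carrier R" "s \<otimes> x = k \<otimes> a"
      unfolding sat_def by blast
    have "s \<otimes> (r \<otimes> x) = r \<otimes> (s \<otimes> x)" using e(1,2) r by (simp add: m_ac)
    also have "\<dots> = (r \<otimes> k) \<otimes> a" unfolding e(4) using e(3) r a by (simp add: m_assoc)
    finally show "r \<otimes> x \<in> sat a" unfolding sat_def using e(1,2) m_closed[OF r e(3)] m_closed[OF r e(1)] by blast
  qed
  define good where "good a \<longleftrightarrow> (\<exists>n::nat. \<exists>s\<in>carrier R - Q. \<exists>t\<in>carrier R - Q. s \<otimes> a = t \<otimes> q [^] n)" for a
  have good: "good a" if a: "a \<in> carrier R" "a \<noteq> \<zero>" for a
  proof (rule ccontr)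
    assume "\<not> good a"
    let ?G = "{sat a | a. a \<in> carrier R \<and> a \<noteq> \<zero> \<and> \<not> good a}"
    have "?G \<noteq> {}" using a \<open>\<not> good a\<close> by blast
    then obtain M where M: "M \<in> ?G" and max: "\<And>J. J \<in> ?G \<Longrightarrow> M \<subseteq> J \<Longrightarrow> J = M"
      by (rule N.ex_maximal_ideal_among) (use sat_ideal in auto)
    obtain a where a: "a \<in> carrier R" "a \<noteq> \<zero>" "\<not> good a" "M = sat a" using M by blast
    have "a \<in> Q"
    proof (rule ccontr)
      assume "a \<notin> Q"
      then have "a \<in> carrier R - Q" "\<one> \<in> carrier R - Q" "\<one> \<otimes> a = a \<otimes> q [^] (0::nat)" using a(1) one by auto
      then have "good a" unfolding good_def by blast
      then show False using a by simp
    qed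
    then obtain t k where t: "t \<in> carrier R - Q" "k \<in> carrier R" "t \<otimes> a = k \<otimes> q" using divides by blast
    have k0: "k \<noteq> \<zero>"
    proof
      assume "k = \<zero>"
      then have "t \<otimes> a = \<zero>" using t(3) qc by simp
      then have "t = \<zero>" using t(1) a(1,2) integral by blast
      then show False using t(1) Q.zero_closed by blast
    qed
    have "\<not> good k"
    proof
      assume "good k"
      then obtain n :: nat and s v where g: "s \<in> carrier R - Q" "v \<in> carrier R - Q" "s \<otimes> k = v \<otimes> q [^] n"
        unfolding good_def by blast
      have "(s \<otimes> t) \<otimes> a = s \<otimes> (t \<otimes> a)" using g(1) t(1) a(1) by (simp add: m_assoc)
      also have "\<dots> = (s \<otimes> k) \<otimes> q" unfolding t(3) using g(1) t(2) qc by (simp add: m_assoc)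
      also have "\<dots> = v \<otimes> q [^] Suc n" unfolding g(3) using g(2) qc by (simp add: m_assoc)
      finally have "good a" unfolding good_def using cm[OF g(1) t(1)] g(2) by blast
      then show False using a by simp
    qed
    then have "sat k \<in> ?G" using t(2) k0 by blast
    moreover have "M \<subseteq> sat k"
    proof
      fix r assume "r \<in> M"
      then obtain s l where e: "r \<in> carrier R" "s \<in> carrier R - Q" "l \<in> carrier R" "s \<otimes> r = l \<otimes> a"
        unfolding a(4) sat_def by blast
      have "(t \<otimes> s) \<otimes> r = t \<otimes> (s \<otimes> r)" using t(1) e(1,2) by (simp add: m_assoc)
      also have "\<dots> = l \<otimes> (t \<otimes> a)" unfolding e(4) using t(1) e(3) a(1) by (simp add: m_ac)
      also have "\<dots> = (l \<otimes> q) \<otimes> k" unfolding t(3) using t(2) e(3) qc by (simp add: m_ac)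
      finally show "r \<in> sat k" unfolding sat_def using e(1) cm[OF t(1) e(2)] m_closed[OF e(3) qc] by blast
    qed
    ultimately have "sat k = M" by (rule max)
    moreover have "k \<in> sat k"
      unfolding sat_def using t(2) one by (auto intro!: bexI[of _ \<one>])
    ultimately have "k \<in> sat a" using a(4) by blast
    then obtain s l where e: "s \<in> carrier R - Q" "l \<in> carrier R" "s \<otimes> k = l \<otimes> a" unfolding sat_def by blast
    have "(s \<otimes> t) \<otimes> a = s \<otimes> (t \<otimes> a)" using e(1) t(1) a(1) by (simp add: m_assoc)
    also have "\<dots> = (s \<otimes> k) \<otimes> q" unfolding t(3) using e(1) t(2) qc by (simp add: m_assoc)
    also have "\<dots> = (l \<otimes> q) \<otimes> a" unfolding e(3) using e(2) a(1) qc by (simp add: m_ac)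
    finally have "s \<otimes> t = l \<otimes> q" using e(1,2) t(1) a(1,2) qc by (subst (asm) m_rcancel) auto
    then have "s \<otimes> t \<in> Q" using Q.I_l_closed[OF q(1) e(2)] by simp
    then show False using cm[OF e(1) t(1)] by blast
  qed
  have "uniformizer R Q q"
    by unfold_locales (use q(1) q0 good in \<open>auto simp: good_def\<close>)
  then show ?thesis by blast
qed

section \<open>Primes and poles under localization\<close>

text \<open>The prime \<open>Q R\<^sub>P\<close>, for a prime \<open>Q\<close> contained in \<open>P\<close>.\<close>

definition extend_prime :: "('a, 'm) ring_scheme \<Rightarrow> 'a set \<Rightarrow> 'a set \<Rightarrow> ('a \<times> 'a) set set" where
  "extend_prime R P Q = {lfrac R (carrier R - P) a s | a s. a \<in> Q \<and> s \<in> carrier R - P}"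

locale nested_primes = "domain" R + P: primeideal P R + Q: primeideal Q R
  for R (structure) and P and Q +
  assumes Q_sub: "Q \<subseteq> P"
begin

sublocale loc: localizing_domain R "carrier R - P"
  by (rule localizing_domain_compl) (rule P.primeideal)

sublocale A: "domain" loc.L
  by (rule loc.loc_domain)

abbreviation "QA \<equiv> extend_prime R P Q"

lemma not_P_imp_not_Q: "s \<in> carrier R - P \<Longrightarrow> s \<in> carrier R - Q"
  using Q_sub by blast

lemma in_extend_prime_iff:
  assumes a: "a \<in> carrier R" and s: "s \<in> carrier R - P"
  shows "loc.fr a s \<in> QA \<longleftrightarrow> a \<in> Q"
proof
  assume "loc.fr a s \<in> QA"
  then obtain b t where b: "b \<in> Q" "t \<in> carrier R - P" "loc.fr a s = loc.fr b t"
    unfolding extend_prime_def by blast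
  then have "a \<otimes> t = b \<otimes> s" using a s Q.Icarr[OF b(1)] by (subst (asm) loc.lfrac_eq_iff_cross)
  moreover have "b \<otimes> s \<in> Q" using b(1) s by (intro Q.I_r_closed) auto
  ultimately have "a \<otimes> t \<in> Q" by simp
  then show "a \<in> Q" using Q.I_prime a not_P_imp_not_Q[OF b(2)] by blast
next
  assume "a \<in> Q"
  then show "loc.fr a s \<in> QA" unfolding extend_prime_def using s by blast
qed

lemma primeideal_extend_prime: "primeideal QA loc.L"
proof (rule primeidealI)
  show "cring loc.L" by (rule loc.loc_cring)
  show "ideal QA loc.L"
  proof (rule loc.L.ideal_of_closed)
    show "QA \<subseteq> carrier loc.L"
      unfolding extend_prime_def using loc.lfrac_in Q.Icarr by blast
    show "\<zero>\<^bsub>loc.L\<^esub> \<in> QA"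
      unfolding loc.loc_zero using loc.S_one by (subst in_extend_prime_iff) auto
    fix x y assume "x \<in> QA" "y \<in> QA"
    then obtain a s b t where e: "a \<in> Q" "s \<in> carrier R - P" "x = loc.fr a s" "b \<in> Q" "t \<in> carrier R - P" "y = loc.fr b t"
      unfolding extend_prime_def by blast
    note ac = Q.Icarr[OF e(1)] and bc = Q.Icarr[OF e(4)]
    have "a \<otimes> t \<oplus> b \<otimes> s \<in> Q" using e(1,2,4,5) by (intro Q.a_closed Q.I_r_closed) auto
    moreover have "a \<otimes> t \<oplus> b \<otimes> s \<in> carrier R" using ac bc e(2,5) by auto
    ultimately show "x \<oplus>\<^bsub>loc.L\<^esub> y \<in> QA"
      unfolding e(3,6) loc.lfrac_add[OF ac e(2) bc e(5)]
      using in_extend_prime_iff loc.S_mult[OF e(2,5)] by blast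
  next
    fix r x assume r: "r \<in> carrier loc.L" and "x \<in> QA"
    then obtain a s where e: "a \<in> Q" "s \<in> carrier R - P" "x = loc.fr a s"
      unfolding extend_prime_def by blast
    obtain b t where bt: "b \<in> carrier R" "t \<in> carrier R - P" "r = loc.fr b t"
      using r by (rule loc.loc_cases)
    note ac = Q.Icarr[OF e(1)]
    show "r \<otimes>\<^bsub>loc.L\<^esub> x \<in> QA"
      unfolding e(3) bt(3) loc.lfrac_mult[OF bt(1,2) ac e(2)]
      using in_extend_prime_iff[OF m_closed[OF bt(1) ac] loc.S_mult[OF bt(2) e(2)]] Q.I_l_closed[OF e(1) bt(1)]
      by blast
  qed
  have "\<one> \<notin> Q" using Q.I_notcarr Q.one_imp_carrier by blast
  then have "\<one>\<^bsub>loc.L\<^esub> \<notin> QA"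
    unfolding loc.loc_one using in_extend_prime_iff[OF one_closed loc.S_one] by simp
  then show "carrier loc.L \<noteq> QA" using loc.L.one_closed by metis
  fix x y assume x: "x \<in> carrier loc.L" and y: "y \<in> carrier loc.L" and xy: "x \<otimes>\<^bsub>loc.L\<^esub> y \<in> QA"
  obtain a s where as: "a \<in> carrier R" "s \<in> carrier R - P" "x = loc.fr a s" using x by (rule loc.loc_cases)
  obtain b t where bt: "b \<in> carrier R" "t \<in> carrier R - P" "y = loc.fr b t" using y by (rule loc.loc_cases)
  have "a \<otimes> b \<in> Q"
    using xy in_extend_prime_iff[OF m_closed[OF as(1) bt(1)] loc.S_mult[OF as(2) bt(2)]]
    unfolding as(3) bt(3) loc.lfrac_mult[OF as(1,2) bt(1,2)] by blast
  then show "x \<in> QA \<or> y \<in> QA"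
    unfolding as(3) bt(3) using Q.I_prime[OF as(1) bt(1)] in_extend_prime_iff[OF as(1,2)] in_extend_prime_iff[OF bt(1,2)] by blast
qed

lemma contract_extend_prime: "{r \<in> carrier R. to_loc_at R P r \<in> QA} = Q"
  unfolding to_loc_at_def using in_extend_prime_iff loc.S_one Q.Icarr by blast

text \<open>A prime of \<open>R\<^sub>P\<close> is determined by its contraction to \<open>R\<close>, and the contraction of one that lies in
  \<open>Q R\<^sub>P\<close> is a prime inside \<open>Q\<close>.\<close>

lemma height_extend_prime:
  assumes "prime_height R Q = 1"
  shows "prime_height loc.L QA = 1"
proof -
  note h = iffD1[OF prime_height_one_iff[OF Q.primeideal] assms]
  obtain q where q: "q \<in> Q" "q \<noteq> \<zero>" using h Q.zero_closed by blast
  have "loc.fr q \<one> \<in> QA" "loc.fr q \<one> \<noteq> \<zero>\<^bsub>loc.L\<^esub>"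
    using q Q.Icarr loc.S_one by (auto simp: in_extend_prime_iff loc.lfrac_zero_iff)
  then have "QA \<noteq> {\<zero>\<^bsub>loc.L\<^esub>}" by blast
  moreover have "N = {\<zero>\<^bsub>loc.L\<^esub>} \<or> N = QA" if N: "primeideal N loc.L" "N \<subseteq> QA" for N
  proof -
    interpret N: primeideal N loc.L by fact
    let ?C = "{r \<in> carrier R. loc.fr r \<one> \<in> N}"
    have N_iff: "loc.fr a s \<in> N \<longleftrightarrow> a \<in> ?C" if as: "a \<in> carrier R" "s \<in> carrier R - P" for a s
    proof
      assume "loc.fr a s \<in> N"
      then have "loc.fr s \<one> \<otimes>\<^bsub>loc.L\<^esub> loc.fr a s \<in> N"
        using as loc.S_one by (intro N.I_l_closed loc.lfrac_in) auto
      then show "a \<in> ?C" using as by (simp add: loc.lfrac_mult_denominator)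
    next
      assume "a \<in> ?C"
      then have "loc.fr s \<one> \<otimes>\<^bsub>loc.L\<^esub> loc.fr a s \<in> N" using as by (simp add: loc.lfrac_mult_denominator)
      moreover have "loc.fr s \<one> \<notin> N"
        using N(2) in_extend_prime_iff[OF _ loc.S_one, of s] not_P_imp_not_Q[OF as(2)] by blast
      ultimately show "loc.fr a s \<in> N"
        using N.I_prime[of "loc.fr s \<one>" "loc.fr a s"] as loc.S_one loc.lfrac_in by blast
    qed
    have "primeideal ?C R"
    proof (rule primeidealI)
      show "cring R" by (rule is_cring)
      show "ideal ?C R"
      proof (rule ideal_of_closed)
        show "\<zero> \<in> ?C" using N.zero_closed by (simp add: loc.loc_zero[symmetric])
        fix x y assume "x \<in> ?C" "y \<in> ?C"
        then show "x \<oplus> y \<in> ?C" by (simp add: ring_hom_add[OF loc.to_loc_hom] N.a_closed)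
      next
        fix r x assume "r \<in> carrier R" "x \<in> ?C"
        then show "r \<otimes> x \<in> ?C"
          using loc.S_one by (simp add: ring_hom_mult[OF loc.to_loc_hom] N.I_l_closed loc.lfrac_in)
      qed blast
      have "\<one> \<notin> ?C" using N.I_notcarr N.one_imp_carrier by (auto simp: loc.loc_one[symmetric])
      then show "carrier R \<noteq> ?C" using one_closed by blast
      fix x y assume x: "x \<in> carrier R" "y \<in> carrier R" "x \<otimes> y \<in> ?C"
      then have "loc.fr x \<one> \<otimes>\<^bsub>loc.L\<^esub> loc.fr y \<one> \<in> N" by (simp add: ring_hom_mult[OF loc.to_loc_hom])
      then show "x \<in> ?C \<or> y \<in> ?C" using x(1,2) N.I_prime loc.lfrac_in[OF _ loc.S_one] by blast
    qed
    moreover have "?C \<subseteq> Q" using N(2) in_extend_prime_iff[OF _ loc.S_one] by blast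
    ultimately have "?C = {\<zero>} \<or> ?C = Q" using h by blast
    moreover have "N = QA" if CQ: "?C = Q"
    proof
      show "QA \<subseteq> N"
      proof
        fix x assume "x \<in> QA"
        then obtain a s where as: "a \<in> Q" "s \<in> carrier R - P" "x = loc.fr a s"
          unfolding extend_prime_def by blast
        then show "x \<in> N" using N_iff[OF Q.Icarr[OF as(1)] as(2)] CQ by blast
      qed
    qed fact
    moreover have "N = {\<zero>\<^bsub>loc.L\<^esub>}" if C0: "?C = {\<zero>}"
    proof
      show "N \<subseteq> {\<zero>\<^bsub>loc.L\<^esub>}"
      proof
        fix x assume x: "x \<in> N"
        obtain a s where as: "a \<in> carrier R" "s \<in> carrier R - P" "x = loc.fr a s"
          using N.Icarr[OF x] by (rule loc.loc_cases)
        then have "a = \<zero>" using x N_iff[OF as(1,2)] C0 by blast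
        then show "x \<in> {\<zero>\<^bsub>loc.L\<^esub>}" using as loc.lfrac_zero_iff by simp
      qed
    qed (use N.zero_closed in blast)
    ultimately show ?thesis by blast
  qed
  ultimately show ?thesis by (subst A.prime_height_one_iff[OF primeideal_extend_prime]) blast
qed

lemma to_loc_pow: "a \<in> carrier R \<Longrightarrow> loc.fr a \<one> [^]\<^bsub>loc.L\<^esub> (n::nat) = loc.fr (a [^] n) \<one>"
  using loc.lfrac_pow(2)[OF _ loc.S_one] by simp

lemma uniformizer_extend_prime:
  assumes "uniformizer R Q \<pi>"
  shows "uniformizer loc.L QA (loc.fr \<pi> \<one>)"
proof -
  interpret U: uniformizer R Q \<pi> by fact
  interpret QA: primeideal QA loc.L by (rule primeideal_extend_prime)
  show ?thesis
  proof
    show "loc.fr \<pi> \<one> \<in> QA" using U.unif_in loc.S_one by (simp add: in_extend_prime_iff)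
    show "loc.fr \<pi> \<one> \<noteq> \<zero>\<^bsub>loc.L\<^esub>" using U.unif_nonzero loc.S_one by (simp add: loc.lfrac_zero_iff)
    fix x assume x: "x \<in> carrier loc.L" "x \<noteq> \<zero>\<^bsub>loc.L\<^esub>"
    obtain a s where as: "a \<in> carrier R" "s \<in> carrier R - P" "x = loc.fr a s" using x(1) by (rule loc.loc_cases)
    have "a \<noteq> \<zero>" using x(2) as loc.lfrac_zero_iff by blast
    then obtain n :: nat and u v where u: "u \<in> carrier R - Q" "v \<in> carrier R - Q" "u \<otimes> a = v \<otimes> \<pi> [^] n"
      using U.unif_rep[OF as(1)] by blast
    have compl: "loc.fr w \<one> \<in> carrier loc.L - QA" if "w \<in> carrier R - Q" for w
      using that loc.lfrac_in[OF _ loc.S_one] in_extend_prime_iff[OF _ loc.S_one] by blast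
    have uc: "u \<in> carrier R" "v \<in> carrier R" "s \<in> carrier R" using u as by auto
    have "loc.fr (u \<otimes> s) \<one> \<otimes>\<^bsub>loc.L\<^esub> x = loc.fr u \<one> \<otimes>\<^bsub>loc.L\<^esub> (loc.fr s \<one> \<otimes>\<^bsub>loc.L\<^esub> loc.fr a s)"
      unfolding as(3) ring_hom_mult[OF loc.to_loc_hom uc(1,3)]
      using uc as(1,2) loc.S_one by (intro loc.L.m_assoc loc.lfrac_in) auto
    also have "\<dots> = loc.fr (u \<otimes> a) \<one>"
      unfolding loc.lfrac_mult_denominator[OF as(1,2)] using ring_hom_mult[OF loc.to_loc_hom uc(1) as(1)] by simp
    also have "\<dots> = loc.fr v \<one> \<otimes>\<^bsub>loc.L\<^esub> loc.fr \<pi> \<one> [^]\<^bsub>loc.L\<^esub> n"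
      unfolding u(3) to_loc_pow[OF U.unif_carr] using ring_hom_mult[OF loc.to_loc_hom uc(2), of "\<pi> [^] n"] by simp
    finally show "\<exists>n::nat. \<exists>s\<in>carrier loc.L - QA. \<exists>t\<in>carrier loc.L - QA.
        s \<otimes>\<^bsub>loc.L\<^esub> x = t \<otimes>\<^bsub>loc.L\<^esub> loc.fr \<pi> \<one> [^]\<^bsub>loc.L\<^esub> n"
      using compl[OF U.compl_mult[OF u(1) not_P_imp_not_Q[OF as(2)]]] compl[OF u(2)] by blast
  qed
qed

text \<open>Clear the denominators \<open>s, t \<notin> P\<close> of the witnesses; they lie outside \<open>Q\<close> as well.\<close>

lemma pole_le_contract:
  assumes pole: "pole_le loc.L QA (loc.fr \<pi> \<one>) k (loc.fr a \<one>) (loc.fr b \<one>)"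
    and c: "\<pi> \<in> carrier R" "a \<in> carrier R" "b \<in> carrier R"
  shows "pole_le R Q \<pi> k a b"
proof -
  obtain x y where xy: "x \<in> carrier loc.L - QA" "y \<in> carrier loc.L"
    "x \<otimes>\<^bsub>loc.L\<^esub> (loc.fr \<pi> \<one> [^]\<^bsub>loc.L\<^esub> k \<otimes>\<^bsub>loc.L\<^esub> loc.fr a \<one>) = y \<otimes>\<^bsub>loc.L\<^esub> loc.fr b \<one>"
    using pole unfolding pole_le_def by blast
  obtain u s where us: "u \<in> carrier R" "s \<in> carrier R - P" "x = loc.fr u s"
    using xy(1) loc.loc_cases by blast
  obtain v t where vt: "v \<in> carrier R" "t \<in> carrier R - P" "y = loc.fr v t"
    using xy(2) by (rule loc.loc_cases)
  have uQ: "u \<in> carrier R - Q" using xy(1) us in_extend_prime_iff[OF us(1,2)] by blast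
  have st: "s \<in> carrier R" "t \<in> carrier R" using us vt by auto
  have pc: "\<pi> [^] k \<otimes> a \<in> carrier R" using c by simp
  have "loc.fr (u \<otimes> (\<pi> [^] k \<otimes> a)) (s \<otimes> \<one>) = loc.fr (v \<otimes> b) (t \<otimes> \<one>)"
    using xy(3) unfolding us(3) vt(3) to_loc_pow[OF c(1)]
      ring_hom_mult[OF loc.to_loc_hom nat_pow_closed[OF c(1)] c(2), symmetric]
      loc.lfrac_mult[OF us(1,2) pc loc.S_one] loc.lfrac_mult[OF vt(1,2) c(3) loc.S_one] .
  then have "u \<otimes> (\<pi> [^] k \<otimes> a) \<otimes> t = v \<otimes> b \<otimes> s"
    using us(1,2) vt(1,2) c pc st by (subst (asm) loc.lfrac_eq_iff_cross) auto
  then have "(u \<otimes> t) \<otimes> (\<pi> [^] k \<otimes> a) = (v \<otimes> s) \<otimes> b"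
    using us(1) vt(1) st c pc by (simp add: m_ac)
  moreover have "u \<otimes> t \<in> carrier R - Q"
    using uQ not_P_imp_not_Q[OF vt(2)] Q.I_prime by auto
  ultimately show ?thesis unfolding pole_le_def using vt(1) st(1) m_closed by blast
qed

end

section \<open>Sections of an effective divisor\<close>

lemma (in primeideal) pole_le_mult:
  assumes "pole_le R I \<pi> k a b" "r \<in> carrier R" "\<pi> \<in> carrier R" "a \<in> carrier R" "b \<in> carrier R"
  shows "pole_le R I \<pi> k (r \<otimes> a) b"
proof -
  obtain s c where e: "s \<in> carrier R - I" "c \<in> carrier R" "s \<otimes> (\<pi> [^] k \<otimes> a) = c \<otimes> b"
    using assms(1) unfolding pole_le_def by blast
  have "s \<otimes> (\<pi> [^] k \<otimes> (r \<otimes> a)) = r \<otimes> (s \<otimes> (\<pi> [^] k \<otimes> a))"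
    using e(1) assms(2-5) by (simp add: m_ac)
  also have "\<dots> = (r \<otimes> c) \<otimes> b" unfolding e(3) using e(2) assms(2,5) by (simp add: m_assoc)
  finally show ?thesis unfolding pole_le_def using e(1) m_closed[OF assms(2) e(2)] by blast
qed

lemma (in primeideal) pole_le_add:
  assumes "pole_le R I \<pi> k a b" "pole_le R I \<pi> k a' b'" "\<pi> \<in> carrier R"
    and c: "a \<in> carrier R" "b \<in> carrier R" "a' \<in> carrier R" "b' \<in> carrier R"
  shows "pole_le R I \<pi> k (a \<otimes> b' \<oplus> a' \<otimes> b) (b \<otimes> b')"
proof -
  obtain s r where e: "s \<in> carrier R - I" "r \<in> carrier R" "s \<otimes> (\<pi> [^] k \<otimes> a) = r \<otimes> b"
    using assms(1) unfolding pole_le_def by blast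
  obtain s' r' where e': "s' \<in> carrier R - I" "r' \<in> carrier R" "s' \<otimes> (\<pi> [^] k \<otimes> a') = r' \<otimes> b'"
    using assms(2) unfolding pole_le_def by blast
  have sc: "s \<in> carrier R" "s' \<in> carrier R" and pc: "\<pi> [^] k \<in> carrier R" using e e' assms(3) by auto
  have "(s \<otimes> s') \<otimes> (\<pi> [^] k \<otimes> (a \<otimes> b' \<oplus> a' \<otimes> b))
      = (s' \<otimes> b') \<otimes> (s \<otimes> (\<pi> [^] k \<otimes> a)) \<oplus> (s \<otimes> b) \<otimes> (s' \<otimes> (\<pi> [^] k \<otimes> a'))"
    using sc pc c by (simp add: r_distr m_ac)
  also have "\<dots> = (s' \<otimes> r \<oplus> s \<otimes> r') \<otimes> (b \<otimes> b')"
    unfolding e(3) e'(3) using sc e(2) e'(2) c by (simp add: l_distr r_distr m_ac)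
  finally have "(s \<otimes> s') \<otimes> (\<pi> [^] k \<otimes> (a \<otimes> b' \<oplus> a' \<otimes> b)) = (s' \<otimes> r \<oplus> s \<otimes> r') \<otimes> (b \<otimes> b')" .
  moreover have "s \<otimes> s' \<in> carrier R - I" using e(1) e'(1) I_prime by auto
  moreover have "s' \<otimes> r \<oplus> s \<otimes> r' \<in> carrier R" using sc e(2) e'(2) by simp
  ultimately show ?thesis unfolding pole_le_def by blast
qed

lemma (in primeideal) pole_le_nonmember:
  assumes "\<pi> \<in> carrier R" "a \<in> carrier R" "b \<in> carrier R" "b \<notin> I"
  shows "pole_le R I \<pi> k a b"
  unfolding pole_le_def using assms m_comm[of b "\<pi> [^] k \<otimes> a"]
  by (intro bexI[of _ b] bexI[of _ "\<pi> [^] k \<otimes> a"]) auto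

text \<open>An element of \<open>Q\<close> has order at least one, so its power with exponent \<open>ord b\<close> absorbs the whole pole
  that \<open>1 / b\<close> has along \<open>Q\<close>.\<close>

lemma (in uniformizer) pole_le_mult_pow:
  assumes a: "a \<in> carrier R" and b: "b \<in> carrier R" "b \<noteq> \<zero>" and g: "g \<in> Q" "g \<noteq> \<zero>"
  shows "pole_le R Q \<pi> k (g [^] (ord_at R Q b) \<otimes> a) b"
proof (cases "a = \<zero>")
  case True
  have gc: "g \<in> carrier R" by (rule Q.Icarr) fact
  show ?thesis unfolding pole_le_def True using loc.S_one b gc
    by (intro bexI[of _ \<one>] bexI[of _ \<zero>]) auto
next
  case False
  have gc: "g \<in> carrier R" by (rule Q.Icarr) fact
  have pos: "1 \<le> ord_at R Q g"
  proof (rule ccontr)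
    obtain s t where st: "s \<in> carrier R - Q" "t \<in> carrier R - Q" "s \<otimes> g = t \<otimes> \<pi> [^] (ord_at R Q g)"
      using ord_at_rep[OF gc g(2)] .
    assume "\<not> 1 \<le> ord_at R Q g"
    then have "ord_at R Q g = 0" by simp
    then have "s \<otimes> g = t" using st by simp
    then show False using st(1,2) Q.I_l_closed[OF g(1)] by blast
  qed
  have "g [^] n \<noteq> \<zero> \<and> n \<le> ord_at R Q (g [^] n)" for n :: nat
  proof (induction n)
    case (Suc n)
    then have "ord_at R Q (g [^] n \<otimes> g) = ord_at R Q (g [^] n) + ord_at R Q g"
      using gc g(2) by (intro ord_at_mult) auto
    then show ?case using Suc pos gc g(2) integral by auto
  qed simp
  then have gn: "g [^] (ord_at R Q b) \<noteq> \<zero>" "ord_at R Q b \<le> ord_at R Q (g [^] (ord_at R Q b))" by auto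
  have gnc: "g [^] (ord_at R Q b) \<in> carrier R" using gc by simp
  have "g [^] (ord_at R Q b) \<otimes> a \<noteq> \<zero>" using gn(1) gnc a False integral by blast
  moreover have "ord_at R Q b \<le> ord_at R Q (g [^] (ord_at R Q b) \<otimes> a)"
    using ord_at_mult[OF gnc gn(1) a False] gn(2) by simp
  ultimately show ?thesis
    using gnc a b val_at_lfrac val_at_ge_iff[of "g [^] (ord_at R Q b) \<otimes> a" b k] by auto
qed

definition uniformizer_family :: "('a, 'm) ring_scheme \<Rightarrow> ('a set \<Rightarrow> 'a) \<Rightarrow> bool" where
  "uniformizer_family R \<pi> \<longleftrightarrow>
     (\<forall>Q. primeideal Q R \<and> prime_height R Q = 1 \<longrightarrow> uniformizer R Q (\<pi> Q))"

lemma uniformizer_familyD: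
  "uniformizer_family R \<pi> \<Longrightarrow> primeideal Q R \<Longrightarrow> prime_height R Q = 1 \<Longrightarrow> uniformizer R Q (\<pi> Q)"
  by (simp add: uniformizer_family_def)

lemma (in "domain") ex_uniformizer_family:
  assumes "noetherian_ring R" "normal_domain R"
  obtains \<pi> where "uniformizer_family R \<pi>"
  using ex_uniformizer[OF assms] unfolding uniformizer_family_def by metis

text \<open>A fraction \<open>a / b\<close> can only have poles along the finitely many height one primes that contain
  \<open>b\<close>. Those not contained in \<open>P\<close> have an element outside \<open>P\<close>, and a product of powers of such elements
  removes all the unwanted poles.\<close>

lemma (in "domain") clear_poles_away_from:
  assumes noeth: "noetherian_ring R" and P: "primeideal P R"
    and unif: "uniformizer_family R \<pi>"
    and a: "a \<in> carrier R" and b: "b \<in> carrier R" "b \<noteq> \<zero>"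
    and poles: "\<And>Q. primeideal Q R \<Longrightarrow> prime_height R Q = 1 \<Longrightarrow> Q \<subseteq> P \<Longrightarrow> pole_le R Q (\<pi> Q) (k Q) a b"
  shows "\<exists>s\<in>carrier R - P. \<forall>Q. primeideal Q R \<and> prime_height R Q = 1 \<longrightarrow> pole_le R Q (\<pi> Q) (k Q) (s \<otimes> a) b"
proof -
  interpret P: primeideal P R by fact
  have one: "\<one> \<notin> P" using P.I_notcarr P.one_imp_carrier by blast
  have single: "\<exists>s\<in>carrier R - P. pole_le R Q (\<pi> Q) (k Q) (s \<otimes> a) b"
    if Q: "primeideal Q R" "prime_height R Q = 1" for Q
  proof (cases "Q \<subseteq> P")
    case True
    then show ?thesis using poles[OF Q] one a by (intro bexI[of _ \<one>]) auto
  next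
    case False
    then obtain g where g: "g \<in> Q" "g \<notin> P" by blast
    interpret U: uniformizer R Q "\<pi> Q" by (rule uniformizer_familyD[OF unif Q])
    interpret lP: localizing R "carrier R - P" by (rule P.localizing_compl)
    have "g \<noteq> \<zero>" using g P.zero_closed by blast
    then have "pole_le R Q (\<pi> Q) (k Q) (g [^] (ord_at R Q b) \<otimes> a) b"
      using a b g(1) by (intro U.pole_le_mult_pow)
    moreover have "g [^] (ord_at R Q b) \<in> carrier R - P"
      using g U.Q.Icarr by (intro lP.lfrac_pow(1)) auto
    ultimately show ?thesis by blast
  qed
  let ?F = "{Q. primeideal Q R \<and> prime_height R Q = 1 \<and> b \<in> Q}"
  have "\<exists>s\<in>carrier R - P. \<forall>Q\<in>G. pole_le R Q (\<pi> Q) (k Q) (s \<otimes> a) b" if "finite G" "G \<subseteq> ?F" for G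
    using that
  proof (induction G rule: finite_induct)
    case empty
    then show ?case using one by auto
  next
    case (insert Q G)
    obtain s where s: "s \<in> carrier R - P" "\<forall>Q\<in>G. pole_le R Q (\<pi> Q) (k Q) (s \<otimes> a) b" using insert by blast
    obtain t where t: "t \<in> carrier R - P" "pole_le R Q (\<pi> Q) (k Q) (t \<otimes> a) b"
      using single insert.prems by blast
    have tc: "t \<in> carrier R" "s \<in> carrier R" using s t by auto
    have "pole_le R Q' (\<pi> Q') (k Q') (t \<otimes> s \<otimes> a) b" if Q': "Q' \<in> insert Q G" for Q'
    proof -
      have Q'p: "primeideal Q' R" "prime_height R Q' = 1" using Q' insert.prems by auto
      interpret U: uniformizer R Q' "\<pi> Q'" by (rule uniformizer_familyD[OF unif Q'p])
      show ?thesis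
      proof (cases "Q' = Q")
        case True
        then have "pole_le R Q' (\<pi> Q') (k Q') (s \<otimes> (t \<otimes> a)) b"
          using U.Q.pole_le_mult[of "\<pi> Q'" "k Q'" "t \<otimes> a" b s] True t(2) tc a b U.unif_carr by simp
        then show ?thesis using tc a by (simp add: m_ac)
      next
        case False
        then have "pole_le R Q' (\<pi> Q') (k Q') (t \<otimes> (s \<otimes> a)) b"
          using False U.Q.pole_le_mult[of "\<pi> Q'" "k Q'" "s \<otimes> a" b t] s(2) Q' tc a b U.unif_carr by simp
        then show ?thesis using tc a by (simp add: m_ac)
      qed
    qed
    moreover have "t \<otimes> s \<in> carrier R - P" using s(1) t(1) P.I_prime by auto
    ultimately show ?case by blast
  qed
  from this[OF finite_height_one_primes_containing[OF noeth b] order_refl]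
  obtain s where s: "s \<in> carrier R - P" "\<forall>Q\<in>?F. pole_le R Q (\<pi> Q) (k Q) (s \<otimes> a) b" by blast
  have "pole_le R Q (\<pi> Q) (k Q) (s \<otimes> a) b" if Q: "primeideal Q R" "prime_height R Q = 1" for Q
  proof (cases "b \<in> Q")
    case True then show ?thesis using s(2) Q by blast
  next
    case False
    interpret U: uniformizer R Q "\<pi> Q" by (rule uniformizer_familyD[OF unif Q])
    show ?thesis using False s(1) a b by (intro U.Q.pole_le_nonmember) auto
  qed
  then show ?thesis using s(1) by blast
qed

lemma (in "domain") pole_le_of_section:
  assumes "lfrac R (nonzerodivisors R) a b \<in> div_sections R D" "D \<noteq> (\<lambda>_. 0)"
    and "uniformizer R Q \<pi>" "prime_height R Q = 1" "0 \<le> D Q"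
    and a: "a \<in> carrier R" and b: "b \<in> carrier R" "b \<noteq> \<zero>"
  shows "pole_le R Q \<pi> (nat (D Q)) a b"
proof (cases "a = \<zero>")
  case True
  interpret U: uniformizer R Q \<pi> by fact
  show ?thesis unfolding pole_le_def True using U.loc.S_one b
    by (intro bexI[of _ \<one>] bexI[of _ \<zero>]) auto
next
  case False
  interpret U: uniformizer R Q \<pi> by fact
  interpret T: localizing_domain R "nonzerodivisors R" by (rule localizing_domain_nonzerodivisors)
  have "lfrac R (nonzerodivisors R) a b \<noteq> \<zero>\<^bsub>tot_frac R\<^esub>"
    using False a b unfolding tot_frac_def by (subst T.lfrac_zero_iff) (auto simp: nonzerodivisors_domain)
  then have "0 \<le> val_at R Q (lfrac R (nonzerodivisors R) a b) + int (nat (D Q))"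
    using assms(1,2,4,5) U.Q.primeideal by (auto simp: div_sections_def)
  then show ?thesis using U.val_at_ge_iff[OF a False b] by blast
qed

lemma (in "domain") section_iff:
  assumes unif: "uniformizer_family R \<pi>"
    and D: "D \<noteq> (\<lambda>_. 0)" "\<forall>Q. 0 \<le> D Q"
    and a: "a \<in> carrier R" and b: "b \<in> carrier R" "b \<noteq> \<zero>"
  shows "lfrac R (nonzerodivisors R) a b \<in> div_sections R D \<longleftrightarrow>
    (\<forall>Q. primeideal Q R \<and> prime_height R Q = 1 \<longrightarrow> pole_le R Q (\<pi> Q) (nat (D Q)) a b)"
proof
  assume "lfrac R (nonzerodivisors R) a b \<in> div_sections R D"
  then show "\<forall>Q. primeideal Q R \<and> prime_height R Q = 1 \<longrightarrow> pole_le R Q (\<pi> Q) (nat (D Q)) a b"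
    using pole_le_of_section[OF _ D(1) uniformizer_familyD[OF unif] _ _ a b] D(2) by blast
next
  assume poles: "\<forall>Q. primeideal Q R \<and> prime_height R Q = 1 \<longrightarrow> pole_le R Q (\<pi> Q) (nat (D Q)) a b"
  interpret T: localizing_domain R "nonzerodivisors R" by (rule localizing_domain_nonzerodivisors)
  have bn: "b \<in> nonzerodivisors R" using b by (simp add: nonzerodivisors_domain)
  have "lfrac R (nonzerodivisors R) a b \<in> carrier (tot_frac R)"
    unfolding tot_frac_def using a bn by (rule T.lfrac_in)
  moreover have "0 \<le> val_at R Q (lfrac R (nonzerodivisors R) a b) + D Q"
    if nz: "lfrac R (nonzerodivisors R) a b \<noteq> \<zero>\<^bsub>tot_frac R\<^esub>" and Q: "primeideal Q R" "prime_height R Q = 1" for Q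
  proof -
    interpret U: uniformizer R Q "\<pi> Q" by (rule uniformizer_familyD[OF unif Q])
    have "a \<noteq> \<zero>" using nz a bn unfolding tot_frac_def by (subst (asm) T.lfrac_zero_iff) auto
    then show ?thesis using U.val_at_ge_iff[OF a _ b, of "nat (D Q)"] poles Q D(2) by auto
  qed
  ultimately show "lfrac R (nonzerodivisors R) a b \<in> div_sections R D"
    using D(1) by (auto simp: div_sections_def)
qed

section \<open>Localizing a Cartier map\<close>

text \<open>The setting in which a \<open>p\<^sup>e\<close>-inverse linear map is localized. In the application \<open>T\<close> and \<open>T'\<close> are the
  total rings of fractions of \<open>R\<close> and \<open>R\<^sub>P\<close>, the module \<open>M\<close> is \<open>R(D)\<close> and \<open>q = p\<^sup>e\<close>. The assumption on
  the kernel of \<open>j\<close> is what makes the localized map independent of choices when \<open>R\<close> has zero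
  divisors.\<close>

locale cartier_map = cring R + P: primeideal P R + T: cring T + T': cring T'
  for R (structure) and P and T (structure) and T' (structure) +
  fixes \<iota> j \<iota>' and q :: nat and M and \<phi>
  assumes iota_hom: "\<iota> \<in> ring_hom R T"
    and j_hom: "j \<in> ring_hom T T'"
    and iota'_hom: "\<iota>' \<in> ring_hom (loc_at R P) T'"
    and j_iota: "a \<in> carrier R \<Longrightarrow> j (\<iota> a) = \<iota>' (to_loc_at R P a)"
    and j_ker: "y \<in> carrier T \<Longrightarrow> j y = \<zero>\<^bsub>T'\<^esub> \<Longrightarrow> \<exists>u\<in>carrier R - P. \<iota> u \<otimes>\<^bsub>T\<^esub> y = \<zero>\<^bsub>T\<^esub>"
    and q_pos: "0 < q"
    and M_sub: "M \<subseteq> carrier T"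
    and M_add: "x \<in> M \<Longrightarrow> y \<in> M \<Longrightarrow> x \<oplus>\<^bsub>T\<^esub> y \<in> M"
    and M_smult: "r \<in> carrier R \<Longrightarrow> y \<in> M \<Longrightarrow> \<iota> r \<otimes>\<^bsub>T\<^esub> y \<in> M"
    and phi_closed: "y \<in> M \<Longrightarrow> \<phi> y \<in> carrier R"
    and phi_add: "x \<in> M \<Longrightarrow> y \<in> M \<Longrightarrow> \<phi> (x \<oplus>\<^bsub>T\<^esub> y) = \<phi> x \<oplus> \<phi> y"
    and phi_semilinear: "r \<in> carrier R \<Longrightarrow> y \<in> M \<Longrightarrow> \<phi> (\<iota> (r [^] q) \<otimes>\<^bsub>T\<^esub> y) = r \<otimes> \<phi> y"
begin

sublocale loc: localizing R "carrier R - P"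
  by (rule P.localizing_compl)

lemma iota'_hom_L: "\<iota>' \<in> ring_hom loc.L T'"
  using iota'_hom by (simp add: loc_at_def)

lemma iota_closed [simp]: "a \<in> carrier R \<Longrightarrow> \<iota> a \<in> carrier T"
  by (rule ring_hom_closed[OF iota_hom])

lemma M_carr: "y \<in> M \<Longrightarrow> y \<in> carrier T"
  using M_sub by blast

lemma iota_mult: "a \<in> carrier R \<Longrightarrow> b \<in> carrier R \<Longrightarrow> \<iota> (a \<otimes> b) = \<iota> a \<otimes>\<^bsub>T\<^esub> \<iota> b"
  by (rule ring_hom_mult[OF iota_hom])

lemma iota_iota:
  "a \<in> carrier R \<Longrightarrow> b \<in> carrier R \<Longrightarrow> y \<in> M \<Longrightarrow> \<iota> a \<otimes>\<^bsub>T\<^esub> (\<iota> b \<otimes>\<^bsub>T\<^esub> y) = \<iota> (a \<otimes> b) \<otimes>\<^bsub>T\<^esub> y"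
  by (simp add: iota_mult T.m_assoc M_carr)

text \<open>The element \<open>x\<close> of \<open>T'\<close> is the fraction \<open>y / s\<close> with numerator \<open>y \<in> M\<close>.\<close>

definition cleared where
  "cleared x s y \<longleftrightarrow> s \<in> carrier R - P \<and> y \<in> M \<and> j y = \<iota>' (loc.fr s \<one>) \<otimes>\<^bsub>T'\<^esub> x"

definition clearable where
  "clearable = {x \<in> carrier T'. \<exists>s y. cleared x s y}"

text \<open>Semilinearity forces \<open>\<phi> (y / s) = \<phi> (s\<^bsup>q-1\<^esup> y / s\<^sup>q) = \<phi> (s\<^bsup>q-1\<^esup> y) / s\<close>.\<close>

definition local_value where
  "local_value s y = loc.fr (\<phi> (\<iota> (s [^] (q - 1)) \<otimes>\<^bsub>T\<^esub> y)) s"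

definition local_map where
  "local_map x = (let p = SOME p. cleared x (fst p) (snd p) in local_value (fst p) (snd p))"

lemma clearedD:
  assumes "cleared x s y"
  shows "s \<in> carrier R - P" "s \<in> carrier R" "y \<in> M" "j y = \<iota>' (loc.fr s \<one>) \<otimes>\<^bsub>T'\<^esub> x"
  using assms by (auto simp: cleared_def)

lemma fr_one_closed: "s \<in> carrier R \<Longrightarrow> \<iota>' (loc.fr s \<one>) \<in> carrier T'"
  using ring_hom_closed[OF iota'_hom_L] loc.lfrac_in[OF _ loc.S_one] by blast

lemma j_smult:
  "a \<in> carrier R \<Longrightarrow> y \<in> M \<Longrightarrow> j (\<iota> a \<otimes>\<^bsub>T\<^esub> y) = \<iota>' (loc.fr a \<one>) \<otimes>\<^bsub>T'\<^esub> j y"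
  using ring_hom_mult[OF j_hom iota_closed M_carr] j_iota by (simp add: to_loc_at_def)

lemma iota'_mult:
  "a \<in> carrier R \<Longrightarrow> b \<in> carrier R \<Longrightarrow>
    \<iota>' (loc.fr (a \<otimes> b) \<one>) = \<iota>' (loc.fr a \<one>) \<otimes>\<^bsub>T'\<^esub> \<iota>' (loc.fr b \<one>)"
  using ring_hom_mult[OF iota'_hom_L] ring_hom_mult[OF loc.to_loc_hom] loc.lfrac_in[OF _ loc.S_one] by simp

text \<open>If \<open>y / s\<close> and \<open>y' / s'\<close> agree in \<open>T'\<close>, then \<open>u s' y = u s y'\<close> for some \<open>u \<notin> P\<close>. Multiplying the two
  numerators by \<open>u s'\<close> and \<open>u s\<close> and moving these factors into \<open>\<phi>\<close> as \<open>q\<close>-th powers gives \<open>\<phi>\<close> of one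
  common element.\<close>

lemma local_value_unique:
  assumes x: "x \<in> carrier T'" and c: "cleared x s y" and c': "cleared x s' y'"
  shows "local_value s y = local_value s' y'"
proof -
  note s = clearedD[OF c] and s' = clearedD[OF c']
  let ?z = "\<iota> s' \<otimes>\<^bsub>T\<^esub> y" and ?z' = "\<iota> s \<otimes>\<^bsub>T\<^esub> y'"
  have zM: "?z \<in> M" "?z' \<in> M" using s(2,3) s'(2,3) M_smult by auto
  note zc = M_carr[OF zM(1)] M_carr[OF zM(2)]
  interpret J: ring_hom_ring T T' j
    by (intro ring_hom_ringI2 T.ring_axioms T'.ring_axioms j_hom)
  have "j ?z = j ?z'"
    unfolding j_smult[OF s'(2) s(3)] j_smult[OF s(2) s'(3)] s(4) s'(4)
    by (rule T'.m_lcomm[OF fr_one_closed[OF s'(2)] fr_one_closed[OF s(2)] x])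
  then have jd: "j (?z \<oplus>\<^bsub>T\<^esub> \<ominus>\<^bsub>T\<^esub> ?z') = \<zero>\<^bsub>T'\<^esub>"
    using zc by (simp add: J.hom_add J.hom_a_inv T'.r_neg)
  have dc: "?z \<oplus>\<^bsub>T\<^esub> \<ominus>\<^bsub>T\<^esub> ?z' \<in> carrier T" using zc by simp
  obtain u where u: "u \<in> carrier R - P" "\<iota> u \<otimes>\<^bsub>T\<^esub> (?z \<oplus>\<^bsub>T\<^esub> \<ominus>\<^bsub>T\<^esub> ?z') = \<zero>\<^bsub>T\<^esub>"
    using j_ker[OF dc jd] by blast
  have uc: "u \<in> carrier R" using u by blast
  have uz: "\<iota> u \<otimes>\<^bsub>T\<^esub> ?z = \<iota> u \<otimes>\<^bsub>T\<^esub> ?z'"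
  proof -
    have "\<iota> u \<otimes>\<^bsub>T\<^esub> ?z \<oplus>\<^bsub>T\<^esub> \<ominus>\<^bsub>T\<^esub> (\<iota> u \<otimes>\<^bsub>T\<^esub> ?z') = \<zero>\<^bsub>T\<^esub>"
      using u(2) uc zc by (simp add: T.r_distr T.r_minus)
    then show ?thesis
      using T.r_right_minus_eq[of "\<iota> u \<otimes>\<^bsub>T\<^esub> ?z" "\<iota> u \<otimes>\<^bsub>T\<^esub> ?z'"] uc zc
      by (simp add: a_minus_def)
  qed
  define \<alpha> \<alpha>' \<beta> where "\<alpha> = s [^] (q - 1)" and "\<alpha>' = s' [^] (q - 1)" and "\<beta> = u [^] (q - 1)"
  have gc: "\<alpha> \<in> carrier R" "\<alpha>' \<in> carrier R" "\<beta> \<in> carrier R"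
    using s(2) s'(2) uc by (simp_all add: \<alpha>_def \<alpha>'_def \<beta>_def)
  have pw: "s [^] q = \<alpha> \<otimes> s" "s' [^] q = \<alpha>' \<otimes> s'" "u [^] q = \<beta> \<otimes> u"
    using s(2) s'(2) uc q_pos by (simp_all add: nat_pow_pred_mult \<alpha>_def \<alpha>'_def \<beta>_def del: One_nat_def)
  have M1: "\<iota> \<alpha> \<otimes>\<^bsub>T\<^esub> y \<in> M" "\<iota> \<alpha>' \<otimes>\<^bsub>T\<^esub> y' \<in> M" using gc s(3) s'(3) M_smult by auto
  have "u \<otimes> (\<phi> (\<iota> \<alpha> \<otimes>\<^bsub>T\<^esub> y) \<otimes> s') = (u \<otimes> s') \<otimes> \<phi> (\<iota> \<alpha> \<otimes>\<^bsub>T\<^esub> y)"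
    using uc s'(2) phi_closed[OF M1(1)] by (simp add: m_ac)
  also have "\<dots> = \<phi> (\<iota> ((u \<otimes> s') [^] q) \<otimes>\<^bsub>T\<^esub> (\<iota> \<alpha> \<otimes>\<^bsub>T\<^esub> y))"
    using phi_semilinear[OF _ M1(1)] uc s'(2) by simp
  also have "\<iota> ((u \<otimes> s') [^] q) \<otimes>\<^bsub>T\<^esub> (\<iota> \<alpha> \<otimes>\<^bsub>T\<^esub> y) = \<iota> (\<beta> \<otimes> \<alpha> \<otimes> \<alpha>') \<otimes>\<^bsub>T\<^esub> (\<iota> u \<otimes>\<^bsub>T\<^esub> ?z)"
    using uc s(2,3) s'(2) gc by (simp add: iota_iota M_smult nat_pow_distrib pw m_ac)
  also have "\<dots> = \<iota> ((u \<otimes> s) [^] q) \<otimes>\<^bsub>T\<^esub> (\<iota> \<alpha>' \<otimes>\<^bsub>T\<^esub> y')"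
    unfolding uz using uc s(2) s'(2,3) gc by (simp add: iota_iota M_smult nat_pow_distrib pw m_ac)
  also have "\<phi> \<dots> = (u \<otimes> s) \<otimes> \<phi> (\<iota> \<alpha>' \<otimes>\<^bsub>T\<^esub> y')"
    using phi_semilinear[OF _ M1(2)] uc s(2) by simp
  also have "\<dots> = u \<otimes> (\<phi> (\<iota> \<alpha>' \<otimes>\<^bsub>T\<^esub> y') \<otimes> s)"
    using uc s(2) phi_closed[OF M1(2)] by (simp add: m_ac)
  finally show ?thesis
    unfolding local_value_def \<alpha>_def[symmetric] \<alpha>'_def[symmetric]
    using phi_closed[OF M1(1)] phi_closed[OF M1(2)] s(1) s'(1) u(1)
    by (subst loc.lfrac_eq_iff) blast+
qed

lemma local_map_eq:
  assumes "x \<in> carrier T'" "cleared x s y"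
  shows "local_map x = local_value s y"
proof -
  define p where "p = (SOME p. cleared x (fst p) (snd p))"
  have "cleared x (fst p) (snd p)"
    unfolding p_def by (rule someI[of "\<lambda>p. cleared x (fst p) (snd p)" "(s, y)"]) (use assms in simp)
  then show ?thesis
    unfolding local_map_def p_def[symmetric] Let_def using local_value_unique assms by blast
qed

lemma local_value_closed: "cleared x s y \<Longrightarrow> local_value s y \<in> carrier loc.L"
  unfolding local_value_def using clearedD by (metis M_smult loc.lfrac_in nat_pow_closed phi_closed)

lemma local_map_closed: "x \<in> clearable \<Longrightarrow> local_map x \<in> carrier loc.L"
  unfolding clearable_def using local_map_eq local_value_closed by auto

lemma local_map_add:
  assumes "x \<in> clearable" "x' \<in> clearable"
  shows "local_map (x \<oplus>\<^bsub>T'\<^esub> x') = local_map x \<oplus>\<^bsub>loc.L\<^esub> local_map x'"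
proof -
  obtain s y s' y' where x: "x \<in> carrier T'" and c: "cleared x s y"
    and x': "x' \<in> carrier T'" and c': "cleared x' s' y'"
    using assms unfolding clearable_def by blast
  note s = clearedD[OF c] and s' = clearedD[OF c']
  let ?z = "\<iota> s' \<otimes>\<^bsub>T\<^esub> y" and ?z' = "\<iota> s \<otimes>\<^bsub>T\<^esub> y'"
  have zM: "?z \<in> M" "?z' \<in> M" using s(2,3) s'(2,3) M_smult by auto
  note f = fr_one_closed[OF s(2)] fr_one_closed[OF s'(2)]
  have ss: "s \<otimes> s' \<in> carrier R - P" by (rule loc.S_mult) fact+
  have jz: "j (?z \<oplus>\<^bsub>T\<^esub> ?z') = \<iota>' (loc.fr (s \<otimes> s') \<one>) \<otimes>\<^bsub>T'\<^esub> (x \<oplus>\<^bsub>T'\<^esub> x')"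
    unfolding ring_hom_add[OF j_hom M_carr[OF zM(1)] M_carr[OF zM(2)]]
      j_smult[OF s'(2) s(3)] j_smult[OF s(2) s'(3)] s(4) s'(4) iota'_mult[OF s(2) s'(2)]
    using f x x' by (simp add: T'.l_distr T'.r_distr T'.m_ac)
  then have cl: "cleared (x \<oplus>\<^bsub>T'\<^esub> x') (s \<otimes> s') (?z \<oplus>\<^bsub>T\<^esub> ?z')"
    unfolding cleared_def using ss zM M_add by blast
  define \<alpha> \<alpha>' where "\<alpha> = s [^] (q - 1)" and "\<alpha>' = s' [^] (q - 1)"
  have gc: "\<alpha> \<in> carrier R" "\<alpha>' \<in> carrier R"
    using s(2) s'(2) by (simp_all add: \<alpha>_def \<alpha>'_def)
  have pw: "s [^] q = \<alpha> \<otimes> s" "s' [^] q = \<alpha>' \<otimes> s'"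
    using s(2) s'(2) q_pos by (simp_all add: nat_pow_pred_mult \<alpha>_def \<alpha>'_def del: One_nat_def)
  have M1: "\<iota> \<alpha> \<otimes>\<^bsub>T\<^esub> y \<in> M" "\<iota> \<alpha>' \<otimes>\<^bsub>T\<^esub> y' \<in> M" using gc s(3) s'(3) M_smult by auto
  note pc = phi_closed[OF M1(1)] phi_closed[OF M1(2)]
  have "\<iota> ((s \<otimes> s') [^] (q - 1)) \<otimes>\<^bsub>T\<^esub> (?z \<oplus>\<^bsub>T\<^esub> ?z')
      = \<iota> (s' [^] q) \<otimes>\<^bsub>T\<^esub> (\<iota> \<alpha> \<otimes>\<^bsub>T\<^esub> y) \<oplus>\<^bsub>T\<^esub> \<iota> (s [^] q) \<otimes>\<^bsub>T\<^esub> (\<iota> \<alpha>' \<otimes>\<^bsub>T\<^esub> y')"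
    using s(2,3) s'(2,3) gc M_carr[OF zM(1)] M_carr[OF zM(2)]
    by (simp add: T.r_distr iota_iota M_smult nat_pow_distrib pw \<alpha>_def[symmetric] \<alpha>'_def[symmetric] m_ac del: One_nat_def)
  then have "\<phi> (\<iota> ((s \<otimes> s') [^] (q - 1)) \<otimes>\<^bsub>T\<^esub> (?z \<oplus>\<^bsub>T\<^esub> ?z'))
      = s' \<otimes> \<phi> (\<iota> \<alpha> \<otimes>\<^bsub>T\<^esub> y) \<oplus> s \<otimes> \<phi> (\<iota> \<alpha>' \<otimes>\<^bsub>T\<^esub> y')"
    using s(2) s'(2) M1 by (simp add: phi_add phi_semilinear M_smult)
  then have "local_value (s \<otimes> s') (?z \<oplus>\<^bsub>T\<^esub> ?z') = local_value s y \<oplus>\<^bsub>loc.L\<^esub> local_value s' y'"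
    unfolding local_value_def \<alpha>_def[symmetric] \<alpha>'_def[symmetric]
      loc.lfrac_add[OF pc(1) s(1) pc(2) s'(1)]
    using s(2) s'(2) pc by (simp add: m_ac)
  moreover have "x \<oplus>\<^bsub>T'\<^esub> x' \<in> carrier T'" using x x' by simp
  ultimately show ?thesis using local_map_eq c c' cl x x' by simp
qed

lemma local_map_semilinear:
  assumes r: "r \<in> carrier loc.L" and "x \<in> clearable"
  shows "local_map (\<iota>' (r [^]\<^bsub>loc.L\<^esub> q) \<otimes>\<^bsub>T'\<^esub> x) = r \<otimes>\<^bsub>loc.L\<^esub> local_map x"
proof -
  obtain s y where x: "x \<in> carrier T'" and c: "cleared x s y"
    using assms unfolding clearable_def by blast
  note s = clearedD[OF c]
  obtain a t where at: "a \<in> carrier R" "t \<in> carrier R - P" "r = loc.fr a t"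
    using r by (rule loc.loc_cases)
  have tc: "t \<in> carrier R" using at by blast
  have tq: "t [^] q \<in> carrier R - P" using at(2) tc by (intro loc.lfrac_pow(1))
  have rq: "r [^]\<^bsub>loc.L\<^esub> q = loc.fr (a [^] q) (t [^] q)" unfolding at(3) by (rule loc.lfrac_pow(2)[OF at(1,2)])
  have rqc: "\<iota>' (r [^]\<^bsub>loc.L\<^esub> q) \<in> carrier T'"
    using ring_hom_closed[OF iota'_hom_L] r by simp
  let ?x = "\<iota>' (r [^]\<^bsub>loc.L\<^esub> q) \<otimes>\<^bsub>T'\<^esub> x" and ?s = "s \<otimes> t [^] q" and ?y = "\<iota> (a [^] q) \<otimes>\<^bsub>T\<^esub> y"
  have aq: "a [^] q \<in> carrier R" "t [^] q \<in> carrier R" using at(1) tc by simp_all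
  have "loc.fr (t [^] q) \<one> \<otimes>\<^bsub>loc.L\<^esub> loc.fr (a [^] q) (t [^] q) = loc.fr (t [^] q \<otimes> a [^] q) (\<one> \<otimes> t [^] q)"
    by (rule loc.lfrac_mult[OF aq(2) loc.S_one aq(1) tq])
  also have "\<dots> = loc.fr (a [^] q) \<one>"
    using aq tq loc.S_one by (intro loc.lfrac_eqI) (auto simp: m_ac)
  finally have "loc.fr (a [^] q) \<one> = loc.fr (t [^] q) \<one> \<otimes>\<^bsub>loc.L\<^esub> r [^]\<^bsub>loc.L\<^esub> q" unfolding rq by simp
  then have aqt: "\<iota>' (loc.fr (a [^] q) \<one>) = \<iota>' (loc.fr (t [^] q) \<one>) \<otimes>\<^bsub>T'\<^esub> \<iota>' (r [^]\<^bsub>loc.L\<^esub> q)"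
    using ring_hom_mult[OF iota'_hom_L] loc.lfrac_in[OF aq(2) loc.S_one] r by simp
  have "j ?y = \<iota>' (loc.fr ?s \<one>) \<otimes>\<^bsub>T'\<^esub> ?x"
    unfolding j_smult[OF aq(1) s(3)] s(4) iota'_mult[OF s(2) aq(2)] aqt
    using fr_one_closed[OF s(2)] fr_one_closed[OF aq(2)] rqc x by (simp add: T'.m_ac)
  then have cl: "cleared ?x ?s ?y"
    unfolding cleared_def using loc.S_mult[OF s(1) tq] M_smult[OF aq(1) s(3)] by blast
  define \<alpha> \<tau> where "\<alpha> = s [^] (q - 1)" and "\<tau> = t [^] (q - 1)"
  have gc: "\<alpha> \<in> carrier R" "\<tau> \<in> carrier R" using s(2) tc by (simp_all add: \<alpha>_def \<tau>_def)
  have M1: "\<iota> \<alpha> \<otimes>\<^bsub>T\<^esub> y \<in> M" using gc s(3) M_smult by auto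
  note pc = phi_closed[OF M1]
  have tau: "\<tau> \<otimes> t = t [^] q" unfolding \<tau>_def by (rule nat_pow_pred_mult[OF tc q_pos])
  have swap: "(t [^] q) [^] (q - 1) = \<tau> [^] q" using tc by (simp add: \<tau>_def nat_pow_pow mult.commute)
  have "\<iota> (?s [^] (q - 1)) \<otimes>\<^bsub>T\<^esub> ?y = \<iota> ((\<tau> \<otimes> a) [^] q) \<otimes>\<^bsub>T\<^esub> (\<iota> \<alpha> \<otimes>\<^bsub>T\<^esub> y)"
    using s(2,3) aq gc at(1) by (simp add: iota_iota nat_pow_distrib swap \<alpha>_def[symmetric] m_ac del: One_nat_def)
  then have "\<phi> (\<iota> (?s [^] (q - 1)) \<otimes>\<^bsub>T\<^esub> ?y) = (\<tau> \<otimes> a) \<otimes> \<phi> (\<iota> \<alpha> \<otimes>\<^bsub>T\<^esub> y)"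
    using M1 gc at(1) by (simp add: phi_semilinear)
  then have "local_value ?s ?y = loc.fr ((\<tau> \<otimes> a) \<otimes> \<phi> (\<iota> \<alpha> \<otimes>\<^bsub>T\<^esub> y)) ?s"
    by (simp add: local_value_def)
  also have "\<dots> = loc.fr (a \<otimes> \<phi> (\<iota> \<alpha> \<otimes>\<^bsub>T\<^esub> y)) (t \<otimes> s)"
  proof (rule loc.lfrac_eqI)
    show "(\<tau> \<otimes> a) \<otimes> \<phi> (\<iota> \<alpha> \<otimes>\<^bsub>T\<^esub> y) \<otimes> (t \<otimes> s) = a \<otimes> \<phi> (\<iota> \<alpha> \<otimes>\<^bsub>T\<^esub> y) \<otimes> ?s"
      unfolding tau[symmetric] using gc at(1) tc s(2) pc by (simp add: m_ac)
  qed (use gc at(1) pc loc.S_mult[OF s(1) tq] loc.S_mult[OF at(2) s(1)] in simp_all)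
  also have "\<dots> = r \<otimes>\<^bsub>loc.L\<^esub> local_value s y"
    unfolding at(3) local_value_def \<alpha>_def[symmetric] by (rule loc.lfrac_mult[OF at(1,2) pc s(1), symmetric])
  finally have "local_value ?s ?y = r \<otimes>\<^bsub>loc.L\<^esub> local_value s y" .
  moreover have "?x \<in> carrier T'" using rqc x by simp
  ultimately show ?thesis using local_map_eq c cl x by simp
qed

lemma local_map_j:
  assumes "w \<in> M"
  shows "j w \<in> clearable" "local_map (j w) = loc.fr (\<phi> w) \<one>"
proof -
  have jw: "j w \<in> carrier T'" using ring_hom_closed[OF j_hom M_carr[OF assms]] .
  have "cleared (j w) \<one> w"
    unfolding cleared_def loc.loc_one[symmetric] ring_hom_one[OF iota'_hom_L]
    using assms jw loc.S_one by simp
  then show "j w \<in> clearable" "local_map (j w) = loc.fr (\<phi> w) \<one>"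
    using local_map_eq[OF jw] jw ring_hom_one[OF iota_hom] M_carr[OF assms]
    unfolding clearable_def local_value_def by auto
qed

text \<open>The value \<open>\<phi> w\<close> is a unit of \<open>R\<^sub>P\<close>; the localized map divided by it sends \<open>w\<close> to \<open>1\<close>.\<close>

lemma splitting_from_unit_value:
  assumes w: "w \<in> M" and u: "\<phi> w \<notin> P"
  obtains \<Phi> where "\<And>x. x \<in> clearable \<Longrightarrow> \<Phi> x \<in> carrier loc.L"
    "\<And>x x'. x \<in> clearable \<Longrightarrow> x' \<in> clearable \<Longrightarrow> \<Phi> (x \<oplus>\<^bsub>T'\<^esub> x') = \<Phi> x \<oplus>\<^bsub>loc.L\<^esub> \<Phi> x'"
    "\<And>r x. r \<in> carrier loc.L \<Longrightarrow> x \<in> clearable \<Longrightarrow>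
      \<Phi> (\<iota>' (r [^]\<^bsub>loc.L\<^esub> q) \<otimes>\<^bsub>T'\<^esub> x) = r \<otimes>\<^bsub>loc.L\<^esub> \<Phi> x"
    "\<And>r. r \<in> carrier loc.L \<Longrightarrow> \<Phi> (\<iota>' (r [^]\<^bsub>loc.L\<^esub> q) \<otimes>\<^bsub>T'\<^esub> j w) = r"
proof -
  have uS: "\<phi> w \<in> carrier R - P" and uc: "\<phi> w \<in> carrier R" using u phi_closed[OF w] by auto
  let ?v = "loc.fr \<one> (\<phi> w)"
  have v: "?v \<in> carrier loc.L" using uS by (intro loc.lfrac_in) auto
  have "?v \<otimes>\<^bsub>loc.L\<^esub> loc.fr (\<phi> w) \<one> = loc.fr (\<one> \<otimes> \<phi> w) (\<phi> w \<otimes> \<one>)"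
    by (rule loc.lfrac_mult[OF one_closed uS uc loc.S_one])
  also have "\<dots> = \<one>\<^bsub>loc.L\<^esub>"
    unfolding loc.loc_one using uS uc loc.S_one by (intro loc.lfrac_eqI) auto
  finally have inv: "?v \<otimes>\<^bsub>loc.L\<^esub> local_map (j w) = \<one>\<^bsub>loc.L\<^esub>" using local_map_j[OF w] by simp
  show thesis
  proof (rule that[of "\<lambda>x. ?v \<otimes>\<^bsub>loc.L\<^esub> local_map x"])
    show "?v \<otimes>\<^bsub>loc.L\<^esub> local_map x \<in> carrier loc.L" if "x \<in> clearable" for x
      using v local_map_closed[OF that] by simp
    show "?v \<otimes>\<^bsub>loc.L\<^esub> local_map (x \<oplus>\<^bsub>T'\<^esub> x') = ?v \<otimes>\<^bsub>loc.L\<^esub> local_map x \<oplus>\<^bsub>loc.L\<^esub> ?v \<otimes>\<^bsub>loc.L\<^esub> local_map x'"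
      if "x \<in> clearable" "x' \<in> clearable" for x x'
      using v local_map_closed[OF that(1)] local_map_closed[OF that(2)]
      by (simp add: local_map_add[OF that] loc.L.r_distr)
    show sl: "?v \<otimes>\<^bsub>loc.L\<^esub> local_map (\<iota>' (r [^]\<^bsub>loc.L\<^esub> q) \<otimes>\<^bsub>T'\<^esub> x) = r \<otimes>\<^bsub>loc.L\<^esub> (?v \<otimes>\<^bsub>loc.L\<^esub> local_map x)"
      if "r \<in> carrier loc.L" "x \<in> clearable" for r x
      using v local_map_closed[OF that(2)] that(1)
      by (simp add: local_map_semilinear[OF that] loc.L.m_lcomm)
    show "?v \<otimes>\<^bsub>loc.L\<^esub> local_map (\<iota>' (r [^]\<^bsub>loc.L\<^esub> q) \<otimes>\<^bsub>T'\<^esub> j w) = r" if "r \<in> carrier loc.L" for r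
      unfolding sl[OF that local_map_j(1)[OF w]] inv using that by simp
  qed
qed

end

section \<open>Sections over a localization\<close>

lemma (in primeideal) to_loc_nonzerodivisors:
  "to_loc_at R I ` nonzerodivisors R \<subseteq> nonzerodivisors (loc_at R I)"
proof
  interpret loc: localizing R "carrier R - I" by (rule localizing_compl)
  fix x assume "x \<in> to_loc_at R I ` nonzerodivisors R"
  then obtain s where s: "s \<in> nonzerodivisors R" "x = loc.fr s \<one>" by (auto simp: to_loc_at_def)
  have sc: "s \<in> carrier R" using s by (simp add: nonzerodivisors_def)
  have "y = \<zero>\<^bsub>loc.L\<^esub>" if y: "y \<in> carrier loc.L" and xy: "x \<otimes>\<^bsub>loc.L\<^esub> y = \<zero>\<^bsub>loc.L\<^esub>" for y
  proof -
    obtain a t where a: "a \<in> carrier R" "t \<in> carrier R - I" "y = loc.fr a t" using y by (rule loc.loc_cases)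
    have tc: "\<one> \<otimes> t \<in> carrier R - I" by (rule loc.S_mult[OF loc.S_one a(2)])
    obtain u where u: "u \<in> carrier R - I" "u \<otimes> (s \<otimes> a) = \<zero>"
      using xy loc.lfrac_eq_zero_iff[OF m_closed[OF sc a(1)] tc]
      unfolding s(2) a(3) loc.lfrac_mult[OF sc loc.S_one a(1,2)] by blast
    have "s \<otimes> (u \<otimes> a) = \<zero>" using u sc a(1) by (simp add: m_lcomm)
    then have "u \<otimes> a = \<zero>" using s(1) u(1) a(1) by (simp add: nonzerodivisors_def)
    then show ?thesis unfolding a(3) using loc.lfrac_eq_zero_iff[OF a(1,2)] u(1) by blast
  qed
  moreover have "x \<in> carrier loc.L" unfolding s(2) by (rule loc.lfrac_in[OF sc loc.S_one])
  ultimately show "x \<in> nonzerodivisors (loc_at R I)" by (simp add: nonzerodivisors_def loc_at_def)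
qed

text \<open>The map from the total ring of fractions of \<open>R\<close> to that of \<open>R\<^sub>P\<close>. It exists because localization
  preserves nonzerodivisors.\<close>

definition frac_to_loc :: "('a, 'm) ring_scheme \<Rightarrow> 'a set \<Rightarrow> ('a \<times> 'a) set \<Rightarrow>
    (('a \<times> 'a) set \<times> ('a \<times> 'a) set) set" where
  "frac_to_loc R P = frac_map (loc_at R P) (nonzerodivisors (loc_at R P)) (to_loc_at R P)"

lemma (in primeideal)
  shows loc_at_cring: "cring (loc_at R I)"
    and to_loc_at_hom: "to_loc_at R I \<in> ring_hom R (loc_at R I)"
    and frac_to_loc_hom: "frac_to_loc R I \<in> ring_hom (tot_frac R) (tot_frac (loc_at R I))"
    and frac_to_loc_lfrac: "\<And>a b. a \<in> carrier R \<Longrightarrow> b \<in> nonzerodivisors R \<Longrightarrow>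
      frac_to_loc R I (lfrac R (nonzerodivisors R) a b) =
      lfrac (loc_at R I) (nonzerodivisors (loc_at R I)) (to_loc_at R I a) (to_loc_at R I b)"
    and frac_to_loc_to_tot_frac: "\<And>a. a \<in> carrier R \<Longrightarrow>
      frac_to_loc R I (to_tot_frac R a) = to_tot_frac (loc_at R I) (to_loc_at R I a)"
proof -
  interpret loc: localizing R "carrier R - I" by (rule localizing_compl)
  have h: "to_loc_at R I \<in> ring_hom R loc.L"
    using loc.to_loc_hom by (simp add: to_loc_at_def[abs_def])
  show 1: "cring (loc_at R I)" "to_loc_at R I \<in> ring_hom R (loc_at R I)"
    using h loc.loc_cring by (simp_all add: loc_at_def)
  interpret A: cring "loc_at R I" by fact
  note lz = localizing_nonzerodivisors A.localizing_nonzerodivisors 1(2) to_loc_nonzerodivisors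
  show "frac_to_loc R I \<in> ring_hom (tot_frac R) (tot_frac (loc_at R I))"
    unfolding frac_to_loc_def tot_frac_def by (rule frac_map_hom[OF lz])
  show 2: "frac_to_loc R I (lfrac R (nonzerodivisors R) a b) =
      lfrac (loc_at R I) (nonzerodivisors (loc_at R I)) (to_loc_at R I a) (to_loc_at R I b)"
    if "a \<in> carrier R" "b \<in> nonzerodivisors R" for a b
    unfolding frac_to_loc_def by (rule frac_map_lfrac[OF lz that])
  interpret T: localizing R "nonzerodivisors R" by (rule localizing_nonzerodivisors)
  show "frac_to_loc R I (to_tot_frac R a) = to_tot_frac (loc_at R I) (to_loc_at R I a)"
    if "a \<in> carrier R" for a
    unfolding to_tot_frac_def 2[OF that T.S_one] using ring_hom_one[OF 1(2)] by simp
qed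

lemma (in cring)
  shows tot_frac_cring: "cring (tot_frac R)"
    and to_tot_frac_hom: "to_tot_frac R \<in> ring_hom R (tot_frac R)"
proof -
  interpret T: localizing R "nonzerodivisors R" by (rule localizing_nonzerodivisors)
  show "cring (tot_frac R)" "to_tot_frac R \<in> ring_hom R (tot_frac R)"
    using T.loc_cring T.to_loc_hom by (simp_all add: tot_frac_def to_tot_frac_def[abs_def])
qed

lemma (in primeideal) frac_to_loc_kernel:
  assumes y: "y \<in> carrier (tot_frac R)" and j: "frac_to_loc R I y = \<zero>\<^bsub>tot_frac (loc_at R I)\<^esub>"
  shows "\<exists>u\<in>carrier R - I. to_tot_frac R u \<otimes>\<^bsub>tot_frac R\<^esub> y = \<zero>\<^bsub>tot_frac R\<^esub>"
proof -
  interpret loc: localizing R "carrier R - I" by (rule localizing_compl)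
  interpret A: cring "loc_at R I" by (rule loc_at_cring)
  interpret T: localizing R "nonzerodivisors R" by (rule localizing_nonzerodivisors)
  interpret T': localizing "loc_at R I" "nonzerodivisors (loc_at R I)" by (rule A.localizing_nonzerodivisors)
  obtain a b where ab: "a \<in> carrier R" "b \<in> nonzerodivisors R" "y = T.fr a b"
    using y unfolding tot_frac_def by (rule T.loc_cases)
  have ha: "to_loc_at R I a \<in> carrier (loc_at R I)" using ring_hom_closed[OF to_loc_at_hom ab(1)] .
  have hb: "to_loc_at R I b \<in> nonzerodivisors (loc_at R I)" using to_loc_nonzerodivisors ab(2) by blast
  obtain v where v: "v \<in> nonzerodivisors (loc_at R I)" "v \<otimes>\<^bsub>loc_at R I\<^esub> to_loc_at R I a = \<zero>\<^bsub>loc_at R I\<^esub>"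
    using j unfolding ab(3) frac_to_loc_lfrac[OF ab(1,2)] tot_frac_def T'.lfrac_eq_zero_iff[OF ha hb] by blast
  then have "loc.fr a \<one> = \<zero>\<^bsub>loc.L\<^esub>"
    using ha by (simp add: nonzerodivisors_def to_loc_at_def loc_at_def)
  then obtain u where u: "u \<in> carrier R - I" "u \<otimes> a = \<zero>"
    unfolding loc.lfrac_eq_zero_iff[OF ab(1) loc.S_one] by blast
  have uc: "u \<in> carrier R" using u by blast
  have ob: "\<one> \<otimes> b \<in> nonzerodivisors R" by (rule T.S_mult[OF T.S_one ab(2)])
  have "T.fr u \<one> \<otimes>\<^bsub>T.L\<^esub> T.fr a b = T.fr \<zero> (\<one> \<otimes> b)"
    unfolding T.lfrac_mult[OF uc T.S_one ab(1,2)] u(2) ..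
  also have "\<dots> = \<zero>\<^bsub>T.L\<^esub>"
    unfolding T.lfrac_eq_zero_iff[OF zero_closed ob] using T.S_one by (intro bexI[of _ \<one>]) auto
  finally show ?thesis using u(1) unfolding ab(3) to_tot_frac_def tot_frac_def by blast
qed

text \<open>For \<open>D = 0\<close> the sections are the image of \<open>R\<close> by definition. Otherwise \<open>R\<close> is normal and membership is
  a family of pole conditions along the primes of height one.\<close>

lemma (in cring) div_sections_submodule:
  assumes normal: "D \<noteq> (\<lambda>_. 0) \<longrightarrow> noetherian_ring R \<and> normal_domain R" and D: "\<forall>Q. 0 \<le> D Q"
  shows "div_sections R D \<subseteq> carrier (tot_frac R)"
    and "\<And>a. a \<in> carrier R \<Longrightarrow> to_tot_frac R a \<in> div_sections R D"
    and "\<And>x y. x \<in> div_sections R D \<Longrightarrow> y \<in> div_sections R D \<Longrightarrow> x \<oplus>\<^bsub>tot_frac R\<^esub> y \<in> div_sections R D"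
    and "\<And>r x. r \<in> carrier R \<Longrightarrow> x \<in> div_sections R D \<Longrightarrow>
      to_tot_frac R r \<otimes>\<^bsub>tot_frac R\<^esub> x \<in> div_sections R D"
proof -
  note hom = to_tot_frac_hom
  show sub: "div_sections R D \<subseteq> carrier (tot_frac R)"
    using ring_hom_closed[OF hom] by (auto simp: div_sections_def)
  have "(\<forall>a\<in>carrier R. to_tot_frac R a \<in> div_sections R D) \<and>
    (\<forall>x\<in>div_sections R D. \<forall>y\<in>div_sections R D. x \<oplus>\<^bsub>tot_frac R\<^esub> y \<in> div_sections R D) \<and>
    (\<forall>r\<in>carrier R. \<forall>x\<in>div_sections R D. to_tot_frac R r \<otimes>\<^bsub>tot_frac R\<^esub> x \<in> div_sections R D)"
  proof (cases "D = (\<lambda>_. 0)")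
    case True
    then have im: "div_sections R D = to_tot_frac R ` carrier R" by (simp add: div_sections_def)
    show ?thesis unfolding im
      by (auto simp: ring_hom_add[OF hom, symmetric] ring_hom_mult[OF hom, symmetric])
  next
    case False
    have n: "noetherian_ring R" "normal_domain R" using normal False by auto
    interpret "domain" R using n(2) by (simp add: normal_domain_def)
    interpret T: localizing_domain R "nonzerodivisors R" by (rule localizing_domain_nonzerodivisors)
    obtain \<pi> where unif: "uniformizer_family R \<pi>"
      using ex_uniformizer_family[OF n] by blast
    note sec = section_iff[OF unif False D]
    have rep: "\<exists>a b. a \<in> carrier R \<and> b \<in> carrier R \<and> b \<noteq> \<zero> \<and> x = T.fr a b" if "x \<in> div_sections R D" for x
    proof -
      have "x \<in> carrier T.L" using sub that by (auto simp: tot_frac_def)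
      then obtain a b where "a \<in> carrier R" "b \<in> nonzerodivisors R" "x = T.fr a b" by (rule T.loc_cases)
      then show ?thesis unfolding nonzerodivisors_domain by blast
    qed
    have nz: "b \<in> nonzerodivisors R" if "b \<in> carrier R" "b \<noteq> \<zero>" for b
      using that by (simp add: nonzerodivisors_domain)
    show ?thesis
    proof (intro conjI ballI)
      fix a assume a: "a \<in> carrier R"
      have "pole_le R Q (\<pi> Q) (nat (D Q)) a \<one>" if Q: "primeideal Q R" "prime_height R Q = 1" for Q
      proof -
        interpret U: uniformizer R Q "\<pi> Q" by (rule uniformizer_familyD[OF unif Q])
        show ?thesis using U.loc.S_one a by (intro U.Q.pole_le_nonmember) auto
      qed
      then show "to_tot_frac R a \<in> div_sections R D"
        unfolding to_tot_frac_def using sec[OF a one_closed one_not_zero] by blast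
    next
      fix x y assume x: "x \<in> div_sections R D" and y: "y \<in> div_sections R D"
      obtain a b where ab: "a \<in> carrier R" "b \<in> carrier R" "b \<noteq> \<zero>" "x = T.fr a b" using rep[OF x] by blast
      obtain a' b' where ab': "a' \<in> carrier R" "b' \<in> carrier R" "b' \<noteq> \<zero>" "y = T.fr a' b'" using rep[OF y] by blast
      note px = iffD1[OF sec[OF ab(1-3)] x[unfolded ab(4)]] and py = iffD1[OF sec[OF ab'(1-3)] y[unfolded ab'(4)]]
      have "pole_le R Q (\<pi> Q) (nat (D Q)) (a \<otimes> b' \<oplus> a' \<otimes> b) (b \<otimes> b')"
        if Q: "primeideal Q R" "prime_height R Q = 1" for Q
      proof -
        interpret U: uniformizer R Q "\<pi> Q" by (rule uniformizer_familyD[OF unif Q])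
        show ?thesis using px py Q ab(1,2) ab'(1,2) by (intro U.Q.pole_le_add) auto
      qed
      moreover have "b \<otimes> b' \<noteq> \<zero>" using ab ab' integral by blast
      moreover have "a \<otimes> b' \<oplus> a' \<otimes> b \<in> carrier R" "b \<otimes> b' \<in> carrier R" using ab(1,2) ab'(1,2) by auto
      ultimately have "T.fr (a \<otimes> b' \<oplus> a' \<otimes> b) (b \<otimes> b') \<in> div_sections R D" using sec by blast
      then show "x \<oplus>\<^bsub>tot_frac R\<^esub> y \<in> div_sections R D"
        unfolding ab(4) ab'(4) tot_frac_def
          T.lfrac_add[OF ab(1) nz[OF ab(2,3)] ab'(1) nz[OF ab'(2,3)]] .
    next
      fix r x assume r: "r \<in> carrier R" and x: "x \<in> div_sections R D"
      obtain a b where ab: "a \<in> carrier R" "b \<in> carrier R" "b \<noteq> \<zero>" "x = T.fr a b" using rep[OF x] by blast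
      note px = iffD1[OF sec[OF ab(1-3)] x[unfolded ab(4)]]
      have "pole_le R Q (\<pi> Q) (nat (D Q)) (r \<otimes> a) b"
        if Q: "primeideal Q R" "prime_height R Q = 1" for Q
      proof -
        interpret U: uniformizer R Q "\<pi> Q" by (rule uniformizer_familyD[OF unif Q])
        show ?thesis using px Q r ab(1,2) by (intro U.Q.pole_le_mult) auto
      qed
      then have "T.fr (r \<otimes> a) b \<in> div_sections R D" using sec[OF m_closed[OF r ab(1)] ab(2,3)] by blast
      then show "to_tot_frac R r \<otimes>\<^bsub>tot_frac R\<^esub> x \<in> div_sections R D"
        unfolding ab(4) tot_frac_def to_tot_frac_def T.lfrac_mult[OF r T.S_one ab(1) nz[OF ab(2,3)]]
        using ab(2) by simp
    qed
  qed
  then show "\<And>a. a \<in> carrier R \<Longrightarrow> to_tot_frac R a \<in> div_sections R D"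
    and "\<And>x y. x \<in> div_sections R D \<Longrightarrow> y \<in> div_sections R D \<Longrightarrow> x \<oplus>\<^bsub>tot_frac R\<^esub> y \<in> div_sections R D"
    and "\<And>r x. r \<in> carrier R \<Longrightarrow> x \<in> div_sections R D \<Longrightarrow>
      to_tot_frac R r \<otimes>\<^bsub>tot_frac R\<^esub> x \<in> div_sections R D" by blast+
qed

lemma ceil_mult_nonneg:
  assumes "\<forall>Q. 0 \<le> \<Delta> Q"
  shows "\<forall>Q. 0 \<le> ceil_mult k \<Delta> Q"
proof
  fix Q
  have "\<lceil>0::real\<rceil> \<le> \<lceil>real k * \<Delta> Q\<rceil>" using assms by (intro ceiling_mono) simp
  then show "0 \<le> ceil_mult k \<Delta> Q" by (simp add: ceil_mult_def)
qed

text \<open>The module \<open>R\<^sub>P(D)\<close> is contained in the localization of \<open>R(D)\<close> at \<open>P\<close>. In the divisorial case a section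
  over \<open>R\<^sub>P\<close> is a fraction of elements of \<open>R\<close> that satisfies the pole conditions along the primes
  \<open>Q \<subseteq> P\<close>, as these are contracted from the primes \<open>Q R\<^sub>P\<close>; a factor outside \<open>P\<close> enforces the
  conditions along the remaining primes.\<close>

lemma (in primeideal) local_section_clearable:
  assumes normal: "ceil_mult k \<Delta> \<noteq> (\<lambda>_. 0) \<longrightarrow> noetherian_ring R \<and> normal_domain R"
    and \<Delta>: "\<forall>Q. 0 \<le> \<Delta> Q"
    and x: "x \<in> div_sections (loc_at R I) (ceil_mult k (restrict_divisor R I \<Delta>))"
  shows "\<exists>s\<in>carrier R - I. \<exists>y\<in>div_sections R (ceil_mult k \<Delta>).
    frac_to_loc R I y = to_tot_frac (loc_at R I) (to_loc_at R I s) \<otimes>\<^bsub>tot_frac (loc_at R I)\<^esub> x"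
proof -
  let ?D = "ceil_mult k \<Delta>" and ?D' = "ceil_mult k (restrict_divisor R I \<Delta>)"
  interpret loc: localizing R "carrier R - I" by (rule localizing_compl)
  interpret A: cring "loc_at R I" by (rule loc_at_cring)
  interpret T': localizing "loc_at R I" "nonzerodivisors (loc_at R I)" by (rule A.localizing_nonzerodivisors)
  have D: "\<forall>Q. 0 \<le> ?D Q" by (rule ceil_mult_nonneg[OF \<Delta>])
  note sections = div_sections_submodule[OF normal D]
  show ?thesis
  proof (cases "?D' = (\<lambda>_. 0)")
    case True
    then obtain z where z: "z \<in> carrier (loc_at R I)" "x = to_tot_frac (loc_at R I) z"
      using x by (auto simp: div_sections_def)
    obtain a s where as: "a \<in> carrier R" "s \<in> carrier R - I" "z = loc.fr a s"
      using z(1) unfolding loc_at_def by (rule loc.loc_cases)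
    have sc: "s \<in> carrier R" using as by blast
    have "to_loc_at R I a = to_loc_at R I s \<otimes>\<^bsub>loc_at R I\<^esub> z"
      unfolding as(3) to_loc_at_def loc_at_def loc.lfrac_mult_denominator[OF as(1,2)] ..
    then have "frac_to_loc R I (to_tot_frac R a) =
        to_tot_frac (loc_at R I) (to_loc_at R I s) \<otimes>\<^bsub>tot_frac (loc_at R I)\<^esub> x"
      unfolding frac_to_loc_to_tot_frac[OF as(1)] z(2)
      using ring_hom_mult[OF A.to_tot_frac_hom ring_hom_closed[OF to_loc_at_hom sc] z(1)] by simp
    then show ?thesis using as(2) sections(2)[OF as(1)] by blast
  next
    case False
    have D_nz: "?D \<noteq> (\<lambda>_. 0)"
    proof
      assume "?D = (\<lambda>_. 0)"
      then have "\<lceil>real k * \<Delta> Q\<rceil> = 0" for Q unfolding ceil_mult_def by meson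
      then have "?D' = (\<lambda>_. 0)" by (auto simp: ceil_mult_def restrict_divisor_def)
      then show False using False by simp
    qed
    have n: "noetherian_ring R" "normal_domain R" using normal D_nz by auto
    interpret dR: "domain" R using n(2) by (simp add: normal_domain_def)
    interpret locd: localizing_domain R "carrier R - I" by (rule dR.localizing_domain_compl[OF primeideal])
    have locL: "loc_at R I = loc.L" by (simp add: loc_at_def)
    interpret A: "domain" "loc_at R I" unfolding locL by (rule locd.loc_domain)
    interpret T': localizing_domain "loc_at R I" "nonzerodivisors (loc_at R I)"
      by (rule A.localizing_domain_nonzerodivisors)
    obtain \<pi> where unif: "uniformizer_family R \<pi>"
      using dR.ex_uniformizer_family[OF n] by blast
    have xc: "x \<in> carrier T'.L" using x False by (simp add: div_sections_def tot_frac_def)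
    obtain z w where zw: "z \<in> carrier (loc_at R I)" "w \<in> nonzerodivisors (loc_at R I)" "x = T'.fr z w"
      using xc by (rule T'.loc_cases)
    have wc: "w \<in> carrier (loc_at R I)" "w \<noteq> \<zero>\<^bsub>loc_at R I\<^esub>" using zw(2) by (auto simp: A.nonzerodivisors_domain)
    obtain a s where as: "a \<in> carrier R" "s \<in> carrier R - I" "z = loc.fr a s"
      using zw(1) unfolding loc_at_def by (rule loc.loc_cases)
    obtain b t where bt: "b \<in> carrier R" "t \<in> carrier R - I" "w = loc.fr b t"
      using wc(1) unfolding loc_at_def by (rule loc.loc_cases)
    have st: "s \<in> carrier R" "t \<in> carrier R" "s \<noteq> \<zero>" "t \<noteq> \<zero>"
      using as(2) bt(2) zero_closed by auto
    have b0: "b \<noteq> \<zero>" using wc(2) bt locd.lfrac_zero_iff[OF bt(1,2)] by (simp add: loc_at_def)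
    let ?h = "to_loc_at R I"
    note h = to_loc_at_hom
    let ?a = "a \<otimes> t" and ?b = "b \<otimes> s"
    have abc: "?a \<in> carrier R" "?b \<in> carrier R" "?b \<noteq> \<zero>" using as(1) bt(1) st b0 dR.integral by auto
    have hc: "?h r \<in> carrier (loc_at R I)" if "r \<in> carrier R" for r using ring_hom_closed[OF h that] .
    have bn: "?b \<in> nonzerodivisors R" using abc by (simp add: dR.nonzerodivisors_domain)
    have hbn: "?h ?b \<in> nonzerodivisors (loc_at R I)" using to_loc_nonzerodivisors bn by blast
    have x_eq: "x = T'.fr (?h ?a) (?h ?b)"
      unfolding zw(3)
    proof (rule T'.lfrac_eqI[OF zw(1,2) hc[OF abc(1)] hbn])
      have hs: "?h s \<otimes>\<^bsub>loc_at R I\<^esub> z = ?h a" and ht: "?h t \<otimes>\<^bsub>loc_at R I\<^esub> w = ?h b"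
        unfolding as(3) bt(3) to_loc_at_def loc_at_def
        using loc.lfrac_mult_denominator[OF as(1,2)] loc.lfrac_mult_denominator[OF bt(1,2)] by simp_all
      show "z \<otimes>\<^bsub>loc_at R I\<^esub> ?h ?b = ?h ?a \<otimes>\<^bsub>loc_at R I\<^esub> w"
        unfolding ring_hom_mult[OF h as(1) st(2)] ring_hom_mult[OF h bt(1) st(1)] hs[symmetric] ht[symmetric]
        using zw(1) wc(1) hc[OF st(1)] hc[OF st(2)] by (simp add: A.m_ac)
    qed
    have "pole_le R Q (\<pi> Q) (nat (?D Q)) ?a ?b"
      if Q: "primeideal Q R" "prime_height R Q = 1" "Q \<subseteq> I" for Q
    proof -
      interpret Q: primeideal Q R by fact
      interpret U: uniformizer R Q "\<pi> Q" by (rule uniformizer_familyD[OF unif Q(1,2)])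
      interpret NP: nested_primes R I Q by unfold_locales (rule Q(3))
      have D'Q: "?D' (extend_prime R I Q) = ?D Q"
        using NP.primeideal_extend_prime NP.contract_extend_prime
        by (simp add: ceil_mult_def restrict_divisor_def loc_at_def)
      have "pole_le (loc_at R I) (extend_prime R I Q) (?h (\<pi> Q)) (nat (?D' (extend_prime R I Q))) (?h ?a) (?h ?b)"
      proof (rule A.pole_le_of_section)
        show "T'.fr (?h ?a) (?h ?b) \<in> div_sections (loc_at R I) ?D'" using x unfolding x_eq .
        show "?D' \<noteq> (\<lambda>_. 0)" by fact
        show "uniformizer (loc_at R I) (extend_prime R I Q) (?h (\<pi> Q))"
          using NP.uniformizer_extend_prime[OF U.uniformizer_axioms] by (simp add: loc_at_def to_loc_at_def)
        show "prime_height (loc_at R I) (extend_prime R I Q) = 1"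
          using NP.height_extend_prime[OF Q(2)] by (simp add: loc_at_def)
        show "0 \<le> ?D' (extend_prime R I Q)" unfolding D'Q using D by blast
        show "?h ?a \<in> carrier (loc_at R I)" "?h ?b \<in> carrier (loc_at R I)" using hc abc by auto
        show "?h ?b \<noteq> \<zero>\<^bsub>loc_at R I\<^esub>" using hbn by (simp add: A.nonzerodivisors_domain)
      qed
      then show ?thesis
        unfolding D'Q to_loc_at_def loc_at_def by (rule NP.pole_le_contract[OF _ U.unif_carr abc(1,2)])
    qed
    then have "\<exists>r\<in>carrier R - I. \<forall>Q. primeideal Q R \<and> prime_height R Q = 1 \<longrightarrow>
        pole_le R Q (\<pi> Q) (nat (?D Q)) (r \<otimes> ?a) ?b"
      by (rule dR.clear_poles_away_from[OF n(1) primeideal unif abc])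
    then obtain r where r: "r \<in> carrier R - I"
      "\<And>Q. primeideal Q R \<Longrightarrow> prime_height R Q = 1 \<Longrightarrow> pole_le R Q (\<pi> Q) (nat (?D Q)) (r \<otimes> ?a) ?b" by blast
    have rc: "r \<in> carrier R" using r by blast
    have "lfrac R (nonzerodivisors R) (r \<otimes> ?a) ?b \<in> div_sections R ?D"
      using dR.section_iff[OF unif D_nz D m_closed[OF rc abc(1)] abc(2,3)] r(2) by blast
    moreover have "frac_to_loc R I (lfrac R (nonzerodivisors R) (r \<otimes> ?a) ?b) =
        to_tot_frac (loc_at R I) (?h r) \<otimes>\<^bsub>tot_frac (loc_at R I)\<^esub> x"
      unfolding frac_to_loc_lfrac[OF m_closed[OF rc abc(1)] bn] x_eq tot_frac_def to_tot_frac_def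
        T'.lfrac_mult[OF hc[OF rc] T'.S_one hc[OF abc(1)] hbn] ring_hom_mult[OF h rc abc(1)]
      using hc[OF abc(2)] by simp
    ultimately show ?thesis using r(1) by blast
  qed
qed

section \<open>Centers of sharp F-purity are compatible with splittings\<close>

text \<open>If \<open>\<phi>\<close> took a value outside \<open>P\<close> at \<open>d f\<close>, this value would be a unit of \<open>R\<^sub>P\<close>, and dividing the
  localized map by it would split the map \<open>1 \<mapsto> d f\<close> over \<open>R\<^sub>P\<close>, which the definition of a center
  forbids.\<close>

lemma center_compatible:
  assumes base: "base_ring p R" and triple: "is_triple R \<Delta> \<aa>"
    and center: "center_sharp_F_purity p R \<Delta> \<aa> P"
    and e: "0 < e" and d: "d \<in> \<aa> (p ^ e - 1)"
    and phi: "\<phi> \<in> linear_maps R (frob_push p e R (div_module R (ceil_mult (p ^ e - 1) \<Delta>))) (self_module R)"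
    and f: "f \<in> P"
  shows "\<phi> (to_tot_frac R (d \<otimes>\<^bsub>R\<^esub> f)) \<in> P"
proof (rule ccontr)
  assume not_in: "\<phi> (to_tot_frac R (d \<otimes>\<^bsub>R\<^esub> f)) \<notin> P"
  let ?D = "ceil_mult (p ^ e - 1) \<Delta>" and ?D' = "ceil_mult (p ^ e - 1) (restrict_divisor R P \<Delta>)"
  have noeth: "noetherian_ring R" and p: "0 < p ^ e"
    using base prime_gt_0_nat by (auto simp: base_ring_def)
  interpret P: primeideal P R using center by (simp add: center_sharp_F_purity_def)
  interpret A: cring "loc_at R P" by (rule P.loc_at_cring)
  have \<Delta>: "\<forall>Q. 0 \<le> \<Delta> Q" using triple by (simp add: is_triple_def effective_R_divisor_def)
  have normal: "?D \<noteq> (\<lambda>_. 0) \<longrightarrow> noetherian_ring R \<and> normal_domain R"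
  proof
    assume "?D \<noteq> (\<lambda>_. 0)"
    then have "\<Delta> \<noteq> (\<lambda>_. 0)" by (auto simp: ceil_mult_def)
    then show "noetherian_ring R \<and> normal_domain R" using triple noeth by (simp add: is_triple_def)
  qed
  have D: "\<forall>Q. 0 \<le> ?D Q" by (rule ceil_mult_nonneg[OF \<Delta>])
  note sections = P.div_sections_submodule[OF normal D]
  have "ideal (\<aa> (p ^ e - 1)) R" using triple by (simp add: is_triple_def graded_system_def)
  then have dc: "d \<in> carrier R" using d by (rule ideal.Icarr)
  have fc: "f \<in> carrier R" using f by (rule P.Icarr)
  have carr: "carrier (div_module R ?D) = div_sections R ?D" by (simp add: div_module_def)
  interpret C: cartier_map R P "tot_frac R" "tot_frac (loc_at R P)" "to_tot_frac R" "frac_to_loc R P"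
    "to_tot_frac (loc_at R P)" "p ^ e" "div_sections R ?D" \<phi>
  proof (intro cartier_map.intro cartier_map_axioms.intro P.is_cring P.primeideal P.tot_frac_cring A.tot_frac_cring
      P.to_tot_frac_hom A.to_tot_frac_hom P.frac_to_loc_hom P.frac_to_loc_to_tot_frac P.frac_to_loc_kernel p sections)
    fix x assume x: "x \<in> div_sections R ?D"
    then show "\<phi> x \<in> carrier R"
      using phi by (auto simp: linear_maps_def frob_push_def div_module_def self_module_def)
    show "\<phi> (x \<oplus>\<^bsub>tot_frac R\<^esub> y) = \<phi> x \<oplus>\<^bsub>R\<^esub> \<phi> y" if "y \<in> div_sections R ?D" for y
      using phi x that by (auto simp: linear_maps_def frob_push_def div_module_def self_module_def)
    show "\<phi> (to_tot_frac R (r [^]\<^bsub>R\<^esub> (p ^ e)) \<otimes>\<^bsub>tot_frac R\<^esub> x) = r \<otimes>\<^bsub>R\<^esub> \<phi> x" if "r \<in> carrier R" for r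
      using phi x that by (auto simp: linear_maps_def frob_push_def div_module_def self_module_def)
  qed
  have dfc: "d \<otimes>\<^bsub>R\<^esub> f \<in> carrier R" using dc fc by simp
  obtain \<Phi> where Phi: "\<And>x. x \<in> C.clearable \<Longrightarrow> \<Phi> x \<in> carrier C.loc.L"
    "\<And>x x'. x \<in> C.clearable \<Longrightarrow> x' \<in> C.clearable \<Longrightarrow>
      \<Phi> (x \<oplus>\<^bsub>tot_frac (loc_at R P)\<^esub> x') = \<Phi> x \<oplus>\<^bsub>C.loc.L\<^esub> \<Phi> x'"
    "\<And>r x. r \<in> carrier C.loc.L \<Longrightarrow> x \<in> C.clearable \<Longrightarrow>
      \<Phi> (to_tot_frac (loc_at R P) (r [^]\<^bsub>C.loc.L\<^esub> (p ^ e)) \<otimes>\<^bsub>tot_frac (loc_at R P)\<^esub> x) = r \<otimes>\<^bsub>C.loc.L\<^esub> \<Phi> x"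
    "\<And>r. r \<in> carrier C.loc.L \<Longrightarrow>
      \<Phi> (to_tot_frac (loc_at R P) (r [^]\<^bsub>C.loc.L\<^esub> (p ^ e)) \<otimes>\<^bsub>tot_frac (loc_at R P)\<^esub>
        frac_to_loc R P (to_tot_frac R (d \<otimes>\<^bsub>R\<^esub> f))) = r"
    using C.splitting_from_unit_value[OF sections(2)[OF dfc] not_in] by blast
  have sub: "div_sections (loc_at R P) ?D' \<subseteq> C.clearable"
  proof
    fix x assume x: "x \<in> div_sections (loc_at R P) ?D'"
    have "x \<in> carrier (tot_frac (loc_at R P))"
      using x ring_hom_closed[OF A.to_tot_frac_hom] by (auto simp: div_sections_def split: if_splits)
    then show "x \<in> C.clearable"
      using P.local_section_clearable[OF normal \<Delta> x]
      unfolding C.clearable_def C.cleared_def to_loc_at_def by blast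
  qed
  have L: "loc_at R P = C.loc.L" by (simp add: loc_at_def)
  have w: "frac_to_loc R P (to_tot_frac R (d \<otimes>\<^bsub>R\<^esub> f)) =
      to_tot_frac (loc_at R P) (to_loc_at R P f \<otimes>\<^bsub>loc_at R P\<^esub> to_loc_at R P d)"
    unfolding P.frac_to_loc_to_tot_frac[OF dfc]
    unfolding P.m_comm[OF dc fc] ring_hom_mult[OF P.to_loc_at_hom fc dc] ..
  have "splits_at (loc_at R P) (frob_push p e (loc_at R P) (div_module (loc_at R P) ?D'))
      (to_tot_frac (loc_at R P) (to_loc_at R P f \<otimes>\<^bsub>loc_at R P\<^esub> to_loc_at R P d))"
    unfolding splits_at_def
  proof (rule bexI[of _ \<Phi>])
    show "\<forall>r\<in>carrier (loc_at R P).
        \<Phi> (r \<odot>\<^bsub>frob_push p e (loc_at R P) (div_module (loc_at R P) ?D')\<^esub>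
          to_tot_frac (loc_at R P) (to_loc_at R P f \<otimes>\<^bsub>loc_at R P\<^esub> to_loc_at R P d)) = r"
      using Phi(4) unfolding L[symmetric] w by (simp add: frob_push_def div_module_def)
    show "\<Phi> \<in> linear_maps (loc_at R P) (frob_push p e (loc_at R P) (div_module (loc_at R P) ?D'))
        (self_module (loc_at R P))"
      using Phi(1-3) sub unfolding L[symmetric]
      by (auto simp: linear_maps_def frob_push_def div_module_def self_module_def subset_iff)
  qed
  moreover have "to_loc_at R P f \<in> loc_max R P"
    unfolding loc_max_def to_loc_at_def using f C.loc.S_one by blast
  ultimately show False using center e d unfolding center_sharp_F_purity_def by blast
qed

text \<open>The map induced by \<open>\<theta>\<close> on cosets is well defined because \<open>\<theta> a - \<theta> b = \<theta> (a - b)\<close> lies in \<open>I\<close>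
  whenever \<open>a - b\<close> does.\<close>

lemma (in ideal) F_pure_quotient:
  assumes "cring R"
    and closed: "\<And>x. x \<in> carrier R \<Longrightarrow> \<theta> x \<in> carrier R"
    and add: "\<And>x y. x \<in> carrier R \<Longrightarrow> y \<in> carrier R \<Longrightarrow> \<theta> (x \<oplus> y) = \<theta> x \<oplus> \<theta> y"
    and semilinear: "\<And>r x. r \<in> carrier R \<Longrightarrow> x \<in> carrier R \<Longrightarrow> \<theta> (r [^] p \<otimes> x) = r \<otimes> \<theta> x"
    and one: "\<theta> \<one> = \<one>"
    and stable: "\<And>x. x \<in> I \<Longrightarrow> \<theta> x \<in> I"
  shows "F_pure p (R Quot I)"
proof -
  interpret cring R by fact
  interpret K: cring "R Quot I" by (rule quotient_is_cring) fact
  note hom = rcos_ring_hom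
  have carr: "carrier (R Quot I) = (\<lambda>x. I +> x) ` carrier R"
    by (auto simp: FactRing_def A_RCOSETS_def')
  have indep: "I +> \<theta> a = I +> \<theta> b" if c: "a \<in> carrier R" "b \<in> carrier R" and eq: "I +> a = I +> b" for a b
  proof -
    have ab: "a \<ominus> b \<in> I" using quotient_eq_iff_same_a_r_cos[OF is_ideal c] eq by simp
    have "a = (a \<ominus> b) \<oplus> b" using c by (simp add: a_minus_def a_assoc l_neg)
    then have "\<theta> a = \<theta> (a \<ominus> b) \<oplus> \<theta> b" using add[of "a \<ominus> b" b] c by simp
    then have "\<theta> a \<ominus> \<theta> b = \<theta> (a \<ominus> b)"
      using closed c by (simp add: a_minus_def a_assoc r_neg)
    then have "\<theta> a \<ominus> \<theta> b \<in> I" using stable[OF ab] by simp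
    then show ?thesis using quotient_eq_iff_same_a_r_cos[OF is_ideal closed[OF c(1)] closed[OF c(2)]] by simp
  qed
  define \<Theta> where "\<Theta> C = I +> \<theta> (SOME x. x \<in> carrier R \<and> C = I +> x)" for C
  have Theta: "\<Theta> (I +> x) = I +> \<theta> x" if x: "x \<in> carrier R" for x
  proof -
    have "(SOME y. y \<in> carrier R \<and> I +> x = I +> y) \<in> carrier R \<and>
        I +> x = I +> (SOME y. y \<in> carrier R \<and> I +> x = I +> y)"
      by (rule someI[of "\<lambda>y. y \<in> carrier R \<and> I +> x = I +> y" x]) (use x in simp)
    then show ?thesis unfolding \<Theta>_def using indep x by metis
  qed
  have pow: "(I +> r) [^]\<^bsub>R Quot I\<^esub> (n::nat) = I +> (r [^] n)" if "r \<in> carrier R" for r n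
    using that by (induction n) (simp_all add: ring_hom_one[OF hom] ring_hom_mult[OF hom])
  have "\<Theta> \<in> linear_maps (R Quot I) (frob_push p 1 (R Quot I) (self_module (R Quot I))) (self_module (R Quot I))"
    unfolding linear_maps_def
  proof (intro CollectI conjI ballI funcsetI)
    show "\<Theta> C \<in> carrier (self_module (R Quot I))"
      if "C \<in> carrier (frob_push p 1 (R Quot I) (self_module (R Quot I)))" for C
      using that closed by (auto simp: frob_push_def self_module_def carr Theta)
    show "\<Theta> (C \<oplus>\<^bsub>frob_push p 1 (R Quot I) (self_module (R Quot I))\<^esub> C') =
        \<Theta> C \<oplus>\<^bsub>self_module (R Quot I)\<^esub> \<Theta> C'"
      if CC': "C \<in> carrier (frob_push p 1 (R Quot I) (self_module (R Quot I)))"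
        "C' \<in> carrier (frob_push p 1 (R Quot I) (self_module (R Quot I)))" for C C'
    proof -
      obtain x y where xy: "x \<in> carrier R" "y \<in> carrier R" "C = I +> x" "C' = I +> y"
        using CC' by (auto simp: frob_push_def self_module_def carr)
      have "\<Theta> (C \<oplus>\<^bsub>R Quot I\<^esub> C') = \<Theta> C \<oplus>\<^bsub>R Quot I\<^esub> \<Theta> C'"
        unfolding xy(3,4) ring_hom_add[OF hom xy(1,2), symmetric] Theta[OF xy(1)] Theta[OF xy(2)]
          Theta[OF a_closed[OF xy(1,2)]] add[OF xy(1,2)]
        by (rule ring_hom_add[OF hom closed[OF xy(1)] closed[OF xy(2)]])
      then show ?thesis by (simp add: frob_push_def self_module_def)
    qed
    show "\<Theta> (c \<odot>\<^bsub>frob_push p 1 (R Quot I) (self_module (R Quot I))\<^esub> C) =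
        c \<odot>\<^bsub>self_module (R Quot I)\<^esub> \<Theta> C"
      if cC: "c \<in> carrier (R Quot I)"
        "C \<in> carrier (frob_push p 1 (R Quot I) (self_module (R Quot I)))" for c C
    proof -
      obtain r x where rx: "r \<in> carrier R" "x \<in> carrier R" "c = I +> r" "C = I +> x"
        using cC by (auto simp: frob_push_def self_module_def carr)
      have rp: "r [^] p \<in> carrier R" using rx(1) by simp
      have "\<Theta> (c [^]\<^bsub>R Quot I\<^esub> p \<otimes>\<^bsub>R Quot I\<^esub> C) = c \<otimes>\<^bsub>R Quot I\<^esub> \<Theta> C"
        unfolding rx(3,4) pow[OF rx(1)] ring_hom_mult[OF hom rp rx(2), symmetric] Theta[OF rx(2)]
          Theta[OF m_closed[OF rp rx(2)]] semilinear[OF rx(1,2)]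
        by (rule ring_hom_mult[OF hom rx(1) closed[OF rx(2)]])
      then show ?thesis by (simp add: frob_push_def self_module_def)
    qed
  qed
  moreover have "\<Theta> (c \<odot>\<^bsub>frob_push p 1 (R Quot I) (self_module (R Quot I))\<^esub> \<one>\<^bsub>R Quot I\<^esub>) = c"
    if "c \<in> carrier (R Quot I)" for c
  proof -
    from that obtain r where r: "r \<in> carrier R" "c = I +> r" unfolding carr by (rule imageE) simp
    have rp: "r [^] p \<in> carrier R" using r(1) by simp
    have "\<Theta> (c [^]\<^bsub>R Quot I\<^esub> p \<otimes>\<^bsub>R Quot I\<^esub> \<one>\<^bsub>R Quot I\<^esub>) = c"
      unfolding r(2) pow[OF r(1)] ring_hom_one[OF hom, symmetric] ring_hom_mult[OF hom rp one_closed, symmetric]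
        Theta[OF m_closed[OF rp one_closed]] semilinear[OF r(1) one_closed] one
      using r(1) by simp
    then show ?thesis by (simp add: frob_push_def self_module_def)
  qed
  ultimately show ?thesis unfolding F_pure_def splits_at_def by blast
qed

theorem theorem7p1:
  fixes R :: "('a, 'm) ring_scheme"
    and p n :: nat
    and \<Delta> :: "'a set \<Rightarrow> real"
    and \<aa> :: "nat \<Rightarrow> 'a set"
    and P :: "nat \<Rightarrow> 'a set"
  assumes "base_ring p R"
    and "is_triple R \<Delta> \<aa>"
    and "sharply_F_pure p R \<Delta> \<aa>"
    and "n \<ge> 1"
    and "\<And>i. i \<in> {1..n} \<Longrightarrow> center_sharp_F_purity p R \<Delta> \<aa> (P i)"
  shows "F_pure p (R Quot (\<Inter>i\<in>{1..n}. P i))"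
proof -
  interpret cring R using assms(1) by (simp add: base_ring_def)
  have p: "Factorial_Ring.prime p" "[p] \<cdot>\<^bsub>R\<^esub> \<one>\<^bsub>R\<^esub> = \<zero>\<^bsub>R\<^esub>" and noeth: "noetherian_ring R"
    using assms(1) by (auto simp: base_ring_def)
  obtain e d \<phi> where e: "0 < e" and d: "d \<in> \<aa> (p ^ e - 1)"
    and phi: "\<phi> \<in> linear_maps R (frob_push p e R (div_module R (ceil_mult (p ^ e - 1) \<Delta>))) (self_module R)"
    and split: "\<And>r. r \<in> carrier R \<Longrightarrow>
      \<phi> (r \<odot>\<^bsub>frob_push p e R (div_module R (ceil_mult (p ^ e - 1) \<Delta>))\<^esub> to_tot_frac R d) = r"
    using assms(3) unfolding sharply_F_pure_def splits_at_def by blast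
  let ?D = "ceil_mult (p ^ e - 1) \<Delta>" and ?i = "to_tot_frac R"
  have \<Delta>: "\<forall>Q. 0 \<le> \<Delta> Q" using assms(2) by (simp add: is_triple_def effective_R_divisor_def)
  have normal: "?D \<noteq> (\<lambda>_. 0) \<longrightarrow> noetherian_ring R \<and> normal_domain R"
  proof
    assume "?D \<noteq> (\<lambda>_. 0)"
    then have "\<Delta> \<noteq> (\<lambda>_. 0)" by (auto simp: ceil_mult_def)
    then show "noetherian_ring R \<and> normal_domain R" using assms(2) noeth by (simp add: is_triple_def)
  qed
  have D: "\<forall>Q. 0 \<le> ?D Q" by (rule ceil_mult_nonneg[OF \<Delta>])
  note sections = div_sections_submodule[OF normal D]
  have "ideal (\<aa> (p ^ e - 1)) R" using assms(2) by (simp add: is_triple_def graded_system_def)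
  then have dc: "d \<in> carrier R" using d by (rule ideal.Icarr)
  have phi_closed: "\<phi> x \<in> carrier R"
    and phi_add: "y \<in> div_sections R ?D \<Longrightarrow> \<phi> (x \<oplus>\<^bsub>tot_frac R\<^esub> y) = \<phi> x \<oplus>\<^bsub>R\<^esub> \<phi> y"
    and phi_smult: "r \<in> carrier R \<Longrightarrow> \<phi> (?i (r [^]\<^bsub>R\<^esub> (p ^ e)) \<otimes>\<^bsub>tot_frac R\<^esub> x) = r \<otimes>\<^bsub>R\<^esub> \<phi> x"
    if "x \<in> div_sections R ?D" for x y r
    using phi that by (auto simp: linear_maps_def frob_push_def div_module_def self_module_def)
  define \<psi> where "\<psi> x = \<phi> (?i (d \<otimes>\<^bsub>R\<^esub> x))" for x
  have psi_closed: "\<psi> x \<in> carrier R" if "x \<in> carrier R" for x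
    unfolding \<psi>_def using that dc by (intro phi_closed sections(2)) auto
  have psi_add: "\<psi> (x \<oplus>\<^bsub>R\<^esub> y) = \<psi> x \<oplus>\<^bsub>R\<^esub> \<psi> y" if "x \<in> carrier R" "y \<in> carrier R" for x y
    unfolding \<psi>_def using that dc phi_add[OF sections(2) sections(2), of "d \<otimes>\<^bsub>R\<^esub> x" "d \<otimes>\<^bsub>R\<^esub> y"]
    by (simp add: r_distr ring_hom_add[OF to_tot_frac_hom])
  have psi_smult: "\<psi> (r [^]\<^bsub>R\<^esub> (p ^ e) \<otimes>\<^bsub>R\<^esub> x) = r \<otimes>\<^bsub>R\<^esub> \<psi> x" if "r \<in> carrier R" "x \<in> carrier R" for r x
  proof -
    have "d \<otimes>\<^bsub>R\<^esub> (r [^]\<^bsub>R\<^esub> (p ^ e) \<otimes>\<^bsub>R\<^esub> x) = r [^]\<^bsub>R\<^esub> (p ^ e) \<otimes>\<^bsub>R\<^esub> (d \<otimes>\<^bsub>R\<^esub> x)"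
      using that dc by (intro m_lcomm) auto
    then show ?thesis
      unfolding \<psi>_def using that dc
      by (simp add: ring_hom_mult[OF to_tot_frac_hom, of _ "d \<otimes>\<^bsub>R\<^esub> x"] phi_smult[OF sections(2)])
  qed
  have psi_one: "\<psi> \<one>\<^bsub>R\<^esub> = \<one>\<^bsub>R\<^esub>"
    using split[OF one_closed] dc ring_hom_mult[OF to_tot_frac_hom one_closed dc]
    by (simp add: \<psi>_def frob_push_def div_module_def)
  \<comment> \<open>The map \<open>\<psi>\<close> splits the \<open>e\<close>-fold Frobenius; composed with the \<open>(e - 1)\<close>-fold Frobenius it splits
  the Frobenius itself.\<close>
  define \<theta> where "\<theta> x = \<psi> (x [^]\<^bsub>R\<^esub> (p ^ (e - 1)))" for x
  let ?I = "\<Inter>i\<in>{1..n}. P i"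
  have ideals: "ideal (P i) R" if "i \<in> {1..n}" for i
    using assms(5)[OF that] by (simp add: center_sharp_F_purity_def primeideal.axioms(1))
  have "ideal (\<Inter>(P ` {1..n})) R"
    using assms(4) ideals by (intro i_Intersect) auto
  then interpret I: ideal ?I R .
  have pe: "p ^ e = p * p ^ (e - 1)" using e by (metis Suc_diff_1 power_Suc)
  have q: "p ^ (e - 1) \<noteq> 0" using p(1) prime_gt_0_nat by auto
  show ?thesis
  proof (rule I.F_pure_quotient[of \<theta>])
    show "cring R" by (rule is_cring)
    show "\<theta> x \<in> carrier R" if "x \<in> carrier R" for x using that by (simp add: \<theta>_def psi_closed)
    show "\<theta> (x \<oplus>\<^bsub>R\<^esub> y) = \<theta> x \<oplus>\<^bsub>R\<^esub> \<theta> y" if "x \<in> carrier R" "y \<in> carrier R" for x y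
      using that by (simp add: \<theta>_def frobenius_pow_add[OF p] psi_add)
    show "\<theta> (r [^]\<^bsub>R\<^esub> p \<otimes>\<^bsub>R\<^esub> x) = r \<otimes>\<^bsub>R\<^esub> \<theta> x" if "r \<in> carrier R" "x \<in> carrier R" for r x
      using that psi_smult[OF that(1), of "x [^]\<^bsub>R\<^esub> (p ^ (e - 1))"]
      by (simp add: \<theta>_def nat_pow_distrib nat_pow_pow pe)
    show "\<theta> \<one>\<^bsub>R\<^esub> = \<one>\<^bsub>R\<^esub>" by (simp add: \<theta>_def psi_one)
    show "\<theta> x \<in> ?I" if x: "x \<in> ?I" for x
    proof
      fix i assume i: "i \<in> {1..n}"
      have xP: "x \<in> P i" using x i by blast
      have xc: "x \<in> carrier R" by (rule ideal.Icarr[OF ideals[OF i] xP])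
      obtain m where m: "p ^ (e - 1) = Suc m" using q not0_implies_Suc by blast
      have "x [^]\<^bsub>R\<^esub> (p ^ (e - 1)) \<in> P i"
        unfolding m nat_pow_Suc using xc by (intro ideal.I_l_closed[OF ideals[OF i] xP]) simp
      then show "\<theta> x \<in> P i"
        unfolding \<theta>_def \<psi>_def by (rule center_compatible[OF assms(1,2) assms(5)[OF i] e d phi])
    qed
  qed
qed

end
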